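(* 1) The $q$-Brownian motions (with $-1\le q\le 1$) lead for different $q$ to non-isomorphic continuous Bernoulli systems. 2) The Bożejko–Speicher generalized Brownian motions interpolating between the bosonic and fermionic relations lead for different $q$ to non-isomorphic continuous Bernoulli systems. That is, within each of the two families, if $q\ne q'$ then the continuous Bernoulli systems associated to $q$ and $q'$ are not isomorphic.
   Context: Intervals: $\mathcal{I}$ is the set of all $I=[s,t)$ with $-\infty<s<t<\infty$. Continuous Bernoulli system: $(\mathcal{A},\varphi,(\mathcal{A}_I)_{I\in\mathcal{I}})$ where $\mathcal{A}$ is a von Neumann algebra with separable predual, $\varphi$ is a faithful normal tracial state on $\mathcal{A}$, and $\mathcal{A}_I\subset\mathcal{A}$ are von Neumann subalgebras with (a) $\mathcal{A}=\bigvee\{\mathcal{A}_I: I\in\mathcal{I}\}$; (b) $\mathcal{A}_I\subset\mathcal{A}_J$ whenever $I\subset J$; (c) $\varphi(ab)=\varphi(a)\varphi(b)$ for $a\in\mathcal{A}_I$, $b\in\mathcal{A}_J$ whenever $I\cap J=\emptyset$. Two such systems $(\mathcal{A},\varphi,(\mathcal{A}_I))$ and $(\mathcal{B},\psi,(\mathcal{B}_I))$ are isomorphic if there is an isomorphism $\pi:\mathcal{A}\to\mathcal{B}$ with $\pi(\mathcal{A}_I)=\mathcal{B}_I$ for all $I\in\mathcal{I}$ and $\varphi=\psi\circ\pi$. Generalized Brownian motion: given a complex-valued function $\mathbf{t}$ on the set of all pair partitions of $\{1,\dots,2m\}$, $m\in\mathbb{N}$, it is a family of (possibly unbounded) symmetric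 field operators $\omega(f)$, depending linearly on real-valued $f\in L^2(\mathbb{R})$, with mixed moments $$\varphi(\omega(f_1)\cdots\omega(f_n))=\sum_{\pi}\mathbf{t}(\pi)\prod_{(i,j)\in\pi}\langle f_i,f_j\rangle ,$$ the sum being over all pair partitions $\pi$ of $\{1,\dots,n\}$ (and $0$ for $n$ odd), realized in the GNS representation with respect to $\varphi$. The associated continuous Bernoulli system has $\mathcal{A}_I$ equal to the von Neumann algebra generated by (in the unbounded case: the smallest one to which are affiliated the closures of) the $\omega(f)$ with $f$ supported in $I$, $\mathcal{A}=\bigvee_I\mathcal{A}_I$, and $\varphi$ the vacuum (GNS) vector state. Two pairs $(i,j),(k,l)$ of $\pi$ cross if $i<k<j<l$ or $k<i<l<j$; $\mathrm{cr}(\pi)$ is the number of unordered crossing pairs. $|\pi|$ is the number of pairs of $\pi$, and $\mathrm{cc}(\pi)$ is the number of connected components of the graph whose vertices are the pairs of $\pi$ and whose edges join crossing pairs. Family 1 ($q$-Brownian motion, $-1\le q\le1$): $\mathbf{t}(\pi)=q^{\mathrm{cr}(\pi)}$ (with $0^0=1$). Family 2 (Bożejko–Speicher interpolation, $-1\le q\le 1$): $\mathbf{t}(\pi)=q^{|\pi|-\mathrm{cc}(\pi)}$ for $0\le q\le1$ (with $0^0=1$), and $\mathbf{t}(\pi)=(-1)^{\mathrm{cr}(\pi)}|q|^{|\pi|-\mathrm{cc}(\pi)}$ for $-1\le q\le0$. For all these parameters these functions $\mathbf{t}$ define continuous Bernoulli systems. *)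

theory Defs
  imports "HOL-Analysis.Analysis"
begin

section \<open>Complex Hilbert spaces\<close>

class complex_vector = real_vector +
  fixes scaleC :: "complex \<Rightarrow> 'a \<Rightarrow> 'a" (infixr "*\<^sub>C" 75)
  assumes scaleC_add_right: "c *\<^sub>C (x + y) = c *\<^sub>C x + c *\<^sub>C y"
    and scaleC_add_left: "(c + d) *\<^sub>C x = c *\<^sub>C x + d *\<^sub>C x"
    and scaleC_scaleC: "c *\<^sub>C d *\<^sub>C x = (c * d) *\<^sub>C x"
    and scaleC_of_real: "complex_of_real r *\<^sub>C x = r *\<^sub>R x"

text \<open>The inner product is conjugate-linear in its first argument.\<close>

class complex_inner = complex_vector + real_normed_vector +
  fixes cinner :: "'a \<Rightarrow> 'a \<Rightarrow> complex"
  assumes cinner_commute: "cinner x y = cnj (cinner y x)"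
    and cinner_add_right: "cinner x (y + z) = cinner x y + cinner x z"
    and cinner_scaleC_right: "cinner x (c *\<^sub>C y) = c * cinner x y"
    and cinner_self: "cinner x x = complex_of_real ((norm x)\<^sup>2)"

class chilbert_space = complex_inner + complete_space

lemma vector_space_scaleC: "vector_space (scaleC :: complex \<Rightarrow> 'a::complex_vector \<Rightarrow> 'a)"
  by standard
    (simp_all add: scaleC_add_right scaleC_add_left scaleC_scaleC
      scaleC_of_real[of 1, simplified])

abbreviation cspan :: "'a::complex_vector set \<Rightarrow> 'a set" where
  "cspan \<equiv> module.span scaleC"

section \<open>Von Neumann algebras\<close>

text \<open>Operators are plain functions; sums and scalar multiples are taken pointwise, the product
  is composition, and the operator norm is \<^const>\<open>onorm\<close>.\<close>

definition bounded_ops :: "('h::complex_inner \<Rightarrow> 'h) set" where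
  "bounded_ops = {a. bounded_linear a \<and> (\<forall>c x. a (c *\<^sub>C x) = c *\<^sub>C a x)}"

definition adjoint_pair :: "('h::complex_inner \<Rightarrow> 'h) \<Rightarrow> ('h \<Rightarrow> 'h) \<Rightarrow> bool" where
  "adjoint_pair a b \<longleftrightarrow> a \<in> bounded_ops \<and> b \<in> bounded_ops \<and>
     (\<forall>x y. cinner (a x) y = cinner x (b y))"

definition commutant :: "('h::complex_inner \<Rightarrow> 'h) set \<Rightarrow> ('h \<Rightarrow> 'h) set" where
  "commutant S = {b \<in> bounded_ops. \<forall>a\<in>S. a \<circ> b = b \<circ> a}"

definition von_neumann_algebra :: "('h::chilbert_space \<Rightarrow> 'h) set \<Rightarrow> bool" where
  "von_neumann_algebra M \<longleftrightarrow> M \<subseteq> bounded_ops \<and>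
     (\<forall>a\<in>M. \<exists>b\<in>M. adjoint_pair a b) \<and> commutant (commutant M) = M"

definition vn_generated :: "('h::chilbert_space \<Rightarrow> 'h) set \<Rightarrow> ('h \<Rightarrow> 'h) set" where
  "vn_generated S = \<Inter>{M. von_neumann_algebra M \<and> S \<subseteq> M}"

text \<open>The normal (that is, ultraweakly continuous) linear functionals on \<open>M\<close>; they make up the
  predual. Only the values on \<open>M\<close> matter.\<close>

definition normal_functionals ::
    "('h::chilbert_space \<Rightarrow> 'h) set \<Rightarrow> (('h \<Rightarrow> 'h) \<Rightarrow> complex) set" where
  "normal_functionals M = {\<phi>. \<exists>\<xi> \<eta> :: nat \<Rightarrow> 'h.
     summable (\<lambda>n. (norm (\<xi> n))\<^sup>2) \<and> summable (\<lambda>n. (norm (\<eta> n))\<^sup>2) \<and>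
     (\<forall>a\<in>M. (\<lambda>n. cinner (\<xi> n) (a (\<eta> n))) sums \<phi> a)}"

definition separable_predual :: "('h::chilbert_space \<Rightarrow> 'h) set \<Rightarrow> bool" where
  "separable_predual M \<longleftrightarrow> (\<exists>C. countable C \<and> C \<subseteq> normal_functionals M \<and>
     (\<forall>\<phi>\<in>normal_functionals M. \<forall>e>0. \<exists>\<psi>\<in>C. \<forall>a\<in>M. onorm a \<le> 1 \<longrightarrow> cmod (\<phi> a - \<psi> a) \<le> e))"

text \<open>Linearity is part of normality.\<close>

definition faithful_normal_tracial_state ::
    "('h::chilbert_space \<Rightarrow> 'h) set \<Rightarrow> (('h \<Rightarrow> 'h) \<Rightarrow> complex) \<Rightarrow> bool" where
  "faithful_normal_tracial_state M \<phi> \<longleftrightarrow> \<phi> \<in> normal_functionals M \<and> \<phi> id = 1 \<and>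
     (\<forall>a\<in>M. \<forall>b\<in>M. adjoint_pair a b \<longrightarrow>
        \<phi> (b \<circ> a) \<in> \<real> \<and> 0 \<le> Re (\<phi> (b \<circ> a)) \<and> (\<phi> (b \<circ> a) = 0 \<longrightarrow> a = (\<lambda>_. 0))) \<and>
     (\<forall>a\<in>M. \<forall>b\<in>M. \<phi> (a \<circ> b) = \<phi> (b \<circ> a))"

section \<open>Continuous Bernoulli systems\<close>

definition intervals :: "real set set" where
  "intervals = {{s..<t} | s t. s < t}"

text \<open>Only the values of \<open>local_algebra\<close> on \<^const>\<open>intervals\<close> matter.\<close>

record 'h bernoulli_data =
  algebra :: "('h \<Rightarrow> 'h) set"
  state :: "('h \<Rightarrow> 'h) \<Rightarrow> complex"
  local_algebra :: "real set \<Rightarrow> ('h \<Rightarrow> 'h) set"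

definition continuous_bernoulli_system :: "'h::chilbert_space bernoulli_data \<Rightarrow> bool" where
  "continuous_bernoulli_system S \<longleftrightarrow>
     von_neumann_algebra (algebra S) \<and> separable_predual (algebra S) \<and>
     faithful_normal_tracial_state (algebra S) (state S) \<and>
     (\<forall>I\<in>intervals. von_neumann_algebra (local_algebra S I) \<and> local_algebra S I \<subseteq> algebra S) \<and>
     algebra S = vn_generated (\<Union>I\<in>intervals. local_algebra S I) \<and>
     (\<forall>I\<in>intervals. \<forall>J\<in>intervals. I \<subseteq> J \<longrightarrow> local_algebra S I \<subseteq> local_algebra S J) \<and>
     (\<forall>I\<in>intervals. \<forall>J\<in>intervals. I \<inter> J = {} \<longrightarrow>
        (\<forall>a\<in>local_algebra S I. \<forall>b\<in>local_algebra S J. state S (a \<circ> b) = state S a * state S b))"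

definition star_isomorphism ::
    "('h::chilbert_space \<Rightarrow> 'h) set \<Rightarrow> ('k::chilbert_space \<Rightarrow> 'k) set \<Rightarrow>
     (('h \<Rightarrow> 'h) \<Rightarrow> ('k \<Rightarrow> 'k)) \<Rightarrow> bool" where
  "star_isomorphism M N \<pi> \<longleftrightarrow> bij_betw \<pi> M N \<and>
     (\<forall>a\<in>M. \<forall>b\<in>M. \<pi> (\<lambda>x. a x + b x) = (\<lambda>x. \<pi> a x + \<pi> b x)) \<and>
     (\<forall>a\<in>M. \<forall>c. \<pi> (\<lambda>x. c *\<^sub>C a x) = (\<lambda>x. c *\<^sub>C \<pi> a x)) \<and>
     (\<forall>a\<in>M. \<forall>b\<in>M. \<pi> (a \<circ> b) = \<pi> a \<circ> \<pi> b) \<and>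
     (\<forall>a\<in>M. \<forall>b\<in>M. adjoint_pair a b \<longrightarrow> adjoint_pair (\<pi> a) (\<pi> b))"

definition isomorphic_bernoulli_systems ::
    "'h::chilbert_space bernoulli_data \<Rightarrow> 'k::chilbert_space bernoulli_data \<Rightarrow> bool" where
  "isomorphic_bernoulli_systems S T \<longleftrightarrow> (\<exists>\<pi>. star_isomorphism (algebra S) (algebra T) \<pi> \<and>
     (\<forall>I\<in>intervals. \<pi> ` local_algebra S I = local_algebra T I) \<and>
     (\<forall>a\<in>algebra S. state S a = state T (\<pi> a)))"

section \<open>Pair partitions\<close>

text \<open>A pair is written \<open>(i, j)\<close> with \<open>i < j\<close>.\<close>

definition pair_partitions :: "nat \<Rightarrow> (nat \<times> nat) set set" where
  "pair_partitions n = {\<pi>. \<pi> \<subseteq> {1..n} \<times> {1..n} \<and> (\<forall>(i, j)\<in>\<pi>. i < j) \<and>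
     (\<forall>k\<in>{1..n}. \<exists>!p. p \<in> \<pi> \<and> (fst p = k \<or> snd p = k))}"

definition crosses :: "nat \<times> nat \<Rightarrow> nat \<times> nat \<Rightarrow> bool" where
  "crosses p r \<longleftrightarrow> (case (p, r) of ((i, j), (k, l)) \<Rightarrow>
     (i < k \<and> k < j \<and> j < l) \<or> (k < i \<and> i < l \<and> l < j))"

definition cr :: "(nat \<times> nat) set \<Rightarrow> nat" where
  "cr \<pi> = card {{p, r} | p r. p \<in> \<pi> \<and> r \<in> \<pi> \<and> crosses p r}"

definition cc :: "(nat \<times> nat) set \<Rightarrow> nat" where
  "cc \<pi> = card (\<pi> // {(p, r). p \<in> \<pi> \<and> r \<in> \<pi> \<and> crosses p r}\<^sup>*)"

definition q_weight :: "real \<Rightarrow> (nat \<times> nat) set \<Rightarrow> complex" where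
  "q_weight q \<pi> = complex_of_real (q ^ cr \<pi>)"

text \<open>At \<open>q = 0\<close> both branches give 1 on noncrossing pair partitions and 0 otherwise.\<close>

definition bozejko_speicher_weight :: "real \<Rightarrow> (nat \<times> nat) set \<Rightarrow> complex" where
  "bozejko_speicher_weight q \<pi> = complex_of_real
     (if 0 \<le> q then q ^ (card \<pi> - cc \<pi>) else (-1) ^ cr \<pi> * \<bar>q\<bar> ^ (card \<pi> - cc \<pi>))"

section \<open>Generalized Brownian motion\<close>

text \<open>Elements of the real space \<open>L\<^sup>2(\<real>)\<close> are handled through representatives.\<close>

definition L2_fun :: "(real \<Rightarrow> real) set" where
  "L2_fun = {f. f \<in> borel_measurable lborel \<and> integrable lborel (\<lambda>x. (f x)\<^sup>2)}"

definition L2_inner :: "(real \<Rightarrow> real) \<Rightarrow> (real \<Rightarrow> real) \<Rightarrow> real" where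
  "L2_inner f g = (\<integral>x. f x * g x \<partial>lborel)"

definition supported_in :: "(real \<Rightarrow> real) \<Rightarrow> real set \<Rightarrow> bool" where
  "supported_in f I \<longleftrightarrow> (AE x in lborel. x \<notin> I \<longrightarrow> f x = 0)"

text \<open>\<open>\<omega>(f\<^sub>1) \<dots> \<omega>(f\<^sub>n) \<Omega>\<close> is \<open>foldr \<omega> [f\<^sub>1, \<dots>, f\<^sub>n] \<Omega>\<close>. The span of these vectors is the
  domain on which the field operators act; the values of \<open>\<omega> f\<close> elsewhere are irrelevant.\<close>

definition field_domain ::
    "'h::chilbert_space \<Rightarrow> ((real \<Rightarrow> real) \<Rightarrow> 'h \<Rightarrow> 'h) \<Rightarrow> 'h set" where
  "field_domain \<Omega> \<omega> = cspan {foldr \<omega> fs \<Omega> | fs. set fs \<subseteq> L2_fun}"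

text \<open>\<open>\<omega>\<close> is the GNS realization, with cyclic unit vector \<open>\<Omega>\<close>, of the generalized Brownian
  motion with weight function \<open>t\<close>. It is determined by \<open>t\<close> up to unitary equivalence.\<close>

definition generalized_brownian_motion ::
    "((nat \<times> nat) set \<Rightarrow> complex) \<Rightarrow> 'h::chilbert_space \<Rightarrow>
     ((real \<Rightarrow> real) \<Rightarrow> 'h \<Rightarrow> 'h) \<Rightarrow> bool" where
  "generalized_brownian_motion t \<Omega> \<omega> \<longleftrightarrow>
     norm \<Omega> = 1 \<and> closure (field_domain \<Omega> \<omega>) = UNIV \<and>
     (\<forall>f\<in>L2_fun. \<forall>x\<in>field_domain \<Omega> \<omega>. \<forall>y\<in>field_domain \<Omega> \<omega>.
        \<omega> f (x + y) = \<omega> f x + \<omega> f y \<and> (\<forall>c. \<omega> f (c *\<^sub>C x) = c *\<^sub>C \<omega> f x) \<and>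
        cinner (\<omega> f x) y = cinner x (\<omega> f y)) \<and>
     (\<forall>f\<in>L2_fun. \<forall>g\<in>L2_fun. \<forall>x\<in>field_domain \<Omega> \<omega>.
        (\<forall>r s. \<omega> (\<lambda>u. r * f u + s * g u) x = r *\<^sub>R \<omega> f x + s *\<^sub>R \<omega> g x) \<and>
        ((AE u in lborel. f u = g u) \<longrightarrow> \<omega> f x = \<omega> g x)) \<and>
     (\<forall>fs. set fs \<subseteq> L2_fun \<longrightarrow> cinner \<Omega> (foldr \<omega> fs \<Omega>) =
        (\<Sum>\<pi>\<in>pair_partitions (length fs).
           t \<pi> * (\<Prod>(i, j)\<in>\<pi>. complex_of_real (L2_inner (fs ! (i - 1)) (fs ! (j - 1))))))"

text \<open>Closed operators are represented by their graphs; the graph of the closure of a closable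
  operator is the closure of its graph.\<close>

definition closure_graph :: "'h::chilbert_space set \<Rightarrow> ('h \<Rightarrow> 'h) \<Rightarrow> ('h \<times> 'h) set" where
  "closure_graph D T = closure {(x, T x) | x. x \<in> D}"

text \<open>\<open>u T \<subseteq> T u\<close> for all unitaries \<open>u\<close> in the commutant of \<open>M\<close>. For an everywhere defined
  bounded \<open>T\<close> and a von Neumann algebra \<open>M\<close> this says \<open>T \<in> M\<close>.\<close>

definition affiliated :: "('h::chilbert_space \<times> 'h) set \<Rightarrow> ('h \<Rightarrow> 'h) set \<Rightarrow> bool" where
  "affiliated G M \<longleftrightarrow> (\<forall>u\<in>commutant M. \<forall>v. adjoint_pair u v \<and> u \<circ> v = id \<and> v \<circ> u = id \<longrightarrow>
     (\<forall>(x, y)\<in>G. (u x, u y) \<in> G))"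

text \<open>In the bounded case this is the von Neumann algebra generated by the (extensions of the)
  field operators, by the previous remark.\<close>

definition field_algebra ::
    "'h::chilbert_space \<Rightarrow> ((real \<Rightarrow> real) \<Rightarrow> 'h \<Rightarrow> 'h) \<Rightarrow> real set \<Rightarrow> ('h \<Rightarrow> 'h) set" where
  "field_algebra \<Omega> \<omega> I = \<Inter>{M. von_neumann_algebra M \<and>
     (\<forall>f\<in>L2_fun. supported_in f I \<longrightarrow> affiliated (closure_graph (field_domain \<Omega> \<omega>) (\<omega> f)) M)}"

definition field_system ::
    "'h::chilbert_space \<Rightarrow> ((real \<Rightarrow> real) \<Rightarrow> 'h \<Rightarrow> 'h) \<Rightarrow> 'h bernoulli_data" where
  "field_system \<Omega> \<omega> =
     \<lparr>algebra = vn_generated (\<Union>I\<in>intervals. field_algebra \<Omega> \<omega> I),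
      state = (\<lambda>a. cinner \<Omega> (a \<Omega>)),
      local_algebra = field_algebra \<Omega> \<omega>\<rparr>"

definition bernoulli_system_of_gbm ::
    "((nat \<times> nat) set \<Rightarrow> complex) \<Rightarrow> 'h::chilbert_space bernoulli_data \<Rightarrow> bool" where
  "bernoulli_system_of_gbm t S \<longleftrightarrow> continuous_bernoulli_system S \<and>
     (\<exists>\<Omega> \<omega>. generalized_brownian_motion t \<Omega> \<omega> \<and> S = field_system \<Omega> \<omega>)"

end

theory Submission
  imports Defs
begin

text \<open>
  In both families the weight of the crossing of two pairs is \<open>q\<close>. Hence, for \<open>f\<close> and \<open>g\<close> with disjoint
  supports, the inner product of \<open>\<omega>(g) \<omega>(f) \<Omega>\<close> with \<open>\<omega>(f) \<omega>(g) \<Omega>\<close> is \<open>q \<parallel>f\<parallel>\<^sup>2 \<parallel>g\<parallel>\<^sup>2\<close>. These products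
  are limits of \<open>a b \<Omega>\<close> with \<open>a\<close>, \<open>b\<close> in local algebras of disjoint intervals, and by traciality and
  independence \<open>\<parallel>a b \<Omega>\<parallel> = \<parallel>a \<Omega>\<parallel> \<parallel>b \<Omega>\<parallel>\<close>, so that the limit depends only on those of \<open>a \<Omega>\<close> and \<open>b \<Omega>\<close>.
  It remains to see that the unitary induced by an isomorphism maps the vectors \<open>\<omega>(1\<^sub>I) \<Omega>\<close> into the
  closed linear span of the vectors \<open>\<omega>(f) \<Omega>\<close>, the first chaos. The image \<open>\<xi>\<^sub>I\<close> is additive in \<open>I\<close>, centred, of squared norm
  \<open>|I|\<close>, and invariant under the second quantization of each involutive isometry of \<open>L\<^sup>2\<close> that fixes
  the functions supported in \<open>I\<close>. Let \<open>\<rho>\<^sub>I\<close> be its component orthogonal to the first chaos. Moving the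
  letters supported off \<open>I\<close> to infinity shows that \<open>\<rho>\<^sub>I\<close> is orthogonal to all words with at most one
  letter on \<open>I\<close>, and a word of bounded letters, at least two of them on \<open>I\<close>, has with \<open>\<rho>\<^sub>I\<close> an inner
  product of order \<open>|I| \<parallel>\<rho>\<^sub>I\<parallel>\<close>, hence at most of order \<open>|I|\<close> to the power \<open>3/2\<close>. Summing over a partition of a unit interval into \<open>N\<close> intervals of length
  \<open>1/N\<close> and letting \<open>N\<close> grow gives \<open>\<rho> = 0\<close>.
\<close>

text \<open>An isomorphism knows nothing of the field operators: it respects only local algebras and
  states. So something must be known about all vectors of a local algebra, although this algebra is
  given as an intersection and, with moments as the only data, no Fock space is at hand. Second
  quantizations supply it: the commutant of one that is trivial on the interval is among the
  algebras intersected.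

  The field operators may be unbounded (for q = 1 they are Gaussian) and are only known to be
  symmetric on the span of the words. Bounded local elements are therefore cut out of them by
  projections onto closed graphs, and limits of products are controlled by the factorization of
  norms instead of operator norms.

  Letters can be moved to infinity with a definite result because the pairs among them form a
  crossing graph that is attached to the remaining pairs at no vertex, or at the single pair through
  the letter on the interval, and weights multiply over such unions. This and the weight of one
  crossing are all that is used of t, so one argument serves both families.\<close>

section \<open>Complex inner product spaces\<close>

interpretation cv: vector_space "scaleC :: complex \<Rightarrow> 'a::complex_vector \<Rightarrow> 'a"
  by (rule vector_space_scaleC)

lemma scaleR_scaleC: "r *\<^sub>R (x::'a::complex_vector) = complex_of_real r *\<^sub>C x"
  by (simp add: scaleC_of_real)

lemma cinner_add_left: "cinner (x + y) z = cinner x z + cinner y z"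
  by (metis cinner_add_right cinner_commute complex_cnj_add)

lemma cinner_scaleC_left: "cinner (c *\<^sub>C x) y = cnj c * cinner x y"
  by (metis cinner_scaleC_right cinner_commute complex_cnj_mult)

lemma cinner_scaleR_right: "cinner x (r *\<^sub>R y) = complex_of_real r * cinner x y"
  by (simp add: scaleR_scaleC cinner_scaleC_right)

lemma cinner_scaleR_left: "cinner (r *\<^sub>R x) y = complex_of_real r * cinner x y"
  by (simp add: scaleR_scaleC cinner_scaleC_left)

lemma cinner_zero_right [simp]: "cinner x 0 = 0"
  using cinner_scaleR_right[of x 0 0] by simp

lemma cinner_zero_left [simp]: "cinner 0 x = 0"
  using cinner_scaleR_left[of 0 0 x] by simp

lemma cinner_minus_right: "cinner x (- y) = - cinner x y"
  using cinner_scaleR_right[of x "-1" y] by simp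

lemma cinner_minus_left: "cinner (- x) y = - cinner x y"
  using cinner_scaleR_left[of "-1" x y] by simp

lemma cinner_diff_right: "cinner x (y - z) = cinner x y - cinner x z"
  using cinner_add_right[of x y "- z"] by (simp add: cinner_minus_right)

lemma cinner_diff_left: "cinner (x - y) z = cinner x z - cinner y z"
  using cinner_add_left[of x "- y" z] by (simp add: cinner_minus_left)

lemma cinner_sum_right: "cinner x (\<Sum>i\<in>A. f i) = (\<Sum>i\<in>A. cinner x (f i))"
  by (induction A rule: infinite_finite_induct) (auto simp: cinner_add_right)

lemmas cinner_simps = cinner_add_left cinner_add_right cinner_diff_left cinner_diff_right
  cinner_scaleC_left cinner_scaleC_right cinner_minus_left cinner_minus_right

lemma cinner_self_eq_0_iff [simp]: "cinner x x = 0 \<longleftrightarrow> x = 0"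
  by (simp add: cinner_self)

lemma cinner_Cauchy_Schwarz: "cmod (cinner x y) \<le> norm x * norm y"
proof (cases "y = 0")
  case False
  define c where "c = cinner y x / complex_of_real ((norm y)\<^sup>2)"
  have ny: "norm y > 0" using False by simp
  have xy: "cinner x y = cnj (cinner y x)" by (rule cinner_commute)
  have n2: "(norm y)\<^sup>2 \<noteq> 0" using ny by simp
  have cn: "c * complex_of_real ((norm y)\<^sup>2) = cinner y x"
    using n2 by (simp add: c_def)
  have "complex_of_real ((norm (x - c *\<^sub>C y))\<^sup>2) = cinner (x - c *\<^sub>C y) (x - c *\<^sub>C y)"
    by (simp add: cinner_self)
  also have "\<dots> = complex_of_real ((norm x)\<^sup>2) - c * cnj (cinner y x) - cnj c * cinner y x
      + cnj c * (c * complex_of_real ((norm y)\<^sup>2))"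
    by (simp only: cinner_diff_left cinner_diff_right cinner_scaleC_left cinner_scaleC_right xy)
      (simp add: cinner_self algebra_simps)
  also have "\<dots> = complex_of_real ((norm x)\<^sup>2) - c * cnj (cinner y x)"
    unfolding cn by simp
  also have "c * cnj (cinner y x) = complex_of_real ((cmod (cinner y x))\<^sup>2 / (norm y)\<^sup>2)"
    by (simp add: c_def complex_norm_square[symmetric] flip: of_real_power)
  finally have "(norm (x - c *\<^sub>C y))\<^sup>2 = (norm x)\<^sup>2 - (cmod (cinner y x))\<^sup>2 / (norm y)\<^sup>2"
    by (simp only: of_real_diff[symmetric] of_real_eq_iff)
  then have "(cmod (cinner y x))\<^sup>2 / (norm y)\<^sup>2 \<le> (norm x)\<^sup>2"
    by (smt (verit) zero_le_power2)
  then have "(cmod (cinner y x))\<^sup>2 \<le> (norm x)\<^sup>2 * (norm y)\<^sup>2"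
    using ny by (simp add: divide_le_eq)
  then have "(cmod (cinner y x))\<^sup>2 \<le> (norm x * norm y)\<^sup>2"
    by (simp add: power_mult_distrib)
  then have "cmod (cinner y x) \<le> norm x * norm y"
    by (rule power2_le_imp_le) simp
  then show ?thesis by (simp add: xy)
qed simp

lemma bounded_bilinear_cinner: "bounded_bilinear cinner"
  by (rule bounded_bilinear.intro)
    (auto simp: cinner_add_left cinner_add_right cinner_scaleR_left cinner_scaleR_right
      scaleR_conv_of_real intro!: exI[of _ 1] cinner_Cauchy_Schwarz)

lemmas tendsto_cinner [tendsto_intros] = bounded_bilinear.tendsto[OF bounded_bilinear_cinner]

lemma continuous_on_cinner [continuous_intros]:
  "continuous_on S f \<Longrightarrow> continuous_on S g \<Longrightarrow> continuous_on S (\<lambda>x. cinner (f x) (g x))"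
  by (rule bounded_bilinear.continuous_on[OF bounded_bilinear_cinner])

lemma norm_scaleC: "norm (c *\<^sub>C x) = cmod c * norm (x::'a::complex_inner)"
proof -
  have "complex_of_real ((norm (c *\<^sub>C x))\<^sup>2) = complex_of_real ((cmod c * norm x)\<^sup>2)"
    by (simp only: cinner_self[symmetric] cinner_scaleC_left cinner_scaleC_right power_mult_distrib
        of_real_mult complex_norm_square) (simp add: cinner_self)
  then have "(norm (c *\<^sub>C x))\<^sup>2 = (cmod c * norm x)\<^sup>2"
    using of_real_eq_iff by blast
  then show ?thesis by (rule power2_eq_imp_eq) auto
qed

lemma bounded_linear_scaleC: "bounded_linear (\<lambda>x::'a::complex_inner. c *\<^sub>C x)"
  by (rule bounded_linear_intro[of _ "cmod c"])
    (auto simp: scaleC_add_right scaleR_scaleC scaleC_scaleC norm_scaleC mult.commute)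

lemmas tendsto_scaleC [tendsto_intros] = bounded_linear.tendsto[OF bounded_linear_scaleC]

lemma norm_sq_cinner: "(norm x)\<^sup>2 = Re (cinner x x)"
  by (simp add: cinner_self)

lemma norm_eq_if_cinner_eq: "cinner x x = cinner y y \<Longrightarrow> norm x = norm y"
  by (metis cinner_self norm_ge_zero of_real_eq_iff power2_eq_imp_eq)

lemma cinner_ext: "(\<And>z. cinner z x = cinner z y) \<Longrightarrow> x = y"
  by (metis cinner_diff_right cinner_self_eq_0_iff diff_self right_minus_eq)

lemma parallelogram:
  "(norm (x + y))\<^sup>2 + (norm (x - y))\<^sup>2 = 2 * (norm x)\<^sup>2 + 2 * (norm (y::'a::complex_inner))\<^sup>2"
  unfolding norm_sq_cinner by (simp add: cinner_simps)

lemma norm_sum_orthogonal: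
  "cinner x y = 0 \<Longrightarrow> (norm (x + y))\<^sup>2 = (norm x)\<^sup>2 + (norm (y::'a::complex_inner))\<^sup>2"
  unfolding norm_sq_cinner using cinner_commute[of y x] by (simp add: cinner_simps)

lemma closure_span_eq_0:
  assumes "closure D = UNIV" "\<And>d. d \<in> D \<Longrightarrow> cinner d x = 0"
  shows "x = 0"
proof -
  have "closed {d. cinner d x = 0}"
    by (intro closed_Collect_eq continuous_intros)
  then have "closure D \<subseteq> {d. cinner d x = 0}"
    using assms(2) by (intro closure_minimal) auto
  then have "cinner x x = 0" using assms(1) by blast
  then show ?thesis by simp
qed

lemma cspan_orthogonal:
  assumes "\<And>s. s \<in> S \<Longrightarrow> cinner s x = 0" "d \<in> cspan S"
  shows "cinner d x = 0"
  using assms(2)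
  by (induction rule: cv.span_induct_alt) (auto simp: cinner_simps assms(1))

lemma subspace_closure:
  assumes "cv.subspace (S :: 'a::complex_inner set)"
  shows "cv.subspace (closure S)"
proof (rule cv.subspaceI)
  show "0 \<in> closure S"
    using cv.subspace_0[OF assms] closure_subset by auto
next
  fix x y assume "x \<in> closure S" "y \<in> closure S"
  then obtain f g where "\<forall>n. f n \<in> S" "f \<longlonglongrightarrow> x" "\<forall>n. g n \<in> S" "g \<longlonglongrightarrow> y"
    unfolding closure_sequential by auto
  then show "x + y \<in> closure S"
    unfolding closure_sequential
    by (intro exI[of _ "\<lambda>n. f n + g n"]) (auto intro!: tendsto_intros cv.subspace_add[OF assms])
next
  fix c x assume "x \<in> closure S"
  then obtain f where "\<forall>n. f n \<in> S" "f \<longlonglongrightarrow> x"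
    unfolding closure_sequential by auto
  then show "c *\<^sub>C x \<in> closure S"
    unfolding closure_sequential
    by (intro exI[of _ "\<lambda>n. c *\<^sub>C f n"]) (auto intro!: tendsto_intros cv.subspace_scale[OF assms])
qed

section \<open>Orthogonal projections\<close>

lemma exists_projection:
  fixes K :: "'a::chilbert_space set"
  assumes "closed K" "cv.subspace K"
  shows "\<exists>p\<in>K. \<forall>k\<in>K. cinner k (x - p) = 0"
proof -
  define d where "d = infdist x K"
  have ne: "K \<noteq> {}" using cv.subspace_0[OF assms(2)] by auto
  have d0: "0 \<le> d" by (simp add: d_def infdist_nonneg)
  have dle: "d \<le> norm (x - k)" if "k \<in> K" for k
    using infdist_le[OF that, of x] by (simp add: d_def dist_norm)
  have "\<exists>k\<in>K. norm (x - k) < d + 1 / real (Suc n)" for n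
  proof -
    have "\<exists>a\<in>K. dist x a < d + 1 / real (Suc n)"
      using ne infdist_notempty[OF ne, of x]
        cInf_lessD[of "dist x ` K" "d + 1 / real (Suc n)"] by (auto simp: d_def)
    then show ?thesis by (auto simp: dist_norm)
  qed
  then obtain k where k: "\<And>n. k n \<in> K" "\<And>n. norm (x - k n) < d + 1 / real (Suc n)"
    by metis
  have sq: "(norm (x - k n))\<^sup>2 \<le> d\<^sup>2 + (2 * d + 1) / real (Suc n)" for n
  proof -
    have "(norm (x - k n))\<^sup>2 \<le> (d + 1 / real (Suc n))\<^sup>2"
      using k(2)[of n] by (intro power_mono) auto
    also have "\<dots> = d\<^sup>2 + 2 * d / real (Suc n) + (1 / real (Suc n)) * (1 / real (Suc n))"
      by (simp add: power2_eq_square algebra_simps)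
    also have "(1 / real (Suc n)) * (1 / real (Suc n)) \<le> 1 / real (Suc n)"
      by (intro mult_left_le) auto
    finally show ?thesis by (simp add: add_divide_distrib)
  qed
  \<comment> \<open>Parallelogram law: the midpoint of \<open>k m\<close> and \<open>k n\<close>
    lies in \<open>K\<close>, hence at distance at least \<open>d\<close> from \<open>x\<close>, so
    two near-minimizers are close to each other.\<close>
  have diff: "(norm (k m - k n))\<^sup>2 \<le> 2 * ((2 * d + 1) / real (Suc m)) + 2 * ((2 * d + 1) / real (Suc n))"
    for m n
  proof -
    have mid: "(1/2) *\<^sub>R (k m + k n) \<in> K"
      unfolding scaleR_scaleC
      by (intro cv.subspace_scale[OF assms(2)] cv.subspace_add[OF assms(2)] k)
    have "(x - k m) + (x - k n) = 2 *\<^sub>R (x - (1/2) *\<^sub>R (k m + k n))"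
      by (simp add: algebra_simps scaleR_2)
    then have "norm ((x - k m) + (x - k n)) = 2 * norm (x - (1/2) *\<^sub>R (k m + k n))"
      by simp
    then have "2 * d \<le> norm ((x - k m) + (x - k n))" using dle[OF mid] by simp
    then have "(2 * d)\<^sup>2 \<le> (norm ((x - k m) + (x - k n)))\<^sup>2"
      using d0 by (intro power_mono) auto
    moreover have "(norm ((x - k m) - (x - k n)))\<^sup>2 = (norm (k m - k n))\<^sup>2"
      by (simp add: norm_minus_commute)
    moreover have "t \<le> 2 * e + 2 * f"
      if "(2 * d)\<^sup>2 \<le> s" "s + t = 2 * u + 2 * v" "u \<le> d\<^sup>2 + e" "v \<le> d\<^sup>2 + f" for s t u v e f :: real
      using that by (simp add: power_mult_distrib)
    ultimately show ?thesis
      using parallelogram[of "x - k m" "x - k n"] sq[of m] sq[of n] by metis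
  qed
  have "Cauchy k"
  proof (rule metric_CauchyI)
    fix e :: real assume e: "e > 0"
    have "(\<lambda>n. 4 * ((2 * d + 1) / real (Suc n))) \<longlonglongrightarrow> 4 * 0"
      by (intro tendsto_intros LIMSEQ_Suc[OF lim_const_over_n])
    then have "\<forall>\<^sub>F n in sequentially. 4 * ((2 * d + 1) / real (Suc n)) < e\<^sup>2"
      using e by (intro order_tendstoD(2)) auto
    then obtain N where N: "\<And>n. n \<ge> N \<Longrightarrow> 4 * ((2 * d + 1) / real (Suc n)) < e\<^sup>2"
      by (auto simp: eventually_sequentially)
    have "dist (k m) (k n) < e" if "m \<ge> N" "n \<ge> N" for m n
    proof -
      have "(norm (k m - k n))\<^sup>2 < e\<^sup>2"
        using diff[of m n] N[OF that(1)] N[OF that(2)] by linarith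
      then show ?thesis using e by (simp add: dist_norm power2_less_imp_less)
    qed
    then show "\<exists>M. \<forall>m\<ge>M. \<forall>n\<ge>M. dist (k m) (k n) < e" by blast
  qed
  then obtain p where p: "k \<longlonglongrightarrow> p"
    using Cauchy_convergent convergent_def by blast
  have pK: "p \<in> K" using closed_sequentially[OF assms(1) _ p] k(1) by blast
  have "norm (x - p) \<le> d + 0"
  proof (rule LIMSEQ_le)
    show "(\<lambda>n. norm (x - k n)) \<longlonglongrightarrow> norm (x - p)" by (intro tendsto_intros p)
    show "(\<lambda>n. d + 1 / real (Suc n)) \<longlonglongrightarrow> d + 0"
      by (intro tendsto_intros LIMSEQ_Suc[OF lim_const_over_n])
    show "\<exists>N. \<forall>n\<ge>N. norm (x - k n) \<le> d + 1 / real (Suc n)" using k(2) less_imp_le by blast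
  qed
  then have pd: "norm (x - p) \<le> d" by simp
  have "cinner h (x - p) = 0" if h: "h \<in> K" for h
  proof -
    define b where "b = cinner h (x - p)"
    \<comment> \<open>This \<open>s\<close> satisfies \<open>s * (norm h)\<^sup>2 \<le> 1\<close>,
      also for \<open>h = 0\<close>. Moving from \<open>p\<close> by \<open>(s * b) h\<close> then
      lowers the squared distance by at least \<open>s * (cmod b)\<^sup>2\<close>, and minimality
      forces \<open>b = 0\<close>.\<close>
    define s where "s = 1 / ((norm h)\<^sup>2 + 1)"
    have s: "s > 0" by (simp add: s_def add_nonneg_pos)
    have "p + (s * b) *\<^sub>C h \<in> K"
      by (intro cv.subspace_add[OF assms(2)] cv.subspace_scale[OF assms(2)] h pK)
    from dle[OF this] have "(norm (x - p))\<^sup>2 \<le> (norm (x - p - (s * b) *\<^sub>C h))\<^sup>2"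
      using pd by (intro power_mono) (auto simp: diff_diff_eq)
    also have "\<dots> = (norm (x - p))\<^sup>2 - 2 * s * (cmod b)\<^sup>2 + s\<^sup>2 * (cmod b)\<^sup>2 * (norm h)\<^sup>2"
    proof -
      have "cinner (y - (s * b) *\<^sub>C h) (y - (s * b) *\<^sub>C h)
         = cinner y y - s * b * cnj b - s * cnj b * b + s * s * (b * cnj b) * cinner h h"
        if "cinner y h = cnj b" "cinner h y = b" for y
        by (simp add: cinner_simps that) (simp add: algebra_simps)
      from this[of "x - p"] have "cinner (x - p - (s * b) *\<^sub>C h) (x - p - (s * b) *\<^sub>C h)
         = cinner (x - p) (x - p) - s * b * cnj b - s * cnj b * b + s * s * (b * cnj b) * cinner h h"
        unfolding b_def using cinner_commute[of "x - p" h] by blast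
      also have "\<dots> = complex_of_real ((norm (x - p))\<^sup>2 - 2 * s * (cmod b)\<^sup>2 + s\<^sup>2 * (cmod b)\<^sup>2 * (norm h)\<^sup>2)"
      proof -
        have nb: "b * cnj b = complex_of_real ((cmod b)\<^sup>2)" "cnj b * b = complex_of_real ((cmod b)\<^sup>2)"
          by (simp_all only: complex_norm_square mult.commute)
        show ?thesis
          by (simp only: cinner_self nb mult.assoc) (simp add: power2_eq_square algebra_simps)
      qed
      finally show ?thesis by (simp only: cinner_self of_real_eq_iff)
    qed
    finally have "2 * s * (cmod b)\<^sup>2 \<le> s * (cmod b)\<^sup>2 * (s * (norm h)\<^sup>2)"
      by (simp add: power2_eq_square algebra_simps)
    also have "\<dots> \<le> s * (cmod b)\<^sup>2 * 1"
      using s by (intro mult_left_mono) (auto simp: s_def)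
    finally have "s * (cmod b)\<^sup>2 \<le> 0" by simp
    then have "b = 0" using s by (simp add: mult_le_0_iff)
    then show ?thesis by (simp add: b_def)
  qed
  then show ?thesis using pK by blast
qed

definition proj :: "'a::chilbert_space set \<Rightarrow> 'a \<Rightarrow> 'a" where
  "proj K x = (SOME p. p \<in> K \<and> (\<forall>k\<in>K. cinner k (x - p) = 0))"

context
  fixes K :: "'a::chilbert_space set"
  assumes cl: "closed K" and sub: "cv.subspace K"
begin

lemma proj_in: "proj K x \<in> K" and proj_orth: "k \<in> K \<Longrightarrow> cinner k (x - proj K x) = 0"
proof -
  have "proj K x \<in> K \<and> (\<forall>k\<in>K. cinner k (x - proj K x) = 0)"
    unfolding proj_def by (rule someI_ex) (use exists_projection[OF cl sub] in blast)
  then show "proj K x \<in> K" "k \<in> K \<Longrightarrow> cinner k (x - proj K x) = 0" by auto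
qed

lemma proj_unique:
  assumes "p \<in> K" "\<And>k. k \<in> K \<Longrightarrow> cinner k (x - p) = 0"
  shows "proj K x = p"
proof -
  have "proj K x - p \<in> K" by (intro cv.subspace_diff[OF sub] proj_in assms)
  from assms(2)[OF this] proj_orth[OF this, of x]
  have "cinner (proj K x - p) ((x - p) - (x - proj K x)) = 0" by (subst cinner_diff_right) simp
  moreover have "(x - p) - (x - proj K x) = proj K x - p" by simp
  ultimately show ?thesis by simp
qed

lemma proj_id: "x \<in> K \<Longrightarrow> proj K x = x"
  by (rule proj_unique) auto

lemma proj_add: "proj K (x + y) = proj K x + proj K y"
proof (rule proj_unique)
  show "proj K x + proj K y \<in> K" by (intro cv.subspace_add[OF sub] proj_in)
  fix k assume "k \<in> K"
  from proj_orth[OF this, of x] proj_orth[OF this, of y]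
  show "cinner k (x + y - (proj K x + proj K y)) = 0" by (simp add: cinner_simps)
qed

lemma proj_scaleC: "proj K (c *\<^sub>C x) = c *\<^sub>C proj K x"
proof (rule proj_unique)
  show "c *\<^sub>C proj K x \<in> K" by (intro cv.subspace_scale[OF sub] proj_in)
  fix k assume "k \<in> K"
  from proj_orth[OF this, of x]
  show "cinner k (c *\<^sub>C x - c *\<^sub>C proj K x) = 0" by (simp add: cinner_simps)
qed

lemma norm_proj_le: "norm (proj K x) \<le> norm x"
  and norm_proj_compl_le: "norm (x - proj K x) \<le> norm x"
proof -
  have "(norm (proj K x + (x - proj K x)))\<^sup>2 = (norm (proj K x))\<^sup>2 + (norm (x - proj K x))\<^sup>2"
    by (rule norm_sum_orthogonal) (rule proj_orth[OF proj_in])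
  then have "(norm (proj K x))\<^sup>2 \<le> (norm x)\<^sup>2" "(norm (x - proj K x))\<^sup>2 \<le> (norm x)\<^sup>2" by auto
  then show "norm (proj K x) \<le> norm x" "norm (x - proj K x) \<le> norm x"
    by (auto intro: power2_le_imp_le)
qed

text \<open>As \<open>v\<close> preserves \<open>K\<close>, its adjoint \<open>u\<close> keeps
  \<open>x - proj K x\<close> orthogonal to \<open>K\<close>. In the applications \<open>u\<close>
  is unitary and \<open>v\<close> its inverse.\<close>

lemma proj_commute:
  assumes "\<And>x y. cinner (u x) y = cinner x (v y)" "\<And>x. v x \<in> K \<longleftrightarrow> x \<in> K" 
    "\<And>x y. u (x - y) = u x - u y" "\<And>x. x \<in> K \<Longrightarrow> u x \<in> K"
  shows "proj K (u x) = u (proj K x)"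
proof (rule proj_unique)
  show "u (proj K x) \<in> K" by (intro assms proj_in)
  fix k assume "k \<in> K"
  then have "v k \<in> K" by (simp add: assms)
  have "cinner (u (x - proj K x)) k = cinner (x - proj K x) (v k)" by (rule assms)
  also have "\<dots> = 0" using proj_orth[OF \<open>v k \<in> K\<close>, of x] by (metis cinner_commute complex_cnj_zero)
  finally show "cinner k (u x - u (proj K x)) = 0"
    by (metis cinner_commute complex_cnj_zero assms(3))
qed

end

section \<open>Bounded operators and commutants\<close>

lemma bounded_opsI:
  assumes "\<And>x y. a (x + y) = a x + a y" "\<And>c x. a (c *\<^sub>C x) = c *\<^sub>C a x" "\<And>x. norm (a x) \<le> norm x * B"
  shows "a \<in> bounded_ops"
  unfolding bounded_ops_def
  by (auto simp: assms scaleR_scaleC intro!: bounded_linear_intro[of _ B])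

lemma
  assumes "a \<in> bounded_ops"
  shows bounded_ops_add: "a (x + y) = a x + a y"
    and bounded_ops_diff: "a (x - y) = a x - a y"
    and bounded_ops_scaleC: "a (c *\<^sub>C x) = c *\<^sub>C a x"
    and bounded_ops_zero: "a 0 = 0"
    and bounded_ops_linear: "bounded_linear a"
  using assms by (auto simp: bounded_ops_def dest: bounded_linear.linear
      intro: linear_add linear_diff linear_0)

lemma bounded_ops_bound:
  assumes "a \<in> bounded_ops"
  obtains B where "B > 0" "\<And>x. norm (a x) \<le> norm x * B"
  using bounded_linear.pos_bounded[OF bounded_ops_linear[OF assms]] by blast

lemmas tendsto_bounded_ops = bounded_linear.tendsto[OF bounded_ops_linear]

lemma bounded_ops_plus: 
  "a \<in> bounded_ops \<Longrightarrow> b \<in> bounded_ops \<Longrightarrow> (\<lambda>x. a x + b x) \<in> bounded_ops"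
  by (auto simp: bounded_ops_def bounded_linear_add scaleC_add_right)

lemma bounded_ops_scale: "a \<in> bounded_ops \<Longrightarrow> (\<lambda>x. c *\<^sub>C a x) \<in> bounded_ops"
  by (auto simp: bounded_ops_def scaleC_scaleC mult.commute
      intro: bounded_linear_compose[OF bounded_linear_scaleC])

lemma bounded_ops_comp: "a \<in> bounded_ops \<Longrightarrow> b \<in> bounded_ops \<Longrightarrow> a \<circ> b \<in> bounded_ops"
  by (auto simp: bounded_ops_def o_def intro: bounded_linear_compose)

lemma bounded_ops_id: "id \<in> bounded_ops"
  by (auto simp: bounded_ops_def id_def intro: bounded_linear_ident)

lemma riesz:
  fixes f :: "'a::chilbert_space \<Rightarrow> complex"
  assumes "bounded_linear f" "\<And>c x. f (c *\<^sub>C x) = c * f x"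
  shows "\<exists>z. \<forall>x. f x = cinner z x"
proof (cases "\<forall>x. f x = 0")
  case True
  then show ?thesis by (intro exI[of _ 0]) simp
next
  case False
  then obtain w where w: "f w \<noteq> 0" by auto
  define K where "K = {x. f x = 0}"
  have add: "f (x + y) = f x + f y" and diff: "f (x - y) = f x - f y" for x y
    using bounded_linear.linear[OF assms(1)] by (auto intro: linear_add linear_diff)
  have "closed K" unfolding K_def
    by (intro closed_Collect_eq linear_continuous_on assms(1) continuous_on_const)
  moreover have sub: "cv.subspace K"
    unfolding K_def using bounded_linear.linear[OF assms(1)]
    by (auto intro!: cv.subspaceI simp: add assms(2) linear_0)
  ultimately have pin: "proj K x \<in> K" and po: "\<And>k. k \<in> K \<Longrightarrow> cinner k (x - proj K x) = 0" for x
    using proj_in proj_orth by blast+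
  define z where "z = w - proj K w"
  have fz: "f z = f w" using pin[of w] by (simp add: z_def diff K_def)
  then have z0: "z \<noteq> 0" using w linear_0[OF bounded_linear.linear[OF assms(1)]] by auto
  have "f x = cinner (cnj (f z / complex_of_real ((norm z)\<^sup>2)) *\<^sub>C z) x" for x
  proof -
    have "x - (f x / f z) *\<^sub>C z \<in> K" using w fz by (simp add: K_def diff assms(2))
    then have "cinner (x - (f x / f z) *\<^sub>C z) z = 0" unfolding z_def by (rule po)
    then have "cinner z (x - (f x / f z) *\<^sub>C z) = 0" by (metis cinner_commute complex_cnj_zero)
    then have "cinner z x = f x / f z * complex_of_real ((norm z)\<^sup>2)"
      by (simp add: cinner_simps cinner_self)
    then show ?thesis using w fz z0 by (simp add: cinner_scaleC_left)
  qed
  then show ?thesis by blast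
qed

lemma adjoint_exists:
  fixes a :: "'a::chilbert_space \<Rightarrow> 'a"
  assumes a: "a \<in> bounded_ops"
  shows "\<exists>b. adjoint_pair a b"
proof -
  have "\<exists>z. \<forall>x. cinner y (a x) = cinner z x" for y
  proof (rule riesz)
    show "bounded_linear (\<lambda>x. cinner y (a x))"
      by (rule bounded_linear_compose[OF bounded_bilinear.bounded_linear_right[OF bounded_bilinear_cinner]
            bounded_ops_linear[OF a]])
  qed (simp add: bounded_ops_scaleC[OF a] cinner_scaleC_right)
  then obtain b where b: "\<And>x y. cinner y (a x) = cinner (b y) x" by metis
  have b': "cinner (a x) y = cinner x (b y)" for x y
    by (metis b cinner_commute)
  obtain B where B: "B > 0" "\<And>x. norm (a x) \<le> norm x * B" using bounded_ops_bound[OF a] by blast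
  have "b \<in> bounded_ops"
  proof (rule bounded_opsI)
    show "b (x + y) = b x + b y" for x y
      by (rule cinner_ext) (simp add: b'[symmetric] cinner_simps)
    show "b (c *\<^sub>C x) = c *\<^sub>C b x" for c x
      by (rule cinner_ext) (simp add: b'[symmetric] cinner_simps)
    show "norm (b y) \<le> norm y * B" for y
    proof (cases "b y = 0")
      case False
      have "complex_of_real ((norm (b y))\<^sup>2) = cinner y (a (b y))" by (simp add: b cinner_self)
      then have "(norm (b y))\<^sup>2 = cmod (cinner y (a (b y)))" by (metis norm_of_real abs_of_nonneg zero_le_power2)
      also have "\<dots> \<le> norm y * norm (a (b y))" by (rule cinner_Cauchy_Schwarz)
      also have "\<dots> \<le> norm y * (norm (b y) * B)" by (intro mult_left_mono B) auto
      finally show ?thesis using False by (simp add: power2_eq_square mult.commute mult.left_commute)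
    qed (use B in auto)
  qed
  then show ?thesis using a b' by (auto simp: adjoint_pair_def)
qed

lemma adjoint_pair_sym: "adjoint_pair a b \<Longrightarrow> adjoint_pair b a"
  unfolding adjoint_pair_def by (metis cinner_commute)

lemma adjoint_pairD: "adjoint_pair a b \<Longrightarrow> cinner (a x) y = cinner x (b y)"
  by (simp add: adjoint_pair_def)

lemma adjoint_pairD': "adjoint_pair a b \<Longrightarrow> cinner (b x) y = cinner x (a y)"
  using adjoint_pairD[OF adjoint_pair_sym] .

lemma adjoint_pair_bdd: "adjoint_pair a b \<Longrightarrow> a \<in> bounded_ops" "adjoint_pair a b \<Longrightarrow> b \<in> bounded_ops"
  by (auto simp: adjoint_pair_def)

lemma commutant_bounded: "commutant S \<subseteq> bounded_ops"
  by (auto simp: commutant_def)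

lemma commutant_mem: "b \<in> commutant S \<Longrightarrow> a \<in> S \<Longrightarrow> a (b x) = b (a x)"
  unfolding commutant_def by (metis (mono_tags, lifting) comp_apply mem_Collect_eq)

lemma commutantI: "b \<in> bounded_ops \<Longrightarrow> (\<And>a x. a \<in> S \<Longrightarrow> a (b x) = b (a x)) \<Longrightarrow> b \<in> commutant S"
  by (auto simp: commutant_def fun_eq_iff)

lemma commutant_anti: "S \<subseteq> T \<Longrightarrow> commutant T \<subseteq> commutant S"
  by (auto simp: commutant_def)

lemma commutant_double: "S \<subseteq> bounded_ops \<Longrightarrow> S \<subseteq> commutant (commutant S)"
  by (auto simp: commutant_def)

lemma commutant_triple: "S \<subseteq> bounded_ops \<Longrightarrow> commutant (commutant (commutant S)) = commutant S"
  by (intro antisym commutant_anti commutant_double commutant_bounded) 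

lemma commutant_adjoint:
  assumes "\<forall>a\<in>S. \<exists>b\<in>S. adjoint_pair a b" "b \<in> commutant S" "adjoint_pair b c"
  shows "c \<in> commutant S"
proof (rule commutantI)
  show "c \<in> bounded_ops" using assms(3) by (rule adjoint_pair_bdd)
  fix a x assume "a \<in> S"
  then obtain a' where a': "a' \<in> S" "adjoint_pair a a'" using assms(1) by blast
  show "a (c x) = c (a x)"
  proof (rule cinner_ext)
    fix z
    have "cinner z (a (c x)) = cinner (b (a' z)) x"
      by (simp add: adjoint_pairD'[OF a'(2), symmetric] adjoint_pairD[OF assms(3)])
    also have "\<dots> = cinner z (c (a x))"
      by (simp add: commutant_mem[OF assms(2) a'(1), symmetric] adjoint_pairD'[OF a'(2)] 
          adjoint_pairD[OF assms(3)])
    finally show "cinner z (a (c x)) = cinner z (c (a x))" .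
  qed
qed

lemma von_neumann_commutant:
  fixes S :: "('a::chilbert_space \<Rightarrow> 'a) set"
  assumes "S \<subseteq> bounded_ops" "\<forall>a\<in>S. \<exists>b\<in>S. adjoint_pair a b"
  shows "von_neumann_algebra (commutant S)"
  unfolding von_neumann_algebra_def
proof (intro conjI ballI commutant_bounded commutant_triple assms)
  fix a assume a: "a \<in> commutant S"
  then obtain b where b: "adjoint_pair a b" using adjoint_exists commutant_bounded by blast
  with commutant_adjoint[OF assms(2) a b] show "\<exists>b\<in>commutant S. adjoint_pair a b" by blast
qed

lemma
  assumes "von_neumann_algebra M"
  shows vN_bounded: "M \<subseteq> bounded_ops"
    and vN_double_commutant: "commutant (commutant M) = M"
    and vN_adjoint: "a \<in> M \<Longrightarrow> \<exists>b\<in>M. adjoint_pair a b"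
  using assms by (auto simp: von_neumann_algebra_def)

lemma
  assumes that: "S \<subseteq> bounded_ops"
  shows commutant_plus: "a \<in> commutant S \<Longrightarrow> b \<in> commutant S \<Longrightarrow> (\<lambda>x. a x + b x) \<in> commutant S"
    and commutant_scale: "a \<in> commutant S \<Longrightarrow> (\<lambda>x. c *\<^sub>C a x) \<in> commutant S"
    and commutant_comp: "a \<in> commutant S \<Longrightarrow> b \<in> commutant S \<Longrightarrow> a \<circ> b \<in> commutant S"
    and commutant_id: "id \<in> commutant S"
proof -
  note lin = bounded_ops_add[OF subsetD[OF that]] bounded_ops_scaleC[OF subsetD[OF that]]
  note bdd = commutant_bounded[THEN subsetD]
  show "(\<lambda>x. a x + b x) \<in> commutant S" if "a \<in> commutant S" "b \<in> commutant S"
    by (rule commutantI[OF bounded_ops_plus[OF that[THEN bdd]]])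
      (simp add: lin that[THEN commutant_mem])
  show "(\<lambda>x. c *\<^sub>C a x) \<in> commutant S" if "a \<in> commutant S"
    by (rule commutantI[OF bounded_ops_scale[OF that[THEN bdd]]])
      (simp add: lin that[THEN commutant_mem])
  show "a \<circ> b \<in> commutant S" if "a \<in> commutant S" "b \<in> commutant S"
    by (rule commutantI[OF bounded_ops_comp[OF that[THEN bdd]]])
      (simp add: that[THEN commutant_mem])
  show "id \<in> commutant S" by (rule commutantI[OF bounded_ops_id]) simp
qed

context
  fixes M :: "('a::chilbert_space \<Rightarrow> 'a) set"
  assumes M: "von_neumann_algebra M"
begin

lemma vN_plus: "a \<in> M \<Longrightarrow> b \<in> M \<Longrightarrow> (\<lambda>x. a x + b x) \<in> M"
  and vN_scale: "a \<in> M \<Longrightarrow> (\<lambda>x. c *\<^sub>C a x) \<in> M"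
  and vN_comp: "a \<in> M \<Longrightarrow> b \<in> M \<Longrightarrow> a \<circ> b \<in> M"
  using commutant_plus[OF commutant_bounded, of a M b] commutant_scale[OF commutant_bounded, of a M c]
    commutant_comp[OF commutant_bounded, of a M b]
  by (simp_all add: vN_double_commutant[OF M])

lemma vN_diff:
  assumes "a \<in> M" "b \<in> M"
  shows "(\<lambda>x. a x - b x) \<in> M"
proof -
  have "(\<lambda>x. a x + (-1) *\<^sub>C b x) \<in> M" by (intro vN_plus vN_scale assms)
  then show ?thesis by simp
qed

end

section \<open>The unitaries of the commutant determine a von Neumann algebra\<close>

text \<open>\<open>R\<close> is the inverse of \<open>1 + k\<close>, found as the fixed point of the
  contraction sending \<open>x\<close> to \<open>y - k x\<close>. Uniqueness of the fixed point
  yields linearity and carries commutation with \<open>k\<close> over to \<open>R\<close>.\<close>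

lemma neumann_inverse:
  fixes k :: "'a::chilbert_space \<Rightarrow> 'a"
  assumes k: "k \<in> bounded_ops" "\<And>x. norm (k x) \<le> norm x / 2"
  obtains R where "R \<in> bounded_ops" "\<And>x. R x + k (R x) = x" "\<And>x. R (x + k x) = x"
    "\<And>b y. b \<in> bounded_ops \<Longrightarrow> (\<And>x. b (k x) = k (b x)) \<Longrightarrow> b (R y) = R (b y)"
proof -
  have "\<exists>!x. y - k x = x" for y
  proof (rule banach_fix_type[of "1/2"])
    show "\<forall>x z. dist (y - k x) (y - k z) \<le> 1 / 2 * dist x z"
    proof (intro allI)
      fix x z
      have "dist (y - k x) (y - k z) = norm (k (x - z))"
        by (simp add: dist_norm bounded_ops_diff[OF k(1)] norm_minus_commute)
      then show "dist (y - k x) (y - k z) \<le> 1 / 2 * dist x z"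
        using k(2)[of "x - z"] by (simp add: dist_norm)
    qed
  qed auto
  then have ex: "\<exists>!x. x + k x = y" for y by (metis add_diff_cancel diff_add_cancel)
  define R where "R y = (THE x. x + k x = y)" for y
  have R: "R y + k (R y) = y" for y unfolding R_def by (rule theI'[OF ex])
  have Ru: "R y = x" if "x + k x = y" for x y using R[of y] ex[of y] that by blast
  have "R \<in> bounded_ops"
  proof (rule bounded_opsI[of _ 2])
    show "R (x + y) = R x + R y" for x y
      by (rule Ru) (metis (no_types, lifting) R add.assoc add.left_commute bounded_ops_add[OF k(1)])
    show "R (c *\<^sub>C x) = c *\<^sub>C R x" for c x
      by (rule Ru) (metis R bounded_ops_scaleC[OF k(1)] scaleC_add_right)
    show "norm (R x) \<le> norm x * 2" for x
      using norm_triangle_ineq4[of x "k (R x)"] R[of x] k(2)[of "R x"]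
      by (smt (verit, ccfv_threshold) add_diff_cancel field_sum_of_halves)
  qed
  moreover have "R (x + k x) = x" for x by (rule Ru) simp
  moreover have "b (R x) = R (b x)" if "b \<in> bounded_ops" "\<And>x. b (k x) = k (b x)" for b x
    by (rule Ru[symmetric]) (metis R bounded_ops_add[OF that(1)] that(2))
  ultimately show ?thesis using R that by blast
qed

text \<open>A self-adjoint element \<open>b\<close> of the commutant of \<open>M\<close> is recovered from its Cayley transform.\<close>

lemma commute_selfadjoint:
  fixes a :: "'a::chilbert_space \<Rightarrow> 'a"
  assumes M: "M \<subseteq> bounded_ops" and a: "a \<in> bounded_ops"
    and u: "\<And>u v x. u \<in> commutant M \<Longrightarrow> adjoint_pair u v \<Longrightarrow> u \<circ> v = id \<Longrightarrow> v \<circ> u = id \<Longrightarrow>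
      a (u x) = u (a x)"
    and b: "b \<in> commutant M" "adjoint_pair b b"
  shows "a (b x) = b (a x)"
proof -
  have bb: "b \<in> bounded_ops" using b(2) by (rule adjoint_pair_bdd)
  obtain B where B: "B > 0" "\<And>x. norm (b x) \<le> norm x * B" using bounded_ops_bound[OF bb] by blast
  \<comment> \<open>The factor \<open>\<i>\<close> makes \<open>k = w b\<close> skew-adjoint and the
    factor \<open>1 / (2 * B)\<close> makes its norm at most 1/2, so \<open>1 + k\<close> and
    \<open>1 - k\<close> have bounded inverses \<open>R\<close> and \<open>S\<close>, adjoint to
    each other.\<close>
  define w where "w = \<i> / complex_of_real (2 * B)"
  define k where "k x = w *\<^sub>C b x" for x
  define k' where "k' x = (- w) *\<^sub>C b x" for x
  have w: "w \<noteq> 0" "cnj w = - w" "cmod w = 1 / (2 * B)" using B(1) by (auto simp: w_def norm_divide norm_mult)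
  have kb: "k \<in> bounded_ops" "k' \<in> bounded_ops"
    unfolding k_def[abs_def] k'_def[abs_def] by (intro bounded_ops_scale bb)+
  have kn: "norm (k x) \<le> norm x / 2" "norm (k' x) \<le> norm x / 2" for x
    using B(2)[of x] B(1) by (auto simp: k_def k'_def norm_scaleC w field_simps)
  obtain R where R: "R \<in> bounded_ops" "\<And>x. R x + k (R x) = x" "\<And>x. R (x + k x) = x"
    "\<And>b y. b \<in> bounded_ops \<Longrightarrow> (\<And>x. b (k x) = k (b x)) \<Longrightarrow> b (R y) = R (b y)"
    using neumann_inverse[OF kb(1) kn(1)] by blast
  obtain S where S: "S \<in> bounded_ops" "\<And>x. S x + k' (S x) = x" "\<And>x. S (x + k' x) = x"
    "\<And>b y. b \<in> bounded_ops \<Longrightarrow> (\<And>x. b (k' x) = k' (b x)) \<Longrightarrow> b (S y) = S (b y)"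
    using neumann_inverse[OF kb(2) kn(2)] by blast
  have kk: "cinner (k x) y = cinner x (k' y)" for x y
    by (simp add: k_def k'_def cinner_simps w adjoint_pairD[OF b(2)])
  have RS: "cinner (R x) y = cinner x (S y)" for x y
  proof -
    have "cinner (R x) y = cinner (R x) (S y + k' (S y))" by (simp add: S(2))
    also have "\<dots> = cinner (R x + k (R x)) (S y)" by (simp only: cinner_add_left cinner_add_right kk)
    finally show ?thesis by (simp add: R(2))
  qed
  have RM: "R \<in> commutant M"
  proof (rule commutantI[OF R(1)])
    fix m x assume m: "m \<in> M"
    show "m (R x) = R (m x)"
      using commutant_mem[OF b(1) m] bounded_ops_scaleC[OF subsetD[OF M m]] subsetD[OF M m]
      by (intro R(4)) (auto simp: k_def)
  qed
  \<comment> \<open>The Cayley transform: \<open>2 R - 1\<close> equals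
    \<open>(1 - k) (1 + k)^-1\<close>.\<close>
  define u where "u x = 2 *\<^sub>C R x - x" for x
  define v where "v x = 2 *\<^sub>C S x - x" for x
  have two: "x + x = 2 *\<^sub>C x" for x :: 'a using scaleC_add_left[of 1 1 x] by simp
  have "u \<in> commutant M"
  proof -
    have "(\<lambda>x. 2 *\<^sub>C R x + (-1) *\<^sub>C id x) \<in> commutant M"
      using M by (intro commutant_plus commutant_scale RM commutant_id)
    then show ?thesis by (simp add: u_def[abs_def])
  qed
  moreover have "adjoint_pair u v"
  proof -
    have "(\<lambda>x. 2 *\<^sub>C S x + (-1) *\<^sub>C id x) \<in> bounded_ops" "(\<lambda>x. 2 *\<^sub>C R x + (-1) *\<^sub>C id x) \<in> bounded_ops"
      by (intro bounded_ops_plus bounded_ops_scale S R bounded_ops_id)+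
    then show ?thesis
      by (auto simp: adjoint_pair_def u_def[abs_def] v_def[abs_def] cinner_simps RS)
  qed
  \<comment> \<open>Resolvent identity. Since \<open>u v = 4 R S - 2 (R + S) + 1\<close>, it is what
    makes \<open>u\<close> and \<open>v\<close> inverse to each other.\<close>
  moreover have rs: "R x + S x = 2 *\<^sub>C R (S x)" "R x + S x = 2 *\<^sub>C S (R x)" for x
  proof -
    have e: "k' z = - k z" for z by (simp add: k_def k'_def)
    have "R x = R (S x + k' (S x))" by (simp add: S(2))
    also have "\<dots> = R (S x) - R (k (S x))" by (simp add: e bounded_ops_diff[OF R(1)])
    finally have 1: "R x = R (S x) - R (k (S x))" .
    have "S x = R (S x + k (S x))" by (simp add: R(3))
    also have "\<dots> = R (S x) + R (k (S x))" by (simp add: bounded_ops_add[OF R(1)])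
    finally show "R x + S x = 2 *\<^sub>C R (S x)" unfolding two[symmetric] using 1
      by (metis add_diff_cancel_right' add.commute add.left_commute diff_add_cancel)
    have "S x = S (R x + k (R x))" by (simp add: R(2))
    also have "\<dots> = S (R x) + S (k (R x))" by (simp add: bounded_ops_add[OF S(1)])
    finally have 2: "S x = S (R x) + S (k (R x))" .
    have "R x = S (R x + k' (R x))" by (simp add: S(3))
    also have "\<dots> = S (R x) - S (k (R x))" by (simp add: e bounded_ops_diff[OF S(1)])
    finally show "R x + S x = 2 *\<^sub>C S (R x)" unfolding two[symmetric] using 2
      by (metis add_diff_cancel_right' add.commute add.left_commute diff_add_cancel)
  qed
  moreover have "u (v x) = x" "v (u x) = x" for x
    unfolding u_def v_def bounded_ops_diff[OF R(1)] bounded_ops_diff[OF S(1)]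
      bounded_ops_scaleC[OF R(1)] bounded_ops_scaleC[OF S(1)] rs[symmetric]
    by simp_all
  then have "u \<circ> v = id" "v \<circ> u = id" by (simp_all add: fun_eq_iff)
  \<comment> \<open>Commuting with \<open>u\<close>, the operator \<open>a\<close> commutes with
    \<open>R = (u + 1) / 2\<close>, hence with its inverse \<open>1 + k\<close>, hence with
    \<open>b\<close>.\<close>
  ultimately have "a (u x) = u (a x)" for x using u by blast
  then have "2 *\<^sub>C a (R x) = 2 *\<^sub>C R (a x)" for x
    by (simp add: u_def bounded_ops_diff[OF a] bounded_ops_scaleC[OF a])
  then have aR: "a (R x) = R (a x)" for x by simp
  have "a x + a (k x) = a x + k (a x)" for x
    by (metis R(2,3) aR bounded_ops_add[OF a])
  then have "w *\<^sub>C a (b x) = w *\<^sub>C b (a x)" by (simp add: k_def bounded_ops_scaleC[OF a])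
  then show ?thesis using w(1) by simp
qed

text \<open>Affiliation tests only the unitaries of the commutant, whereas the double commutant
  involves all of it. Real and imaginary parts \<open>r\<close>, \<open>s\<close> reduce the gap to
  self-adjoint elements, and Cayley transforms spare the operator square roots by which an element
  is usually written as a combination of unitaries.\<close>

lemma vN_unitary_criterion:
  fixes a :: "'a::chilbert_space \<Rightarrow> 'a"
  assumes M: "von_neumann_algebra M" and a: "a \<in> bounded_ops"
    and u: "\<And>u v x. u \<in> commutant M \<Longrightarrow> adjoint_pair u v \<Longrightarrow> u \<circ> v = id \<Longrightarrow> v \<circ> u = id \<Longrightarrow>
      a (u x) = u (a x)"
  shows "a \<in> M"
proof -
  have "a \<in> commutant (commutant M)"
  proof (rule commutantI[OF a])
    fix b x assume b: "b \<in> commutant M"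
    then obtain c where bc: "adjoint_pair b c" using adjoint_exists commutant_bounded by blast
    then have c: "c \<in> commutant M"
      using commutant_adjoint[OF _ b] vN_adjoint[OF M] by blast
    note Mb = vN_bounded[OF M]
    define r where "r x = (1/2) *\<^sub>C b x + (1/2) *\<^sub>C c x" for x
    define s where "s x = (-\<i>/2) *\<^sub>C b x + (\<i>/2) *\<^sub>C c x" for x
    have rs: "r \<in> commutant M" "s \<in> commutant M"
      unfolding r_def[abs_def] s_def[abs_def] by (intro commutant_plus commutant_scale Mb b c)+
    have adj: "adjoint_pair r r" "adjoint_pair s s"
      using rs commutant_bounded
      by (auto simp: adjoint_pair_def r_def s_def cinner_simps adjoint_pairD[OF bc] adjoint_pairD'[OF bc])
    have bx: "b x = r x + \<i> *\<^sub>C s x" for x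
    proof -
      have "\<i> *\<^sub>C s x = (1/2) *\<^sub>C b x - (1/2) *\<^sub>C c x"
        by (simp add: s_def cv.scale_right_diff_distrib)
      then have "r x + \<i> *\<^sub>C s x = (1/2) *\<^sub>C b x + (1/2) *\<^sub>C b x" by (simp add: r_def)
      also have "\<dots> = b x" by (simp flip: scaleC_add_left)
      finally show ?thesis by simp
    qed
    show "b (a x) = a (b x)"
      using commute_selfadjoint[OF Mb a u rs(1) adj(1)] commute_selfadjoint[OF Mb a u rs(2) adj(2)]
      by (simp add: bx bounded_ops_add[OF a] bounded_ops_scaleC[OF a])
  qed
  then show ?thesis by (simp add: vN_double_commutant[OF M])
qed

section \<open>Graphs of unbounded operators\<close>

text \<open>Graphs are subspaces of the direct sum of the space with itself; projecting onto them
  requires its Hilbert space structure.\<close>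

instantiation prod :: (complex_vector, complex_vector) complex_vector
begin
definition scaleC_prod :: "complex \<Rightarrow> 'a \<times> 'b \<Rightarrow> 'a \<times> 'b" where
  "scaleC_prod c p = (c *\<^sub>C fst p, c *\<^sub>C snd p)"
instance
  by standard
    (auto simp: scaleC_prod_def prod_eq_iff scaleC_add_left scaleC_add_right scaleC_scaleC scaleC_of_real)
end

instantiation prod :: (complex_inner, complex_inner) complex_inner
begin
definition cinner_prod :: "'a \<times> 'b \<Rightarrow> 'a \<times> 'b \<Rightarrow> complex" where
  "cinner_prod p r = cinner (fst p) (fst r) + cinner (snd p) (snd r)"
instance
proof
  fix x y z :: "'a \<times> 'b" and c
  show "cinner x y = cnj (cinner y x)"
    unfolding cinner_prod_def by (metis cinner_commute complex_cnj_add)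
  show "cinner x (y + z) = cinner x y + cinner x z" "cinner x (c *\<^sub>C y) = c * cinner x y"
    by (simp_all add: cinner_prod_def scaleC_prod_def cinner_simps algebra_simps)
  show "cinner x x = complex_of_real ((norm x)\<^sup>2)"
    by (simp add: cinner_prod_def norm_prod_def cinner_self flip: of_real_power of_real_add)
qed
end

instance prod :: (chilbert_space, chilbert_space) chilbert_space ..

lemma scaleC_Pair [simp]: "c *\<^sub>C (x, y) = (c *\<^sub>C x, c *\<^sub>C y)"
  by (simp add: scaleC_prod_def)

lemma cinner_Pair [simp]: "cinner (x, y) (x', y') = cinner x x' + cinner y y'"
  by (simp add: cinner_prod_def)

lemma closure_graph_subspace:
  assumes D: "cv.subspace D"
    and T: "\<And>x y. x \<in> D \<Longrightarrow> y \<in> D \<Longrightarrow> T (x + y) = T x + T y"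
      "\<And>c x. x \<in> D \<Longrightarrow> T (c *\<^sub>C x) = c *\<^sub>C T x"
  shows "cv.subspace (closure_graph D T)"
  unfolding closure_graph_def
proof (rule subspace_closure, rule cv.subspaceI)
  have "T 0 = 0" using T(2)[OF cv.subspace_0[OF D], of 0] by simp
  then show "0 \<in> {(x, T x) |x. x \<in> D}" by (auto simp: zero_prod_def cv.subspace_0[OF D])
qed (use T cv.subspace_add[OF D] cv.subspace_scale[OF D] in fastforce)+

lemma closed_closure_graph: "closed (closure_graph D T)"
  by (simp add: closure_graph_def)

lemma closure_graph_base: "x \<in> D \<Longrightarrow> (x, T x) \<in> closure_graph D T"
  unfolding closure_graph_def by (intro subsetD[OF closure_subset]) auto

text \<open>Affiliation says that \<open>u\<close>, acting on both components, preserves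
  \<open>G\<close>; hence it commutes with the projection and with the entries of its 2 by 2 matrix.
  For the graph of a closed densely defined \<open>T\<close> with adjoint \<open>T'\<close>, the
  entry taken here is \<open>T (1 + T' T)^-1\<close>.\<close>

lemma proj_graph_mem_vN:
  fixes G :: "('h::chilbert_space \<times> 'h) set"
  assumes M: "von_neumann_algebra M" and G: "closed G" "cv.subspace G" and aff: "affiliated G M"
  shows "(\<lambda>x. snd (proj G (x, 0))) \<in> M"
proof (rule vN_unitary_criterion[OF M])
  show "(\<lambda>x. snd (proj G (x, 0))) \<in> bounded_ops"
  proof (rule bounded_opsI[of _ 1])
    fix x y :: 'h and c
    show "snd (proj G (x + y, 0)) = snd (proj G (x, 0)) + snd (proj G (y, 0))"
      using proj_add[OF G, of "(x, 0)" "(y, 0)"] by simp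
    show "snd (proj G (c *\<^sub>C x, 0)) = c *\<^sub>C snd (proj G (x, 0))"
      using proj_scaleC[OF G, of c "(x, 0)"] by (simp add: scaleC_prod_def)
    have "norm (snd (proj G (x, 0))) \<le> norm (proj G (x, 0))" by (metis norm_snd_le prod.collapse)
    also have "\<dots> \<le> norm (x, 0 :: 'h)" by (rule norm_proj_le[OF G])
    finally show "norm (snd (proj G (x, 0))) \<le> norm x * 1" by simp
  qed
  fix u v x
  assume u: "u \<in> commutant M" "adjoint_pair u v" "u \<circ> v = id" "v \<circ> u = id"
  have v: "v \<in> commutant M" using commutant_adjoint[OF _ u(1,2)] vN_adjoint[OF M] by blast
  have uv: "u (v x) = x" "v (u x) = x" for x using u(3,4) by (auto simp: fun_eq_iff)
  note lin = bounded_ops_diff[OF adjoint_pair_bdd(1)[OF u(2)]]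
    bounded_ops_zero[OF adjoint_pair_bdd(1)[OF u(2)]]
  let ?u = "\<lambda>p. (u (fst p), u (snd p))" and ?v = "\<lambda>p. (v (fst p), v (snd p))"
  have uG: "?u p \<in> G" if "p \<in> G" for p
    using aff u that unfolding affiliated_def by fastforce
  have vG: "?v p \<in> G" if "p \<in> G" for p
    using aff v adjoint_pair_sym[OF u(2)] u(3,4) that unfolding affiliated_def by fastforce
  have "proj G (?u (x, 0)) = ?u (proj G (x, 0))"
  proof (rule proj_commute[OF G, where v = ?v])
    show "cinner (?u p) r = cinner p (?v r)" for p r
      by (cases p, cases r) (simp add: adjoint_pairD[OF u(2)])
    show "?v p \<in> G \<longleftrightarrow> p \<in> G" for p
      using uG[of "?v p"] vG[of p] by (auto simp: uv)
  qed (auto simp: lin uG)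
  then show "snd (proj G (u x, 0)) = u (snd (proj G (x, 0)))"
    by (simp add: lin)
qed

text \<open>With \<open>T\<^sub>e = e T\<close> and \<open>P\<close> the projection onto the closure of its graph, \<open>(x, T\<^sub>e x)\<close> is fixed
  by \<open>P\<close>, so that the bounded operator \<open>snd P (x, 0) / e\<close> differs from \<open>T x\<close> by \<open>snd P (0, T x)\<close>.\<close>

lemma proj_graph_approx:
  fixes T Te :: "'h::chilbert_space \<Rightarrow> 'h"
  assumes D: "cv.subspace D"
    and T: "\<And>x y. x \<in> D \<Longrightarrow> y \<in> D \<Longrightarrow> T (x + y) = T x + T y"
      "\<And>c x. x \<in> D \<Longrightarrow> T (c *\<^sub>C x) = c *\<^sub>C T x" "\<And>x. x \<in> D \<Longrightarrow> T x \<in> D"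
      "\<And>x y. x \<in> D \<Longrightarrow> y \<in> D \<Longrightarrow> cinner (T x) y = cinner x (T y)"
    and Te: "\<And>x. x \<in> D \<Longrightarrow> Te x = e *\<^sub>R T x" and e: "e > 0" and x: "x \<in> D"
  shows "norm ((1 / e) *\<^sub>R snd (proj (closure_graph D Te) (x, 0)) - T x) \<le> e * norm (T (T x))"
proof -
  let ?G = "closure_graph D Te"
  have sub: "cv.subspace ?G"
    by (rule closure_graph_subspace[OF D])
      (simp_all add: Te T D cv.subspace_add cv.subspace_scale scaleR_scaleC
        scaleC_scaleC scaleC_add_right mult.commute)
  note G = closed_closure_graph[of D Te] sub
  define z where "z = T x"
  have z: "z \<in> D" by (simp add: z_def T x)
  obtain w y where p: "proj ?G (0, z) = (w, y)" by fastforce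
  have "proj ?G (x, Te x) = (x, Te x)" by (intro proj_id[OF G] closure_graph_base x)
  moreover have "(x, Te x) = (x, 0) + complex_of_real e *\<^sub>C (0, z)"
    by (simp add: Te x z_def scaleR_scaleC)
  ultimately have "proj ?G (x, 0) + complex_of_real e *\<^sub>C (w, y) = (x, Te x)"
    using proj_add[OF G, of "(x, 0)" "complex_of_real e *\<^sub>C (0, z)"]
      proj_scaleC[OF G, of "complex_of_real e" "(0, z)"] p by simp
  then have "snd (proj ?G (x, 0)) + e *\<^sub>R y = e *\<^sub>R z"
    by (simp add: Te x z_def scaleC_of_real prod_eq_iff)
  then have "snd (proj ?G (x, 0)) = e *\<^sub>R (z - y)" by (simp add: algebra_simps)
  then have eq: "(1 / e) *\<^sub>R snd (proj ?G (x, 0)) - z = - y" using e by simp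
  \<comment> \<open>Symmetry of \<open>T\<close> on \<open>D\<close>, phrased as a closed condition
    on pairs, passes to the closure of the graph and stands in for self-adjointness.\<close>
  have "closed {r. cinner (snd r) z = complex_of_real e * cinner (fst r) (T z)}"
    by (intro closed_Collect_eq continuous_intros)
  then have "?G \<subseteq> {r. cinner (snd r) z = complex_of_real e * cinner (fst r) (T z)}"
    unfolding closure_graph_def
    by (intro closure_minimal) (auto simp: Te cinner_scaleR_left T z)
  then have yz: "cinner y z = complex_of_real e * cinner w (T z)"
    using proj_in[OF G, of "(0, z)"] p by auto
  \<comment> \<open>The squared norm of a projected vector is its inner product with the original
    one. Together with \<open>yz\<close> this bounds it by \<open>e\<close> times its norm times
    \<open>norm (T z)\<close>, and one factor cancels.\<close>
  have "cinner (w, y) ((0, z) - (w, y)) = 0"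
    using proj_orth[OF G proj_in[OF G], of "(0, z)" "(0, z)"] p by metis
  then have "cinner (w, y) (w, y) = cinner (w, y) (0, z)" by (subst (asm) cinner_diff_right) simp
  then have "complex_of_real ((norm (w, y))\<^sup>2) = complex_of_real e * cinner w (T z)"
    unfolding cinner_self using yz by simp
  then have "(norm (w, y))\<^sup>2 = cmod (complex_of_real e * cinner w (T z))"
    by (metis norm_of_real abs_of_nonneg zero_le_power2)
  also have "\<dots> \<le> e * (norm w * norm (T z))"
    using e cinner_Cauchy_Schwarz[of w "T z"] by (simp add: norm_mult)
  also have "\<dots> \<le> e * (norm (w, y) * norm (T z))"
    using e norm_fst_le[of w y] by (intro mult_left_mono mult_right_mono) auto
  finally have "norm (w, y) * norm (w, y) \<le> norm (w, y) * (e * norm (T z))"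
    by (simp add: power2_eq_square mult_ac)
  then have "norm (w, y) \<le> e * norm (T z)"
  proof (cases "norm (w, y) > 0")
    case False
    then have "norm (w, y) \<le> 0" by linarith
    also have "0 \<le> e * norm (T z)" using e by simp
    finally show ?thesis .
  qed (rule mult_left_le_imp_le)
  then have "norm y \<le> e * norm (T z)" using norm_snd_le[of y w] by linarith
  then show ?thesis using eq by (simp add: z_def)
qed

section \<open>Extending isometries\<close>

text \<open>The isometry is built as a closed relation. On the span of the pairs
  \<open>(X i, Y i)\<close> the inner products of first and of second components agree; this makes
  the relation single-valued and its closure total, which settles well-definedness on linear
  combinations and extension by continuity together.\<close>

lemma isometry_extension:
  fixes X Y :: "'i \<Rightarrow> 'h::chilbert_space"
  assumes iso: "\<And>i j. i \<in> I \<Longrightarrow> j \<in> I \<Longrightarrow> cinner (X i) (X j) = cinner (Y i) (Y j)"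
    and dense: "closure (cspan (X ` I)) = UNIV"
  obtains u where "u \<in> bounded_ops" "\<And>i. i \<in> I \<Longrightarrow> u (X i) = Y i"
    "\<And>x y. cinner (u x) (u y) = cinner x y"
proof -
  define S where "S = cspan ((\<lambda>i. (X i, Y i)) ` I)"
  have Ssub: "cv.subspace S" by (simp add: S_def cv.subspace_span)
  have SS: "cinner (fst p) (fst r) = cinner (snd p) (snd r)" if "p \<in> S" "r \<in> S" for p r
    using that(1) unfolding S_def
  proof (induction rule: cv.span_induct_alt)
    case (step c b p)
    then obtain i where i: "i \<in> I" "b = (X i, Y i)" by auto
    have "cinner (X i) (fst r) = cinner (Y i) (snd r)"
      using that(2) unfolding S_def
      by (induction rule: cv.span_induct_alt) (auto simp: scaleC_prod_def cinner_simps iso i)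
    then show ?case using step i by (auto simp: scaleC_prod_def cinner_simps)
  qed simp
  define G where "G = closure S"
  have Gsub: "cv.subspace G" unfolding G_def by (rule subspace_closure[OF Ssub])
  have GG1: "cinner (fst p) (fst r) = cinner (snd p) (snd r)" if "p \<in> G" "r \<in> S" for p r
  proof -
    have "closed {p. cinner (fst p) (fst r) = cinner (snd p) (snd r)}"
      by (intro closed_Collect_eq continuous_intros)
    then have "G \<subseteq> {p. cinner (fst p) (fst r) = cinner (snd p) (snd r)}"
      unfolding G_def using SS that(2) by (intro closure_minimal) auto
    then show ?thesis using that by blast
  qed
  have GG: "cinner (fst p) (fst r) = cinner (snd p) (snd r)" if "p \<in> G" "r \<in> G" for p r
  proof -
    have "closed {r. cinner (fst p) (fst r) = cinner (snd p) (snd r)}"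
      by (intro closed_Collect_eq continuous_intros)
    then have "G \<subseteq> {r. cinner (fst p) (fst r) = cinner (snd p) (snd r)}"
      using GG1 that(1) by (subst G_def, intro closure_minimal) auto
    then show ?thesis using that by blast
  qed
  have part: "\<exists>y. (x, y) \<in> S" if "x \<in> cspan (X ` I)" for x
    using that
  proof (induction rule: cv.span_induct_alt)
    case base
    then show ?case using cv.subspace_0[OF Ssub] by (auto simp: zero_prod_def)
  next
    case (step c b x)
    then obtain i y where i: "i \<in> I" "b = X i" "(x, y) \<in> S" by auto
    then have "c *\<^sub>C (X i, Y i) + (x, y) \<in> S"
      by (intro cv.subspace_add[OF Ssub] cv.subspace_scale[OF Ssub]) (auto simp: S_def intro: cv.span_base)
    then show ?case by (auto simp: i)
  qed
  have ex: "\<exists>y. (x, y) \<in> G" for x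
  proof -
    have "x \<in> closure (cspan (X ` I))" using dense by simp
    then obtain f where f: "\<And>n. f n \<in> cspan (X ` I)" "f \<longlonglongrightarrow> x" unfolding closure_sequential by auto
    obtain g where g: "\<And>n. (f n, g n) \<in> S" using part[OF f(1)] by metis
    have "dist (g m) (g n) = dist (f m) (f n)" for m n
    proof -
      have d: "(f m, g m) - (f n, g n) \<in> S" by (intro cv.subspace_diff[OF Ssub] g)
      have "norm (f m - f n) = norm (g m - g n)"
        by (rule norm_eq_if_cinner_eq) (use SS[OF d d] in simp)
      then show ?thesis by (simp add: dist_norm)
    qed
    then have "Cauchy g" using LIMSEQ_imp_Cauchy[OF f(2)] by (simp add: Cauchy_def)
    then obtain y where "g \<longlonglongrightarrow> y" using Cauchy_convergent convergent_def by blast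
    then have "(\<lambda>n. (f n, g n)) \<longlonglongrightarrow> (x, y)" by (intro tendsto_Pair f)
    with g have "(x, y) \<in> G"
      unfolding G_def closure_sequential by (intro exI[of _ "\<lambda>n. (f n, g n)"]) simp
    then show ?thesis ..
  qed
  define u where "u x = (SOME y. (x, y) \<in> G)" for x
  have u: "(x, u x) \<in> G" for x unfolding u_def by (rule someI_ex[OF ex])
  have uniq: "u x = y" if "(x, y) \<in> G" for x y
  proof -
    have d: "(x, u x) - (x, y) \<in> G" by (intro cv.subspace_diff[OF Gsub] u that)
    show ?thesis using GG[OF d d] by (auto simp: eq_commute[of 0])
  qed
  have inner: "cinner (u x) (u y) = cinner x y" for x y using GG[OF u u, of x y] by simp
  show ?thesis
  proof (rule that[of u])
    show "u \<in> bounded_ops"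
    proof (rule bounded_opsI[of _ 1])
      show "u (x + y) = u x + u y" for x y
        by (rule uniq) (use cv.subspace_add[OF Gsub u u] in simp)
      show "u (c *\<^sub>C x) = c *\<^sub>C u x" for c x
        by (rule uniq) (use cv.subspace_scale[OF Gsub u] in \<open>simp add: scaleC_prod_def\<close>)
      show "norm (u x) \<le> norm x * 1" for x
        using norm_eq_if_cinner_eq[OF inner, of x] by simp
    qed
    show "u (X i) = Y i" if "i \<in> I" for i
      by (rule uniq, unfold G_def, rule subsetD[OF closure_subset])
        (auto simp: S_def that intro: cv.span_base)
  qed (rule inner)
qed

section \<open>Sums over pair partitions\<close>

definition pairings :: "nat set \<Rightarrow> (nat \<times> nat) set set" where
  "pairings X = {\<pi>. \<pi> \<subseteq> X \<times> X \<and> (\<forall>(i, j)\<in>\<pi>. i < j) \<and>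
     (\<forall>k\<in>X. \<exists>!p. p \<in> \<pi> \<and> (fst p = k \<or> snd p = k))}"

definition pairing_sum ::
    "((nat \<times> nat) set \<Rightarrow> complex) \<Rightarrow> nat set \<Rightarrow> (nat \<Rightarrow> nat \<Rightarrow> complex) \<Rightarrow> complex" where
  "pairing_sum t X h = (\<Sum>\<pi>\<in>pairings X. t \<pi> * (\<Prod>(i, j)\<in>\<pi>. h i j))"

lemma pair_partitions_eq_pairings: "pair_partitions n = pairings {1..n}"
  by (simp add: pair_partitions_def pairings_def)

lemma finite_pairings: "finite X \<Longrightarrow> finite (pairings X)"
  by (rule finite_subset[of _ "Pow (X \<times> X)"]) (auto simp: pairings_def)

lemma pairings_subset: "\<pi> \<in> pairings X \<Longrightarrow> \<pi> \<subseteq> X \<times> X"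
  by (auto simp: pairings_def)

lemma pairings_memD: "\<pi> \<in> pairings X \<Longrightarrow> p \<in> \<pi> \<Longrightarrow> fst p \<in> X \<and> snd p \<in> X"
  by (auto simp: pairings_def)

lemma pairings_less: "\<pi> \<in> pairings X \<Longrightarrow> (i, j) \<in> \<pi> \<Longrightarrow> i < j"
  by (auto simp: pairings_def)

lemma pairings_finite: "finite X \<Longrightarrow> \<pi> \<in> pairings X \<Longrightarrow> finite \<pi>"
  using finite_subset[OF pairings_subset] by blast

lemma pairings_ex1: "\<pi> \<in> pairings X \<Longrightarrow> k \<in> X \<Longrightarrow> \<exists>!p. p \<in> \<pi> \<and> (fst p = k \<or> snd p = k)"
  by (auto simp: pairings_def)

lemma pairingsI:
  "\<pi> \<subseteq> X \<times> X \<Longrightarrow> (\<And>p. p \<in> \<pi> \<Longrightarrow> fst p < snd p) \<Longrightarrow>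
    (\<And>k. k \<in> X \<Longrightarrow> \<exists>!p. p \<in> \<pi> \<and> (fst p = k \<or> snd p = k)) \<Longrightarrow> \<pi> \<in> pairings X"
  unfolding pairings_def by (simp add: case_prod_unfold)

lemma ex1_iff_cong: "(\<And>p. P p \<longleftrightarrow> Q p) \<Longrightarrow> (\<exists>!p. P p) \<longleftrightarrow> (\<exists>!p. Q p)"
  by presburger

lemma pairings_Un:
  assumes "\<sigma> \<in> pairings A" "\<tau> \<in> pairings B" "A \<inter> B = {}"
  shows "\<sigma> \<union> \<tau> \<in> pairings (A \<union> B)"
proof -
  note s = pairings_memD[OF assms(1)] pairings_memD[OF assms(2)]
  have "\<exists>!p. p \<in> \<sigma> \<union> \<tau> \<and> (fst p = k \<or> snd p = k)" if k: "k \<in> A \<union> B" for k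
  proof (cases "k \<in> A")
    case True
    then have "p \<in> \<sigma> \<union> \<tau> \<and> (fst p = k \<or> snd p = k) \<longleftrightarrow> p \<in> \<sigma> \<and> (fst p = k \<or> snd p = k)" for p
      using s(2)[of p] assms(3) by blast
    then show ?thesis by (rule iffD2[OF ex1_iff_cong pairings_ex1[OF assms(1) True]])
  next
    case False
    then have "p \<in> \<sigma> \<union> \<tau> \<and> (fst p = k \<or> snd p = k) \<longleftrightarrow> p \<in> \<tau> \<and> (fst p = k \<or> snd p = k)" for p
      using s(1)[of p] assms(3) by blast
    moreover have "k \<in> B" using False k by blast
    ultimately show ?thesis by (rule iffD2[OF ex1_iff_cong pairings_ex1[OF assms(2)]])
  qed
  then show ?thesis
  proof (rule pairingsI[rotated 2])
    show "\<sigma> \<union> \<tau> \<subseteq> (A \<union> B) \<times> (A \<union> B)"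
      using pairings_subset[OF assms(1)] pairings_subset[OF assms(2)] by blast
    show "fst p < snd p" if "p \<in> \<sigma> \<union> \<tau>" for p
      using that pairings_less[OF assms(1), of "fst p" "snd p"]
        pairings_less[OF assms(2), of "fst p" "snd p"] by auto
  qed
qed

lemma pairings_restrict:
  assumes "\<pi> \<in> pairings (A \<union> B)" "A \<inter> B = {}" "\<pi> \<subseteq> A \<times> A \<union> B \<times> B"
  shows "\<pi> \<inter> A \<times> A \<in> pairings A"
proof -
  have "\<exists>!p. p \<in> \<pi> \<inter> A \<times> A \<and> (fst p = k \<or> snd p = k)" if k: "k \<in> A" for k
  proof -
    have kB: "k \<notin> B" using k assms(2) by blast
    have "p \<in> \<pi> \<inter> A \<times> A \<and> (fst p = k \<or> snd p = k) \<longleftrightarrow> p \<in> \<pi> \<and> (fst p = k \<or> snd p = k)" for p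
    proof -
      have "p \<in> \<pi> \<Longrightarrow> p \<in> A \<times> A \<or> p \<in> B \<times> B" using assms(3) by blast
      then show ?thesis using k kB by (cases p) auto
    qed
    moreover have "k \<in> A \<union> B" using k by blast
    ultimately show ?thesis by (rule iffD2[OF ex1_iff_cong pairings_ex1[OF assms(1)]])
  qed
  then show ?thesis
    by (rule pairingsI[rotated 2]) (use pairings_less[OF assms(1)] in auto)
qed

text \<open>A pair joining \<open>A\<close> to \<open>B\<close> contributes a vanishing factor. The
  weights on the right may differ from \<open>t\<close>, so that the influence of one block on the
  other can be absorbed into them.\<close>

lemma pairing_sum_Un:
  assumes fin: "finite A" "finite B" and disj: "A \<inter> B = {}"
    and h: "\<And>a b. a \<in> A \<Longrightarrow> b \<in> B \<Longrightarrow> h a b = 0 \<and> h b a = 0"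
    and t: "\<And>\<sigma> \<tau>. \<sigma> \<in> pairings A \<Longrightarrow> \<tau> \<in> pairings B \<Longrightarrow> t (\<sigma> \<union> \<tau>) = t1 \<sigma> * t2 \<tau>"
  shows "pairing_sum t (A \<union> B) h = pairing_sum t1 A h * pairing_sum t2 B h"
proof -
  let ?P = "\<lambda>\<pi>. \<Prod>(i, j)\<in>\<pi>. h i j"
  let ?U = "{\<pi> \<in> pairings (A \<union> B). \<pi> \<subseteq> A \<times> A \<union> B \<times> B}"
  have "pairing_sum t (A \<union> B) h = (\<Sum>\<pi>\<in>?U. t \<pi> * ?P \<pi>)"
    unfolding pairing_sum_def
  proof (rule sum.mono_neutral_right)
    show "\<forall>\<pi>\<in>pairings (A \<union> B) - ?U. t \<pi> * ?P \<pi> = 0"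
    proof
      fix \<pi> assume pi: "\<pi> \<in> pairings (A \<union> B) - ?U"
      then obtain i j where ij: "(i, j) \<in> \<pi>" "(i, j) \<notin> A \<times> A \<union> B \<times> B" by auto
      then have "h i j = 0" using pairings_subset[of \<pi> "A \<union> B"] pi h by blast
      moreover have "finite \<pi>" using pi fin by (auto intro: pairings_finite[of "A \<union> B"])
      ultimately have "?P \<pi> = 0" using ij(1) by (intro prod_zero bexI[of _ "(i, j)"]) auto
      then show "t \<pi> * ?P \<pi> = 0" by simp
    qed
  qed (use fin finite_pairings in auto)
  also have "\<dots> = (\<Sum>(\<sigma>, \<tau>)\<in>pairings A \<times> pairings B. (t1 \<sigma> * ?P \<sigma>) * (t2 \<tau> * ?P \<tau>))"
  proof (rule sum.reindex_bij_witness[of _ "\<lambda>(\<sigma>, \<tau>). \<sigma> \<union> \<tau>" "\<lambda>\<pi>. (\<pi> \<inter> A \<times> A, \<pi> \<inter> B \<times> B)"])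
    fix \<pi> assume pi: "\<pi> \<in> ?U"
    then show m: "(\<pi> \<inter> A \<times> A, \<pi> \<inter> B \<times> B) \<in> pairings A \<times> pairings B"
      using pairings_restrict[of \<pi> A B] pairings_restrict[of \<pi> B A] disj by (auto simp: Un_commute)
    show e: "(case (\<pi> \<inter> A \<times> A, \<pi> \<inter> B \<times> B) of (\<sigma>, \<tau>) \<Rightarrow> \<sigma> \<union> \<tau>) = \<pi>" using pi by auto
    have "?P \<pi> = ?P (\<pi> \<inter> A \<times> A) * ?P (\<pi> \<inter> B \<times> B)"
      by (subst prod.union_disjoint[symmetric])
        (use e m fin disj in \<open>auto intro: pairings_finite\<close>)
    moreover have "t \<pi> = t1 (\<pi> \<inter> A \<times> A) * t2 (\<pi> \<inter> B \<times> B)"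
      using t[of "\<pi> \<inter> A \<times> A" "\<pi> \<inter> B \<times> B"] m e by auto
    ultimately show "(case (\<pi> \<inter> A \<times> A, \<pi> \<inter> B \<times> B) of (\<sigma>, \<tau>) \<Rightarrow> (t1 \<sigma> * ?P \<sigma>) * (t2 \<tau> * ?P \<tau>)) = t \<pi> * ?P \<pi>"
      by simp
  next
    fix p assume "p \<in> pairings A \<times> pairings B"
    then obtain \<sigma> \<tau> where p: "p = (\<sigma>, \<tau>)" "\<sigma> \<in> pairings A" "\<tau> \<in> pairings B" by auto
    note s = pairings_subset[OF p(2)] pairings_subset[OF p(3)]
    show "(\<lambda>\<pi>. (\<pi> \<inter> A \<times> A, \<pi> \<inter> B \<times> B)) (case p of (\<sigma>, \<tau>) \<Rightarrow> \<sigma> \<union> \<tau>) = p"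
      using s disj p(1) by auto
    show "(case p of (\<sigma>, \<tau>) \<Rightarrow> \<sigma> \<union> \<tau>) \<in> ?U"
      using s p pairings_Un[OF p(2,3) disj] by auto
  qed
  also have "\<dots> = pairing_sum t1 A h * pairing_sum t2 B h"
    by (simp add: pairing_sum_def sum_product sum.cartesian_product)
  finally show ?thesis .
qed

lemma pairings_image:
  assumes e: "strict_mono_on X e"
  shows "pairings (e ` X) = (\<lambda>\<pi>. map_prod e e ` \<pi>) ` pairings X"
proof -
  have inj: "inj_on e X" by (rule strict_mono_on_imp_inj_on[OF e])
  have less: "e i < e j \<longleftrightarrow> i < j" if "i \<in> X" "j \<in> X" for i j
    using strict_mono_on_less[OF e that] .
  have key: "map_prod e e ` \<pi> \<in> pairings (e ` X) \<longleftrightarrow> \<pi> \<in> pairings X" if s: "\<pi> \<subseteq> X \<times> X" for \<pi>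
  proof -
    have "(\<exists>!p. p \<in> map_prod e e ` \<pi> \<and> (fst p = e k \<or> snd p = e k)) \<longleftrightarrow>
       (\<exists>!p. p \<in> \<pi> \<and> (fst p = k \<or> snd p = k))" if "k \<in> X" for k
    proof -
      have im: "{p. p \<in> map_prod e e ` \<pi> \<and> (fst p = e k \<or> snd p = e k)} =
        map_prod e e ` {p. p \<in> \<pi> \<and> (fst p = k \<or> snd p = k)}"
        using s that by (auto simp: inj_on_eq_iff[OF inj] subset_iff) 
      have inj2: "inj_on (map_prod e e) {p. p \<in> \<pi> \<and> (fst p = k \<or> snd p = k)}"
        by (rule inj_on_subset[OF map_prod_inj_on[OF inj inj]]) (use s in auto)
      \<comment> \<open>Unique existence is read as cardinality one, which an injective relabelling
        preserves.\<close>
      have ex1: "(\<exists>!p. P p) \<longleftrightarrow> card {p. P p} = 1" for P :: "nat \<times> nat \<Rightarrow> bool"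
        unfolding One_nat_def card_1_singleton_iff set_eq_iff mem_Collect_eq singleton_iff by metis
      show ?thesis unfolding ex1 im card_image[OF inj2] by (rule refl)
    qed
    moreover have "(\<forall>(i, j)\<in>map_prod e e ` \<pi>. i < j) \<longleftrightarrow> (\<forall>(i, j)\<in>\<pi>. i < j)"
      unfolding ball_simps case_prod_unfold fst_map_prod snd_map_prod
      using s by (intro ball_cong refl less) auto
    ultimately show ?thesis using s unfolding pairings_def by auto
  qed
  show ?thesis
  proof (intro set_eqI iffI)
    fix \<pi> assume p: "\<pi> \<in> pairings (e ` X)"
    let ?r = "{q \<in> X \<times> X. map_prod e e q \<in> \<pi>}"
    have "\<pi> = map_prod e e ` ?r" using pairings_subset[OF p] by force
    moreover have "?r \<in> pairings X" using key[of ?r] p calculation by auto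
    ultimately show "\<pi> \<in> (\<lambda>\<pi>. map_prod e e ` \<pi>) ` pairings X" by blast
  next
    fix \<pi> assume "\<pi> \<in> (\<lambda>\<pi>. map_prod e e ` \<pi>) ` pairings X"
    then show "\<pi> \<in> pairings (e ` X)" using key pairings_subset by auto
  qed
qed

lemma pairing_sum_image:
  assumes e: "strict_mono_on X e"
    and t: "\<And>\<pi>. \<pi> \<in> pairings X \<Longrightarrow> t (map_prod e e ` \<pi>) = t' \<pi>"
  shows "pairing_sum t (e ` X) h = pairing_sum t' X (\<lambda>i j. h (e i) (e j))"
proof -
  have inj: "inj_on (map_prod e e) (X \<times> X)"
    using map_prod_inj_on strict_mono_on_imp_inj_on[OF e] by blast
  have "inj_on (\<lambda>\<pi>. map_prod e e ` \<pi>) (pairings X)"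
    by (rule inj_on_subset[OF inj_on_image_Pow[OF inj]]) (auto dest: pairings_subset)
  then have "pairing_sum t (e ` X) h =
      (\<Sum>\<pi>\<in>pairings X. t (map_prod e e ` \<pi>) * (\<Prod>(i, j)\<in>map_prod e e ` \<pi>. h i j))"
    by (simp add: pairing_sum_def pairings_image[OF e] sum.reindex)
  also have "\<dots> = pairing_sum t' X (\<lambda>i j. h (e i) (e j))"
    unfolding pairing_sum_def
  proof (intro sum.cong refl, goal_cases)
    case (1 \<pi>)
    then have "inj_on (map_prod e e) \<pi>" using inj pairings_subset inj_on_subset by blast
    then show ?case by (simp add: t 1 prod.reindex case_prod_unfold)
  qed
  finally show ?thesis .
qed

text \<open>Each position lies in exactly one pair. This turns the Cauchy-Schwarz inequality for
  every pair into one product over all letters.\<close>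

lemma prod_pairing:
  fixes N :: "nat \<Rightarrow> real"
  assumes "finite X" "\<pi> \<in> pairings X"
  shows "(\<Prod>(i, j)\<in>\<pi>. N i * N j) = (\<Prod>k\<in>X. N k)"
proof -
  have U: "(\<Union>p\<in>\<pi>. {fst p, snd p}) = X"
  proof (intro set_eqI iffI)
    fix k assume "k \<in> X"
    then obtain p where "p \<in> \<pi>" "fst p = k \<or> snd p = k" using pairings_ex1[OF assms(2)] by blast
    then show "k \<in> (\<Union>p\<in>\<pi>. {fst p, snd p})" by blast
  qed (use pairings_memD[OF assms(2)] in blast)
  have "(\<Prod>k\<in>(\<Union>p\<in>\<pi>. {fst p, snd p}). N k) = (\<Prod>p\<in>\<pi>. \<Prod>k\<in>{fst p, snd p}. N k)"
  proof (rule prod.UNION_disjoint)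
    show "\<forall>p\<in>\<pi>. \<forall>r\<in>\<pi>. p \<noteq> r \<longrightarrow> {fst p, snd p} \<inter> {fst r, snd r} = {}"
    proof (intro ballI impI, rule ccontr)
      fix p r assume pr: "p \<in> \<pi>" "r \<in> \<pi>" "p \<noteq> r" "{fst p, snd p} \<inter> {fst r, snd r} \<noteq> {}"
      then obtain k where k: "k \<in> {fst p, snd p}" "k \<in> {fst r, snd r}" by blast
      then have "k \<in> X" using U pr(1) by blast
      then obtain u where "\<And>v. v \<in> \<pi> \<and> (fst v = k \<or> snd v = k) \<Longrightarrow> v = u"
        using pairings_ex1[OF assms(2)] by metis
      from this[of p] this[of r] show False using k pr(1-3) by auto
    qed
  qed (use pairings_finite[OF assms] in auto)
  also have "\<dots> = (\<Prod>(i, j)\<in>\<pi>. N i * N j)"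
  proof (rule prod.cong[OF refl])
    fix p assume "p \<in> \<pi>"
    then have "fst p \<noteq> snd p" using pairings_less[OF assms(2), of "fst p" "snd p"] by auto
    then show "(\<Prod>k\<in>{fst p, snd p}. N k) = (case p of (i, j) \<Rightarrow> N i * N j)"
      by (simp add: case_prod_unfold)
  qed
  finally show ?thesis by (simp add: U)
qed

lemma pairings_doubleton: "i < j \<Longrightarrow> pairings {i, j} = {{(i, j)}}"
proof (intro set_eqI iffI)
  fix \<pi> assume ij: "i < j" and p: "\<pi> \<in> pairings {i, j}"
  have sub: "\<pi> \<subseteq> {(i, j)}"
    using pairings_subset[OF p] pairings_less[OF p] ij by fastforce
  moreover have "\<pi> \<noteq> {}" using pairings_ex1[OF p, of i] by auto
  ultimately show "\<pi> \<in> {{(i, j)}}" by auto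
qed (auto simp: pairings_def)

lemma pairing_sum_doubleton: "i < j \<Longrightarrow> pairing_sum t {i, j} h = t {(i, j)} * h i j"
  by (simp add: pairing_sum_def pairings_doubleton)

lemma pairing_sum_singleton: "pairing_sum t {i} h = 0"
proof -
  have False if p: "\<pi> \<in> pairings {i}" for \<pi>
  proof -
    have "\<exists>!p. p \<in> \<pi> \<and> (fst p = i \<or> snd p = i)" by (rule pairings_ex1[OF p]) simp
    then obtain r where "r \<in> \<pi>" by blast
    then show False using pairings_subset[OF p] pairings_less[OF p, of "fst r" "snd r"] by auto
  qed
  then have "pairings {i} = {}" by blast
  then show ?thesis by (simp add: pairing_sum_def)
qed

section \<open>Multiplicative weights on crossing graphs\<close>

text \<open>Both families of weights depend only on the crossing graph of a pair partition and are
  multiplicative when graphs are joined at no or at one common vertex.\<close>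

definition crossing_weight :: "real \<Rightarrow> ((nat \<times> nat) set \<Rightarrow> complex) \<Rightarrow> bool" where
  "crossing_weight q t \<longleftrightarrow>
     (\<forall>\<pi> h. finite \<pi> \<longrightarrow> inj_on h \<pi> \<longrightarrow> (\<forall>p\<in>\<pi>. \<forall>r\<in>\<pi>. crosses (h p) (h r) = crosses p r) \<longrightarrow>
        t (h ` \<pi>) = t \<pi>) \<and>
     (\<forall>A B. finite A \<longrightarrow> finite B \<longrightarrow> A \<inter> B = {} \<longrightarrow> (\<forall>a\<in>A. \<forall>b\<in>B. \<not> crosses a b) \<longrightarrow>
        t (A \<union> B) = t A * t B) \<and>
     (\<forall>A B p. finite A \<longrightarrow> finite B \<longrightarrow> A \<inter> B = {} \<longrightarrow> p \<notin> A \<union> B \<longrightarrow>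
        (\<forall>a\<in>A. \<forall>b\<in>B. \<not> crosses a b) \<longrightarrow>
        t (insert p (A \<union> B)) = t (insert p A) * t (insert p B)) \<and>
     (\<forall>p r. crosses p r \<longrightarrow> t {p, r} = complex_of_real q) \<and> (\<forall>p. t {p} = 1)"

section \<open>The number of crossings\<close>

lemma crosses_sym: "crosses p r \<longleftrightarrow> crosses r p"
  by (auto simp: crosses_def split: prod.splits)

lemma crosses_irrefl: "\<not> crosses p p"
  by (auto simp: crosses_def split: prod.splits)

definition crossing_pairs :: "(nat \<times> nat) set \<Rightarrow> (nat \<times> nat) set set" where
  "crossing_pairs \<pi> = {{p, r} | p r. p \<in> \<pi> \<and> r \<in> \<pi> \<and> crosses p r}"

lemma crossing_pairsI: "p \<in> \<pi> \<Longrightarrow> r \<in> \<pi> \<Longrightarrow> crosses p r \<Longrightarrow> {p, r} \<in> crossing_pairs \<pi>"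
  unfolding crossing_pairs_def by blast

lemma crossing_pairsE:
  assumes "x \<in> crossing_pairs \<pi>"
  obtains p r where "x = {p, r}" "p \<in> \<pi>" "r \<in> \<pi>" "crosses p r"
  using assms unfolding crossing_pairs_def by blast

lemma crossing_pairs_subset: "x \<in> crossing_pairs \<pi> \<Longrightarrow> x \<subseteq> \<pi>"
  by (auto elim!: crossing_pairsE)

lemma cr_eq: "cr \<pi> = card (crossing_pairs \<pi>)"
  by (simp add: cr_def crossing_pairs_def)

lemma finite_crossing_pairs: "finite \<pi> \<Longrightarrow> finite (crossing_pairs \<pi>)"
  by (rule finite_subset[of _ "Pow \<pi>"]) (auto simp: crossing_pairs_def)

lemma cr_image:
  assumes "inj_on h \<pi>" "\<And>p r. p \<in> \<pi> \<Longrightarrow> r \<in> \<pi> \<Longrightarrow> crosses (h p) (h r) = crosses p r"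
  shows "cr (h ` \<pi>) = cr \<pi>"
proof -
  have "crossing_pairs (h ` \<pi>) = (`) h ` crossing_pairs \<pi>"
  proof (intro set_eqI iffI)
    fix x assume "x \<in> crossing_pairs (h ` \<pi>)"
    then obtain p r where "p \<in> \<pi>" "r \<in> \<pi>" "crosses p r" "x = {h p, h r}"
      using assms(2) by (elim crossing_pairsE) blast
    then show "x \<in> (`) h ` crossing_pairs \<pi>"
      by (intro image_eqI[of _ _ "{p, r}"] crossing_pairsI) auto
  next
    fix x assume "x \<in> (`) h ` crossing_pairs \<pi>"
    then obtain p r where "x = {h p, h r}" "p \<in> \<pi>" "r \<in> \<pi>" "crosses p r"
      by (auto elim!: crossing_pairsE)
    then show "x \<in> crossing_pairs (h ` \<pi>)"
      using assms(2) by (simp add: crossing_pairsI)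
  qed
  moreover have "inj_on ((`) h) (crossing_pairs \<pi>)"
    by (rule inj_on_subset[OF inj_on_image_Pow[OF assms(1)]]) (auto simp: crossing_pairs_def)
  ultimately show ?thesis by (simp add: cr_eq card_image)
qed

text \<open>One statement for both kinds of union: \<open>p\<close> lies in neither set when they
  are disjoint, and in both when they are glued at a vertex. No crossing is counted twice, as it has
  two distinct ends and the sets share at most one element.\<close>

lemma cr_Un:
  assumes "finite A" "finite B" "A \<inter> B \<subseteq> {p}" "\<And>a b. a \<in> A - {p} \<Longrightarrow> b \<in> B - {p} \<Longrightarrow> \<not> crosses a b"
    "p \<in> A \<longleftrightarrow> p \<in> B"
  shows "cr (A \<union> B) = cr A + cr B"
proof -
  have "crossing_pairs (A \<union> B) = crossing_pairs A \<union> crossing_pairs B"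
  proof (intro set_eqI iffI)
    fix x assume "x \<in> crossing_pairs (A \<union> B)"
    then obtain a b where "x = {a, b}" "a \<in> A \<union> B" "b \<in> A \<union> B" "crosses a b"
      by (rule crossing_pairsE)
    moreover from this have "(a \<in> A \<and> b \<in> A) \<or> (a \<in> B \<and> b \<in> B)"
      using assms(4)[of a b] assms(4)[of b a] assms(5) crosses_sym[of a b] by blast
    ultimately show "x \<in> crossing_pairs A \<union> crossing_pairs B" using crossing_pairsI by blast
  qed (auto elim!: crossing_pairsE intro: crossing_pairsI)
  moreover have "crossing_pairs A \<inter> crossing_pairs B = {}"
  proof (rule ccontr)
    assume "crossing_pairs A \<inter> crossing_pairs B \<noteq> {}"
    then obtain x where x: "x \<in> crossing_pairs A" "x \<in> crossing_pairs B" by blast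
    then obtain a b where ab: "x = {a, b}" "crosses a b" by (elim crossing_pairsE) blast
    have "x \<subseteq> A \<inter> B" using x by (simp add: crossing_pairs_subset)
    then show False using ab assms(3) crosses_irrefl by blast
  qed
  ultimately show ?thesis
    using assms(1,2) by (simp add: cr_eq card_Un_disjoint finite_crossing_pairs)
qed

lemma cr_singleton: "cr {p} = 0"
proof -
  have "crossing_pairs {p} = {}" using crosses_irrefl by (auto simp: crossing_pairs_def)
  then show ?thesis by (simp add: cr_eq)
qed

lemma cr_doubleton: "crosses p r \<Longrightarrow> cr {p, r} = 1"
proof -
  assume "crosses p r"
  then have "crossing_pairs {p, r} = {{p, r}}"
    using crosses_irrefl by (auto elim!: crossing_pairsE intro: crossing_pairsI)
  then show ?thesis by (simp add: cr_eq)
qed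

section \<open>Connected components of the crossing graph\<close>

definition crossing_rel :: "(nat \<times> nat) set \<Rightarrow> ((nat \<times> nat) \<times> (nat \<times> nat)) set" where
  "crossing_rel \<pi> = {(p, r). p \<in> \<pi> \<and> r \<in> \<pi> \<and> crosses p r}"

lemma cc_eq: "cc \<pi> = card ((\<lambda>x. (crossing_rel \<pi>)\<^sup>* `` {x}) ` \<pi>)"
  unfolding cc_def crossing_rel_def quotient_def by (rule arg_cong[where f = card]) auto

lemma sym_crossing_rel: "sym ((crossing_rel \<pi>)\<^sup>*)"
  by (rule sym_rtrancl) (auto simp: sym_def crossing_rel_def crosses_sym)

lemma crossing_class_subset: "x \<in> \<pi> \<Longrightarrow> (crossing_rel \<pi>)\<^sup>* `` {x} \<subseteq> \<pi>"
proof
  fix y assume x: "x \<in> \<pi>" and "y \<in> (crossing_rel \<pi>)\<^sup>* `` {x}"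
  then have "(x, y) \<in> (crossing_rel \<pi>)\<^sup>*" by simp
  then show "y \<in> \<pi>" by (induction) (auto simp: x crossing_rel_def)
qed

lemma crossing_class_restrict:
  assumes "A \<subseteq> Z" "x \<in> A" "\<And>a b. a \<in> A \<Longrightarrow> b \<in> Z - A \<Longrightarrow> \<not> crosses a b"
  shows "(crossing_rel Z)\<^sup>* `` {x} = (crossing_rel A)\<^sup>* `` {x}"
proof (intro set_eqI iffI)
  fix y assume "y \<in> (crossing_rel Z)\<^sup>* `` {x}"
  then have "(x, y) \<in> (crossing_rel Z)\<^sup>*" by simp
  then have "y \<in> A \<and> (x, y) \<in> (crossing_rel A)\<^sup>*"
  proof induction
    case (step y z)
    then have "z \<in> A" using assms(3)[of y z] by (auto simp: crossing_rel_def)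
    with step have "(y, z) \<in> crossing_rel A" by (auto simp: crossing_rel_def)
    with step \<open>z \<in> A\<close> show ?case by auto
  qed (use assms in auto)
  then show "y \<in> (crossing_rel A)\<^sup>* `` {x}" by simp
next
  fix y assume "y \<in> (crossing_rel A)\<^sup>* `` {x}"
  moreover have "crossing_rel A \<subseteq> crossing_rel Z" using assms(1) by (auto simp: crossing_rel_def)
  ultimately show "y \<in> (crossing_rel Z)\<^sup>* `` {x}" using rtrancl_mono by blast
qed

lemma cc_Un:
  assumes "finite A" "finite B" "A \<inter> B = {}" "\<And>a b. a \<in> A \<Longrightarrow> b \<in> B \<Longrightarrow> \<not> crosses a b"
  shows "cc (A \<union> B) = cc A + cc B"
proof -
  let ?c = "\<lambda>\<pi>. (\<lambda>x. (crossing_rel \<pi>)\<^sup>* `` {x}) ` \<pi>"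
  have "?c (A \<union> B) = ?c A \<union> ?c B"
    unfolding image_Un
    by (intro arg_cong2[where f = "(\<union>)"] image_cong refl crossing_class_restrict)
      (use assms(3,4) crosses_sym in blast)+
  moreover have "?c A \<inter> ?c B = {}"
  proof (rule ccontr)
    assume "?c A \<inter> ?c B \<noteq> {}"
    then obtain a b where "a \<in> A" "b \<in> B" "(crossing_rel A)\<^sup>* `` {a} = (crossing_rel B)\<^sup>* `` {b}" by auto
    with crossing_class_subset[of a A] crossing_class_subset[of b B] assms(3)
    have "(crossing_rel A)\<^sup>* `` {a} = {}" by blast
    then show False by auto
  qed
  ultimately show ?thesis using assms(1,2) by (simp add: cc_eq card_Un_disjoint)
qed

lemma cc_connected:
  assumes "p \<in> C" "\<And>x. x \<in> C \<Longrightarrow> (p, x) \<in> (crossing_rel C)\<^sup>*"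
  shows "cc C = 1"
proof -
  have "(crossing_rel C)\<^sup>* `` {x} = (crossing_rel C)\<^sup>* `` {p}" if "x \<in> C" for x
    using assms(2)[OF that] symD[OF sym_crossing_rel assms(2)[OF that]]
    by (auto intro: rtrancl_trans)
  then have "(\<lambda>x. (crossing_rel C)\<^sup>* `` {x}) ` C = (\<lambda>x. (crossing_rel C)\<^sup>* `` {p}) ` C"
    by (intro image_cong refl)
  also have "\<dots> = {(crossing_rel C)\<^sup>* `` {p}}" using assms(1) by auto
  finally show ?thesis by (simp add: cc_eq)
qed

lemma cc_le_card: "finite \<pi> \<Longrightarrow> cc \<pi> \<le> card \<pi>"
  by (simp add: cc_eq card_image_le)

lemma crossing_component:
  assumes "p \<in> X"
  obtains C where "p \<in> C" "C \<subseteq> X" "\<And>x. x \<in> C \<Longrightarrow> (p, x) \<in> (crossing_rel C)\<^sup>*"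
    "\<And>a b. a \<in> C \<Longrightarrow> b \<in> X - C \<Longrightarrow> \<not> crosses a b"
proof -
  define C where "C = (crossing_rel X)\<^sup>* `` {p}"
  have sub: "C \<subseteq> X" unfolding C_def by (rule crossing_class_subset[OF assms])
  have nc: "\<not> crosses a b" if "a \<in> C" "b \<in> X - C" for a b
  proof
    assume "crosses a b"
    then have "(a, b) \<in> crossing_rel X" using that sub by (auto simp: crossing_rel_def)
    then show False using that by (auto simp: C_def intro: rtrancl_into_rtrancl)
  qed
  have "p \<in> C" by (simp add: C_def)
  moreover have "(p, x) \<in> (crossing_rel C)\<^sup>*" if "x \<in> C" for x
    using crossing_class_restrict[OF sub \<open>p \<in> C\<close> nc] that by (auto simp: C_def)
  ultimately show ?thesis using sub nc that by blast
qed

text \<open>The components of \<open>p\<close> in \<open>X\<close> and in \<open>Y\<close> merge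
  into one, and all others survive. The cardinality of the union falls short of the sum by one as
  well, so \<open>card - cc\<close> is additive.\<close>

lemma cc_glue:
  assumes fin: "finite X" "finite Y" and XY: "X \<inter> Y = {p}"
    and nc: "\<And>a b. a \<in> X - {p} \<Longrightarrow> b \<in> Y - {p} \<Longrightarrow> \<not> crosses a b"
  shows "cc (X \<union> Y) + 1 = cc X + cc Y"
proof -
  have pX: "p \<in> X" and pY: "p \<in> Y" using XY by auto
  obtain C where C: "p \<in> C" "C \<subseteq> X" "\<And>x. x \<in> C \<Longrightarrow> (p, x) \<in> (crossing_rel C)\<^sup>*"
    "\<And>a b. a \<in> C \<Longrightarrow> b \<in> X - C \<Longrightarrow> \<not> crosses a b" using crossing_component[OF pX] by blast
  obtain D where D: "p \<in> D" "D \<subseteq> Y" "\<And>x. x \<in> D \<Longrightarrow> (p, x) \<in> (crossing_rel D)\<^sup>*"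
    "\<And>a b. a \<in> D \<Longrightarrow> b \<in> Y - D \<Longrightarrow> \<not> crosses a b" using crossing_component[OF pY] by blast
  note f = finite_subset[OF C(2) fin(1)] finite_subset[OF D(2) fin(2)] fin
  have "cc (C \<union> (X - C)) = cc C + cc (X - C)" by (rule cc_Un) (use f C(4) in auto)
  then have 1: "cc X = 1 + cc (X - C)"
    using cc_connected[OF C(1,3)] C(2) by (simp add: Un_absorb1)
  have "cc (D \<union> (Y - D)) = cc D + cc (Y - D)" by (rule cc_Un) (use f D(4) in auto)
  then have 2: "cc Y = 1 + cc (Y - D)"
    using cc_connected[OF D(1,3)] D(2) by (simp add: Un_absorb1)
  have sub: "crossing_rel C \<subseteq> crossing_rel (C \<union> D)" "crossing_rel D \<subseteq> crossing_rel (C \<union> D)"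
    by (auto simp: crossing_rel_def)
  have "cc (C \<union> D) = 1"
    by (rule cc_connected[of p]) (use C(1,3) D(3) rtrancl_mono[OF sub(1)] rtrancl_mono[OF sub(2)] in auto)
  moreover have disj: "(C \<union> D) \<inter> ((X - C) \<union> (Y - D)) = {}"
  proof -
    have "z = p" if "z \<in> X" "z \<in> Y" for z using XY that by blast
    then show ?thesis using C(1,2) D(1,2) by blast
  qed
  moreover have "cc ((C \<union> D) \<union> ((X - C) \<union> (Y - D))) = cc (C \<union> D) + cc ((X - C) \<union> (Y - D))"
  proof (rule cc_Un)
    fix a b assume a: "a \<in> C \<union> D" and b: "b \<in> (X - C) \<union> (Y - D)"
    show "\<not> crosses a b"
    proof (cases "b \<in> X - C")
      case True
      then show ?thesis
        using a C(1) C(4)[of a b] nc[of b a] D(2) crosses_sym[of a b] by blast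
    next
      case False
      then show ?thesis
        using a b D(1) D(4)[of a b] nc[of a b] C(2) by blast
    qed
  qed (use f disj in auto)
  moreover have "cc ((X - C) \<union> (Y - D)) = cc (X - C) + cc (Y - D)"
  proof (rule cc_Un)
    show "(X - C) \<inter> (Y - D) = {}" using XY C(1) by auto
    show "\<not> crosses a b" if "a \<in> X - C" "b \<in> Y - D" for a b
      using that C(1) D(1) by (intro nc) auto
  qed (use f in auto)
  moreover have "(C \<union> D) \<union> ((X - C) \<union> (Y - D)) = X \<union> Y" using C(2) D(2) by auto
  ultimately show ?thesis using 1 2 by simp
qed

lemma cc_image:
  assumes inj: "inj_on h \<pi>" and h: "\<And>p r. p \<in> \<pi> \<Longrightarrow> r \<in> \<pi> \<Longrightarrow> crosses (h p) (h r) = crosses p r"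
  shows "cc (h ` \<pi>) = cc \<pi>"
proof -
  have fwd: "(h x, h y) \<in> (crossing_rel (h ` \<pi>))\<^sup>*" if "(x, y) \<in> (crossing_rel \<pi>)\<^sup>*" for x y
    using that
  proof induction
    case (step y z)
    then have "(h y, h z) \<in> crossing_rel (h ` \<pi>)" by (auto simp: crossing_rel_def h)
    with step show ?case by auto
  qed auto
  have bwd: "\<exists>z\<in>\<pi>. y = h z \<and> (x, z) \<in> (crossing_rel \<pi>)\<^sup>*"
    if "(h x, y) \<in> (crossing_rel (h ` \<pi>))\<^sup>*" "x \<in> \<pi>" for x y
    using that(1)
  proof induction
    case (step y z)
    then obtain a b where "a \<in> \<pi>" "y = h a" "(x, a) \<in> (crossing_rel \<pi>)\<^sup>*" "b \<in> \<pi>" "z = h b" "crosses (h a) (h b)"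
      by (auto simp: crossing_rel_def)
    moreover from this have "(a, b) \<in> crossing_rel \<pi>" by (auto simp: crossing_rel_def h)
    ultimately show ?case by auto
  qed (use that in auto)
  have cls: "(crossing_rel (h ` \<pi>))\<^sup>* `` {h x} = h ` ((crossing_rel \<pi>)\<^sup>* `` {x})" if "x \<in> \<pi>" for x
  proof (intro set_eqI iffI)
    fix y assume "y \<in> (crossing_rel (h ` \<pi>))\<^sup>* `` {h x}"
    then show "y \<in> h ` ((crossing_rel \<pi>)\<^sup>* `` {x})" using bwd[OF _ that] by blast
  qed (use fwd in blast)
  have "(\<lambda>x. (crossing_rel (h ` \<pi>))\<^sup>* `` {x}) ` h ` \<pi> = (`) h ` (\<lambda>x. (crossing_rel \<pi>)\<^sup>* `` {x}) ` \<pi>"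
    by (simp add: image_image cls cong: image_cong)
  moreover have "inj_on ((`) h) ((\<lambda>x. (crossing_rel \<pi>)\<^sup>* `` {x}) ` \<pi>)"
    by (rule inj_on_subset[OF inj_on_image_Pow[OF inj]]) (auto dest: crossing_class_subset)
  ultimately show ?thesis by (simp add: cc_eq card_image)
qed

lemma cc_singleton: "cc {p} = 1"
  by (rule cc_connected[of p]) auto

lemma cc_doubleton: "crosses p r \<Longrightarrow> cc {p, r} = 1"
  by (rule cc_connected[of p]) (auto simp: crossing_rel_def)

lemma crossing_weight_q_weight: "crossing_weight q (q_weight q)"
  unfolding crossing_weight_def q_weight_def
proof (intro conjI allI impI)
  fix A B :: "(nat \<times> nat) set" and p
  assume a: "finite A" "finite B" "A \<inter> B = {}" "\<forall>a\<in>A. \<forall>b\<in>B. \<not> crosses a b"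
  \<comment> \<open>The disjoint case of \<open>cr_Un\<close> asks for some vertex in neither
    set.\<close>
  obtain z where "z \<notin> A \<union> B" using ex_new_if_finite[of "A \<union> B"] a(1,2) by (auto simp: finite_prod)
  then show "complex_of_real (q ^ cr (A \<union> B)) = complex_of_real (q ^ cr A) * complex_of_real (q ^ cr B)"
    using cr_Un[of A B z] a by (simp add: power_add)
next
  fix A B :: "(nat \<times> nat) set" and p
  assume a: "finite A" "finite B" "A \<inter> B = {}" "p \<notin> A \<union> B" "\<forall>a\<in>A. \<forall>b\<in>B. \<not> crosses a b"
  have "cr (insert p A \<union> insert p B) = cr (insert p A) + cr (insert p B)"
    using a by (intro cr_Un[of _ _ p]) auto
  then show "complex_of_real (q ^ cr (insert p (A \<union> B))) =
      complex_of_real (q ^ cr (insert p A)) * complex_of_real (q ^ cr (insert p B))"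
    by (simp add: power_add)
qed (simp_all add: cr_image cr_doubleton cr_singleton)

text \<open>\<open>card \<pi> - cc \<pi>\<close> is the number of edges of a spanning forest of the
  crossing graph. Like \<open>cr\<close>, it is additive over disjoint unions and over unions with
  one common vertex.\<close>

lemma crossing_weight_bozejko_speicher_weight: "crossing_weight q (bozejko_speicher_weight q)"
proof -
  \<comment> \<open>As a function of the two exponents the weight is multiplicative in either
    branch, so \<open>wadd\<close> treats both signs of \<open>q\<close> at once.\<close>
  define w where "w a b = complex_of_real (if 0 \<le> q then q ^ b else (-1) ^ a * \<bar>q\<bar> ^ b)" for a b :: nat
  have w: "bozejko_speicher_weight q \<pi> = w (cr \<pi>) (card \<pi> - cc \<pi>)" for \<pi>
    by (simp add: bozejko_speicher_weight_def w_def)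
  have wadd: "w (a + a') (b + b') = w a b * w a' b'" for a a' b b'
    by (simp add: w_def power_add)
  show ?thesis
    unfolding crossing_weight_def
  proof (intro conjI allI impI)
    fix A B :: "(nat \<times> nat) set" and p
    assume a: "finite A" "finite B" "A \<inter> B = {}" "\<forall>a\<in>A. \<forall>b\<in>B. \<not> crosses a b"
    obtain z where z: "z \<notin> A \<union> B" using ex_new_if_finite[of "A \<union> B"] a(1,2) by (auto simp: finite_prod)
    have "cr (A \<union> B) = cr A + cr B" using cr_Un[of A B z] a z by simp
    \<comment> \<open>These are subtractions of naturals; \<open>cc_le_card\<close> rules out
      truncation.\<close>
    moreover have "card (A \<union> B) - cc (A \<union> B) = (card A - cc A) + (card B - cc B)"
      using cc_Un[of A B] card_Un_disjoint[of A B] cc_le_card[of A] cc_le_card[of B] a by simp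
    ultimately show "bozejko_speicher_weight q (A \<union> B) = bozejko_speicher_weight q A * bozejko_speicher_weight q B"
      by (simp add: w wadd)
  next
    fix A B :: "(nat \<times> nat) set" and p
    assume a: "finite A" "finite B" "A \<inter> B = {}" "p \<notin> A \<union> B" "\<forall>a\<in>A. \<forall>b\<in>B. \<not> crosses a b"
    have u: "insert p A \<union> insert p B = insert p (A \<union> B)" by auto
    have "cr (insert p A \<union> insert p B) = cr (insert p A) + cr (insert p B)"
      using a by (intro cr_Un[of _ _ p]) auto
    moreover have "cc (insert p A \<union> insert p B) + 1 = cc (insert p A) + cc (insert p B)"
      using a by (intro cc_glue) auto
    moreover have "card (insert p A \<union> insert p B) + 1 = card (insert p A) + card (insert p B)"
      using a by (simp add: u card_Un_disjoint)
    ultimately show "bozejko_speicher_weight q (insert p (A \<union> B)) =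
        bozejko_speicher_weight q (insert p A) * bozejko_speicher_weight q (insert p B)"
      using cc_le_card[of "insert p A"] cc_le_card[of "insert p B"] a(1,2)
      unfolding w u wadd[symmetric] by (intro arg_cong2[where f = w]) auto
  next
    fix p r assume c: "crosses p r"
    then have "p \<noteq> r" using crosses_irrefl by metis
    with c show "bozejko_speicher_weight q {p, r} = complex_of_real q"
      by (auto simp: bozejko_speicher_weight_def cr_doubleton cc_doubleton)
  qed (auto simp: w cr_image cc_image card_image w_def cr_singleton cc_singleton)
qed

section \<open>The real space \<open>L\<^sup>2\<close>\<close>

lemma L2_measurable [measurable_dest]: "f \<in> L2_fun \<Longrightarrow> f \<in> borel_measurable borel"
  by (simp add: L2_fun_def)

lemma L2_square_integrable: "f \<in> L2_fun \<Longrightarrow> integrable lborel (\<lambda>x. (f x)\<^sup>2)"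
  by (simp add: L2_fun_def)

lemma L2_mult_integrable:
  assumes [measurable]: "f \<in> L2_fun" "g \<in> L2_fun"
  shows "integrable lborel (\<lambda>x. f x * g x)"
proof (rule Bochner_Integration.integrable_bound)
  show "integrable lborel (\<lambda>x. (f x)\<^sup>2 + (g x)\<^sup>2)"
    using assms by (intro Bochner_Integration.integrable_add L2_square_integrable)
  show "AE x in lborel. norm (f x * g x) \<le> norm ((f x)\<^sup>2 + (g x)\<^sup>2)"
  proof (rule AE_I2)
    fix x
    have "0 \<le> (\<bar>f x\<bar> - \<bar>g x\<bar>)\<^sup>2" by simp
    then have "2 * (\<bar>f x\<bar> * \<bar>g x\<bar>) \<le> (f x)\<^sup>2 + (g x)\<^sup>2" by (simp add: power2_diff)
    moreover have "0 \<le> \<bar>f x\<bar> * \<bar>g x\<bar>" by simp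
    ultimately show "norm (f x * g x) \<le> norm ((f x)\<^sup>2 + (g x)\<^sup>2)"
      using sum_power2_ge_zero[of "f x" "g x"] unfolding real_norm_def abs_mult by linarith
  qed
qed simp

lemma L2_lincomb:
  assumes [measurable]: "f \<in> L2_fun" "g \<in> L2_fun"
  shows "(\<lambda>x. r * f x + s * g x) \<in> L2_fun"
proof -
  have "integrable lborel (\<lambda>x. r\<^sup>2 * (f x)\<^sup>2 + (2 * r * s) * (f x * g x) + s\<^sup>2 * (g x)\<^sup>2)"
    using assms by (intro Bochner_Integration.integrable_add integrable_mult_right
        L2_square_integrable L2_mult_integrable)
  then have "integrable lborel (\<lambda>x. (r * f x + s * g x)\<^sup>2)"
    by (simp add: power2_sum power_mult_distrib algebra_simps)
  then show ?thesis by (simp add: L2_fun_def)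
qed

lemma L2_diff: "f \<in> L2_fun \<Longrightarrow> g \<in> L2_fun \<Longrightarrow> (\<lambda>x. f x - g x) \<in> L2_fun"
  using L2_lincomb[of f g 1 "-1"] by simp

lemma L2_scale: "f \<in> L2_fun \<Longrightarrow> (\<lambda>x. r * f x) \<in> L2_fun"
  using L2_lincomb[of f f r 0] by simp

lemma L2_inner_commute: "L2_inner f g = L2_inner g f"
  by (simp add: L2_inner_def mult.commute)

lemma L2_inner_lincomb:
  assumes "f \<in> L2_fun" "g \<in> L2_fun" "h \<in> L2_fun"
  shows "L2_inner (\<lambda>x. r * f x + s * g x) h = r * L2_inner f h + s * L2_inner g h"
proof -
  have "L2_inner (\<lambda>x. r * f x + s * g x) h = (\<integral>x. r * (f x * h x) + s * (g x * h x) \<partial>lborel)"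
    by (simp add: L2_inner_def algebra_simps)
  also have "\<dots> = r * L2_inner f h + s * L2_inner g h"
    using assms by (simp add: L2_inner_def L2_mult_integrable)
  finally show ?thesis .
qed

definition L2norm :: "(real \<Rightarrow> real) \<Rightarrow> real" where
  "L2norm f = sqrt (L2_inner f f)"

lemma L2_inner_nonneg: "0 \<le> L2_inner f f"
  by (simp add: L2_inner_def)

lemma L2norm_nonneg [simp]: "0 \<le> L2norm f"
  by (simp add: L2norm_def L2_inner_nonneg)

lemma L2_Cauchy_Schwarz:
  assumes "f \<in> L2_fun" "g \<in> L2_fun"
  shows "\<bar>L2_inner f g\<bar> \<le> L2norm f * L2norm g"
proof -
  let ?a = "L2_inner f f" and ?b = "L2_inner f g" and ?c = "L2_inner g g"
  have q: "0 \<le> r\<^sup>2 * ?a + 2 * r * s * ?b + s\<^sup>2 * ?c" for r s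
  proof -
    let ?h = "\<lambda>x. r * f x + s * g x"
    have h: "?h \<in> L2_fun" by (rule L2_lincomb[OF assms])
    have "L2_inner ?h ?h = r * L2_inner ?h f + s * L2_inner ?h g"
      using L2_inner_lincomb[OF assms h, of r s] by (simp add: L2_inner_commute)
    also have "\<dots> = r\<^sup>2 * ?a + 2 * r * s * ?b + s\<^sup>2 * ?c"
      using L2_inner_lincomb[OF assms assms(1), of r s] L2_inner_lincomb[OF assms assms(2), of r s]
      by (simp add: L2_inner_commute[of g f] power2_eq_square algebra_simps)
    finally show ?thesis using L2_inner_nonneg[of ?h] by simp
  qed
  have "?b\<^sup>2 \<le> ?a * ?c"
  proof (cases "?c = 0")
    case True
    have "?b = 0"
    proof (rule ccontr)
      assume b: "?b \<noteq> 0"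
      \<comment> \<open>For \<open>?c = 0\<close> the quadratic form is affine in its second
        coefficient; the value chosen would make it -1.\<close>
      have "0 \<le> ?a + 2 * (- (?a + 1) / (2 * ?b)) * ?b"
        using q[of 1 "- (?a + 1) / (2 * ?b)"] True by simp
      then show False using b by (simp add: field_simps)
    qed
    then show ?thesis by (simp add: True)
  next
    case False
    then have c: "?c > 0" using L2_inner_nonneg[of g] by simp
    have "0 \<le> ?c * (?a * ?c - ?b\<^sup>2)"
      using q[of "?c" "- ?b"] by (simp add: power2_eq_square algebra_simps)
    then show ?thesis using c by (simp add: zero_le_mult_iff)
  qed
  then have "sqrt (?b\<^sup>2) \<le> sqrt (?a * ?c)" by (rule real_sqrt_le_mono)
  then show ?thesis by (simp add: L2norm_def real_sqrt_mult)
qed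

section \<open>Truncations and bounded letters of bounded support\<close>

definition trunc :: "real set \<Rightarrow> (real \<Rightarrow> real) \<Rightarrow> real \<Rightarrow> real" where
  "trunc A f x = (if x \<in> A then f x else 0)"

lemma trunc_eq: "trunc A f = (\<lambda>x. indicator A x * f x)"
  by (auto simp: trunc_def)

lemma L2_trunc:
  assumes [measurable]: "f \<in> L2_fun" "A \<in> sets borel"
  shows "trunc A f \<in> L2_fun"
proof -
  have "integrable lborel (\<lambda>x. (indicator A x * f x)\<^sup>2)"
    by (rule Bochner_Integration.integrable_bound[OF L2_square_integrable[OF assms(1)]])
      (auto simp: indicator_def)
  then show ?thesis by (simp add: L2_fun_def trunc_eq)
qed

lemma trunc_supported: "supported_in (trunc A f) A"
  by (simp add: supported_in_def trunc_def)

lemma L2norm_trunc_le: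
  assumes "f \<in> L2_fun" "A \<in> sets borel"
  shows "L2norm (trunc A f) \<le> L2norm f"
  unfolding L2norm_def L2_inner_def
proof (intro real_sqrt_le_mono integral_mono)
  show "integrable lborel (\<lambda>x. trunc A f x * trunc A f x)" "integrable lborel (\<lambda>x. f x * f x)"
    by (intro L2_mult_integrable L2_trunc assms)+
qed (auto simp: trunc_def)

lemma L2_inner_disjoint:
  assumes "supported_in f I" "supported_in g J" "I \<inter> J = {}"
  shows "L2_inner f g = 0"
proof -
  have "AE x in lborel. f x * g x = 0"
    using assms(1,2) unfolding supported_in_def by eventually_elim (use assms(3) in auto)
  then show ?thesis unfolding L2_inner_def by (rule integral_eq_zero_AE)
qed

lemma indicator_L2: "indicator {s..<t} \<in> L2_fun"
proof -
  have "integrable lborel (indicator {s..<t} :: real \<Rightarrow> real)"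
    by (cases "s \<le> t") (simp_all add: integrable_indicator_iff)
  moreover have "(indicator {s..<t} x :: real)\<^sup>2 = indicator {s..<t} x" for x :: real
    by (simp add: indicator_def)
  ultimately show ?thesis by (simp add: L2_fun_def)
qed

lemma L2norm_indicator: "s \<le> t \<Longrightarrow> L2_inner (indicator {s..<t}) (indicator {s..<t}) = t - s"
proof -
  assume "s \<le> t"
  have "indicator {s..<t} x * indicator {s..<t} x = (indicator {s..<t} x :: real)" for x :: real
    by (simp add: indicator_def)
  with \<open>s \<le> t\<close> show ?thesis by (simp only: L2_inner_def) simp
qed

text \<open>Bounded support lets a letter be moved away from all others by a large translation;
  bounded values make its norm on a short interval comparable to the root of the length.\<close>

definition nice_fun :: "(real \<Rightarrow> real) set" where
  "nice_fun = {f \<in> L2_fun. \<exists>R. \<forall>x. \<bar>f x\<bar> \<le> R \<and> (\<bar>x\<bar> > R \<longrightarrow> f x = 0)}"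

lemma nice_L2: "f \<in> nice_fun \<Longrightarrow> f \<in> L2_fun"
  by (simp add: nice_fun_def)

lemma nice_common_bound:
  assumes "finite F" "F \<subseteq> nice_fun"
  obtains R where "\<And>f x. f \<in> F \<Longrightarrow> \<bar>f x\<bar> \<le> R" "\<And>f x. f \<in> F \<Longrightarrow> \<bar>x\<bar> > R \<Longrightarrow> f x = 0"
proof -
  have "\<exists>R. \<forall>f\<in>F. \<forall>x. \<bar>f x\<bar> \<le> R \<and> (\<bar>x\<bar> > R \<longrightarrow> f x = 0)"
    using assms
  proof (induction F rule: finite_induct)
    case (insert f F)
    then obtain R where R: "\<forall>f\<in>F. \<forall>x. \<bar>f x\<bar> \<le> R \<and> (\<bar>x\<bar> > R \<longrightarrow> f x = 0)" by auto
    obtain R' where R': "\<forall>x. \<bar>f x\<bar> \<le> R' \<and> (\<bar>x\<bar> > R' \<longrightarrow> f x = 0)"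
      using insert.prems by (auto simp: nice_fun_def)
    show ?case
      by (intro exI[of _ "max R R'"] ballI allI conjI impI) (use R R' in \<open>fastforce simp: le_max_iff_disj\<close>)+
  qed auto
  then show ?thesis using that by blast
qed

lemma trunc_nice:
  assumes "f \<in> nice_fun" "A \<in> sets borel"
  shows "trunc A f \<in> nice_fun"
proof -
  obtain R where R: "\<forall>x. \<bar>f x\<bar> \<le> R \<and> (\<bar>x\<bar> > R \<longrightarrow> f x = 0)" using assms by (auto simp: nice_fun_def)
  have "0 \<le> R" using R abs_ge_zero order_trans by blast
  with R show ?thesis
    using L2_trunc[OF nice_L2[OF assms(1)] assms(2)]
    by (auto simp: nice_fun_def trunc_def intro!: exI[of _ R])
qed

lemma nice_approx:
  assumes f: "f \<in> L2_fun"
  obtains g where "\<And>n. g n \<in> nice_fun" "(\<lambda>n. L2norm (\<lambda>x. f x - g n x)) \<longlonglongrightarrow> 0"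
proof -
  define A where "A n = {x. \<bar>x\<bar> \<le> real n \<and> \<bar>f x\<bar> \<le> real n}" for n :: nat
  note [measurable] = L2_measurable[OF f]
  have A [measurable]: "A n \<in> sets borel" for n unfolding A_def by measurable
  have "trunc (A n) f \<in> nice_fun" for n
    using L2_trunc[OF f A, of n] by (auto simp: nice_fun_def trunc_def A_def intro!: exI[of _ "real n"])
  moreover have "(\<lambda>n. L2norm (\<lambda>x. f x - trunc (A n) f x)) \<longlonglongrightarrow> 0"
  proof -
    have "(\<lambda>n. \<integral>x. (f x - trunc (A n) f x) * (f x - trunc (A n) f x) \<partial>lborel) \<longlonglongrightarrow> (\<integral>x. 0 \<partial>(lborel :: real measure))"
    proof (rule integral_dominated_convergence[where w = "\<lambda>x. f x * f x" and f = "\<lambda>x. 0"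
          and s = "\<lambda>n x. (f x - trunc (A n) f x) * (f x - trunc (A n) f x)"])
      show "(\<lambda>x. (f x - trunc (A n) f x) * (f x - trunc (A n) f x)) \<in> borel_measurable lborel" for n
        unfolding trunc_eq by measurable
      show "integrable lborel (\<lambda>x. f x * f x)" by (rule L2_mult_integrable[OF f f])
      show "AE x in lborel. (\<lambda>n. (f x - trunc (A n) f x) * (f x - trunc (A n) f x)) \<longlonglongrightarrow> 0"
      proof (rule AE_I2, rule tendsto_eventually)
        fix x
        obtain N where N: "max \<bar>x\<bar> \<bar>f x\<bar> \<le> real N" using real_arch_simple by blast
        show "\<forall>\<^sub>F n in sequentially. (f x - trunc (A n) f x) * (f x - trunc (A n) f x) = 0"
          using eventually_ge_at_top[of N]
          by eventually_elim (use N in \<open>auto simp: trunc_def A_def\<close>)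
      qed
    qed (auto simp: trunc_def)
    then have "(\<lambda>n. sqrt (\<integral>x. (f x - trunc (A n) f x) * (f x - trunc (A n) f x) \<partial>lborel)) \<longlonglongrightarrow> sqrt 0"
      by (intro tendsto_real_sqrt) simp
    then show ?thesis by (simp add: L2norm_def L2_inner_def)
  qed
  ultimately show ?thesis by (rule that)
qed

text \<open>Two letters restricted to an interval thus contribute one full power of its
  length.\<close>

lemma L2norm_trunc_bounded:
  assumes f: "f \<in> L2_fun" "\<And>x. \<bar>f x\<bar> \<le> K" and st: "s \<le> t"
  shows "L2norm (trunc {s..<t} f) \<le> K * sqrt (t - s)"
proof -
  have K: "0 \<le> K" using f(2)[of 0] by linarith
  have "L2_inner (trunc {s..<t} f) (trunc {s..<t} f) \<le> (\<integral>x. K\<^sup>2 * (indicator {s..<t} x * indicator {s..<t} x) \<partial>lborel)"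
    unfolding L2_inner_def
  proof (rule integral_mono)
    show "integrable lborel (\<lambda>x. trunc {s..<t} f x * trunc {s..<t} f x)"
      by (intro L2_mult_integrable L2_trunc f) auto
    show "integrable lborel (\<lambda>x::real. K\<^sup>2 * (indicator {s..<t} x * indicator {s..<t} x))"
      by (intro integrable_mult_right L2_mult_integrable indicator_L2)
    fix x :: real
    have "(f x)\<^sup>2 \<le> K\<^sup>2" using f(2)[of x] K by (simp add: abs_le_square_iff[symmetric])
    then show "trunc {s..<t} f x * trunc {s..<t} f x \<le> K\<^sup>2 * (indicator {s..<t} x * indicator {s..<t} x)"
      by (simp add: trunc_def power2_eq_square)
  qed
  also have "\<dots> = K\<^sup>2 * (t - s)"
    using L2norm_indicator[OF st] by (simp add: L2_inner_def del: integral_mult_right)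
  finally have "L2norm (trunc {s..<t} f) \<le> sqrt (K\<^sup>2 * (t - s))"
    unfolding L2norm_def by (rule real_sqrt_le_mono)
  then show ?thesis using K by (simp add: real_sqrt_mult)
qed

section \<open>Involutive isometries of \<open>L\<^sup>2\<close>\<close>

text \<open>Moments depend only on inner products of letters, so preserving these is what second
  quantization asks for; being involutive makes the resulting unitary its own adjoint.\<close>

definition L2_involution :: "((real \<Rightarrow> real) \<Rightarrow> real \<Rightarrow> real) \<Rightarrow> bool" where
  "L2_involution O1 \<longleftrightarrow> (\<forall>f\<in>L2_fun. O1 f \<in> L2_fun \<and> O1 (O1 f) = f) \<and>
     (\<forall>f\<in>L2_fun. \<forall>g\<in>L2_fun. L2_inner (O1 f) (O1 g) = L2_inner f g)"

definition fixes_supported :: "((real \<Rightarrow> real) \<Rightarrow> real \<Rightarrow> real) \<Rightarrow> real set \<Rightarrow> bool" where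
  "fixes_supported O1 I \<longleftrightarrow>
     (\<forall>f\<in>L2_fun. supported_in f I \<longrightarrow> (AE x in lborel. O1 f x = f x))"

text \<open>The average of this map and the identity is truncation to \<open>I\<close>.\<close>

definition flip_off :: "real set \<Rightarrow> (real \<Rightarrow> real) \<Rightarrow> real \<Rightarrow> real" where
  "flip_off I f x = (if x \<in> I then f x else - f x)"

lemma flip_off_involution: 
  assumes [measurable]: "I \<in> sets borel" 
  shows "L2_involution (flip_off I)"
proof -
  have "flip_off I f \<in> L2_fun" if [measurable]: "f \<in> L2_fun" for f
  proof -
    have "flip_off I f = (\<lambda>x. (2 * indicator I x - 1) * f x)" by (auto simp: flip_off_def)
    moreover have "(\<lambda>x. (2 * indicator I x - 1) * f x) \<in> borel_measurable lborel" by measurable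
    moreover have "(flip_off I f x)\<^sup>2 = (f x)\<^sup>2" for x by (simp add: flip_off_def)
    ultimately show ?thesis using L2_square_integrable[OF that] by (simp add: L2_fun_def)
  qed
  moreover have "flip_off I f x * flip_off I g x = f x * g x" for f g and x :: real by (simp add: flip_off_def)
  ultimately show ?thesis by (auto simp: L2_involution_def L2_inner_def) (auto simp: flip_off_def)
qed

lemma flip_off_fixes: "fixes_supported (flip_off I) I"
  unfolding fixes_supported_def supported_in_def
proof (intro ballI impI)
  fix f :: "real \<Rightarrow> real" assume "AE x in lborel. x \<notin> I \<longrightarrow> f x = 0"
  then show "AE x in lborel. flip_off I f x = f x"
    by eventually_elim (auto simp: flip_off_def)
qed

text \<open>For \<open>B\<close> disjoint from its translate by \<open>c\<close>, the two are
  exchanged and everything else stays in place. A mere translation would neither be involutive nor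
  fix an interval pointwise.\<close>

definition swap_point :: "real set \<Rightarrow> real \<Rightarrow> real \<Rightarrow> real" where
  "swap_point B c x = (if x \<in> B then x + c else if x - c \<in> B then x - c else x)"

definition swap_with :: "real set \<Rightarrow> real \<Rightarrow> (real \<Rightarrow> real) \<Rightarrow> real \<Rightarrow> real" where
  "swap_with B c f x = f (swap_point B c x)"

context
  fixes B :: "real set" and c :: real
  assumes B [measurable]: "B \<in> sets borel" and disj: "\<And>x. x \<in> B \<Longrightarrow> x - c \<notin> B"
begin

lemma disj': "x \<in> B \<Longrightarrow> x + c \<notin> B"
  using disj[of "x + c"] by auto

lemma swap_swap: "swap_point B c (swap_point B c x) = x"
  using disj disj' by (auto simp: swap_point_def)

lemma integral_swap:
  assumes h: "integrable lborel (h :: real \<Rightarrow> real)"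
  shows "integrable lborel (\<lambda>x. h (swap_point B c x))"
    and "(\<integral>x. h (swap_point B c x) \<partial>lborel) = (\<integral>x. h x \<partial>lborel)"
proof -
  have [measurable]: "h \<in> borel_measurable borel" using borel_measurable_integrable[OF h] by simp
  \<comment> \<open>The parts of \<open>h\<close> on the translate of \<open>B\<close>, on
    \<open>B\<close> and elsewhere; the swap translates the first two and keeps the third.\<close>
  let ?a = "\<lambda>x. indicator B (x - c) * h x" and ?b = "\<lambda>x. indicator B x * h x"
    and ?r = "\<lambda>x. (1 - indicator B x - indicator B (x - c)) * h x"
  have "integrable lborel ?a" "integrable lborel ?b" "integrable lborel ?r"
    by (rule Bochner_Integration.integrable_bound[OF h]; force simp: indicator_def disj)+
  note int = this
  have ta: "integrable lborel (\<lambda>x. ?a (c + 1 * x))" "(\<integral>x. ?a (c + 1 * x) \<partial>lborel) = (\<integral>x. ?a x \<partial>lborel)"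
    using lborel_integrable_real_affine[OF int(1), of 1 c] lborel_integral_real_affine[of 1 ?a c] by auto
  have tb: "integrable lborel (\<lambda>x. ?b (-c + 1 * x))" "(\<integral>x. ?b (-c + 1 * x) \<partial>lborel) = (\<integral>x. ?b x \<partial>lborel)"
    using lborel_integrable_real_affine[OF int(2), of 1 "-c"] lborel_integral_real_affine[of 1 ?b "-c"] by auto
  have eq: "h (swap_point B c x) = ?a (c + 1 * x) + ?b (-c + 1 * x) + ?r x" for x
    using disj[of x] disj'[of x] by (auto simp: swap_point_def indicator_def add.commute)
  show "integrable lborel (\<lambda>x. h (swap_point B c x))"
    unfolding eq by (intro Bochner_Integration.integrable_add ta tb int)
  have "(\<integral>x. h (swap_point B c x) \<partial>lborel) = (\<integral>x. ?a x \<partial>lborel) + (\<integral>x. ?b x \<partial>lborel) + (\<integral>x. ?r x \<partial>lborel)"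
    unfolding eq
    by (subst Bochner_Integration.integral_add Bochner_Integration.integral_add;
        (intro Bochner_Integration.integrable_add ta tb int)?)+ (simp only: ta tb)
  also have "\<dots> = (\<integral>x. ?a x + ?b x + ?r x \<partial>lborel)"
    by (simp only: Bochner_Integration.integral_add Bochner_Integration.integrable_add int)
  also have "\<dots> = (\<integral>x. h x \<partial>lborel)" by (simp add: algebra_simps)
  finally show "(\<integral>x. h (swap_point B c x) \<partial>lborel) = (\<integral>x. h x \<partial>lborel)" .
qed

lemma swap_involution: "L2_involution (swap_with B c)"
  unfolding L2_involution_def
proof (intro conjI ballI)
  fix f g assume f: "f \<in> L2_fun" and g: "g \<in> L2_fun"
  show "L2_inner (swap_with B c f) (swap_with B c g) = L2_inner f g"
    unfolding L2_inner_def swap_with_def using integral_swap(2)[OF L2_mult_integrable[OF f g]] .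
next
  fix f assume f: "f \<in> L2_fun"
  show "swap_with B c (swap_with B c f) = f" by (auto simp: swap_with_def swap_swap)
  have [measurable]: "swap_point B c \<in> borel_measurable borel"
    unfolding swap_point_def[abs_def] by measurable
  note [measurable] = L2_measurable[OF f]
  have "swap_with B c f \<in> borel_measurable lborel" unfolding swap_with_def[abs_def] by measurable
  moreover have "integrable lborel (\<lambda>x. (swap_with B c f x)\<^sup>2)"
    unfolding swap_with_def by (rule integral_swap(1)[OF L2_square_integrable[OF f]])
  ultimately show "swap_with B c f \<in> L2_fun" by (simp add: L2_fun_def)
qed

text \<open>As \<open>f\<close> vanishes off \<open>I\<close> only almost everywhere, null sets
  would have to be transported by the swap. Instead the squared distance of \<open>f\<close> to its
  image is expanded: both squared norms and the inner product equal
  \<open>L2_inner f f\<close>.\<close>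

lemma swap_fixes:
  assumes I: "\<And>x. x \<in> I \<Longrightarrow> x \<notin> B \<and> x - c \<notin> B"
  shows "fixes_supported (swap_with B c) I"
  unfolding fixes_supported_def
proof (intro ballI impI)
  fix f assume f: "f \<in> L2_fun" and s: "supported_in f I"
  let ?g = "swap_with B c f"
  have g: "?g \<in> L2_fun" and gg: "L2_inner ?g ?g = L2_inner f f"
    using swap_involution f by (auto simp: L2_involution_def)
  have "AE x in lborel. ?g x * f x = f x * f x"
    using s unfolding supported_in_def
    by eventually_elim (use I in \<open>auto simp: swap_with_def swap_point_def\<close>)
  then have gf: "L2_inner ?g f = L2_inner f f"
    unfolding L2_inner_def using L2_measurable[OF f] L2_measurable[OF g] by (intro integral_cong_AE) auto
  let ?d = "\<lambda>x. 1 * ?g x + (-1) * f x"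
  have d: "?d \<in> L2_fun" by (rule L2_lincomb[OF g f])
  have "L2_inner ?d ?d = L2_inner ?g ?d - L2_inner f ?d"
    using L2_inner_lincomb[OF g f d, of 1 "-1"] by simp
  also have "\<dots> = 0"
    using L2_inner_lincomb[OF g f g, of 1 "-1"] L2_inner_lincomb[OF g f f, of 1 "-1"] gg gf
    by (simp add: L2_inner_commute[of _ "\<lambda>x. ?g x - f x"] L2_inner_commute[of f ?g])
  finally have "(\<integral>x. ?d x * ?d x \<partial>lborel) = 0" by (simp add: L2_inner_def)
  then have "AE x in lborel. ?d x * ?d x = 0"
    using integral_nonneg_eq_0_iff_AE[OF L2_mult_integrable[OF d d]] by simp
  then show "AE x in lborel. ?g x = f x" by eventually_elim simp
qed

end

section \<open>Generalized Brownian motions with multiplicative weights\<close>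

lemma pairing_sum_cong:
  assumes "\<And>i j. i \<in> X \<Longrightarrow> j \<in> X \<Longrightarrow> h i j = h' i j"
  shows "pairing_sum t X h = pairing_sum t X h'"
  unfolding pairing_sum_def
proof (intro sum.cong refl arg_cong2[where f = "(*)"] prod.cong)
  fix \<pi> p assume "\<pi> \<in> pairings X" "p \<in> \<pi>"
  then show "(case p of (i, j) \<Rightarrow> h i j) = (case p of (i, j) \<Rightarrow> h' i j)"
    using pairings_memD[of \<pi> X p] assms by (auto simp: case_prod_unfold)
qed

lemma fst_scaleC: "fst (c *\<^sub>C p) = c *\<^sub>C fst p" and snd_scaleC: "snd (c *\<^sub>C p) = c *\<^sub>C snd p"
  by (simp_all add: scaleC_prod_def)

lemma crosses_map_strict_mono:
  assumes "strict_mono_on X e" "p \<in> X \<times> X" "r \<in> X \<times> X"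
  shows "crosses (map_prod e e p) (map_prod e e r) = crosses p r"
  using assms(2,3) by (auto simp: crosses_def strict_mono_on_less[OF assms(1)])

locale gbm =
  fixes q :: real and t :: "(nat \<times> nat) set \<Rightarrow> complex"
    and \<Omega> :: "'h::chilbert_space" and \<omega> :: "(real \<Rightarrow> real) \<Rightarrow> 'h \<Rightarrow> 'h"
  assumes weight: "crossing_weight q t"
    and gbm: "generalized_brownian_motion t \<Omega> \<omega>"
    and cbs: "continuous_bernoulli_system (field_system \<Omega> \<omega>)"
begin

abbreviation D :: "'h set" where "D \<equiv> field_domain \<Omega> \<omega>"
abbreviation W :: "(real \<Rightarrow> real) list \<Rightarrow> 'h" where "W fs \<equiv> foldr \<omega> fs \<Omega>"
abbreviation A :: "real set \<Rightarrow> ('h \<Rightarrow> 'h) set" where "A \<equiv> field_algebra \<Omega> \<omega>"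

lemma
  shows weight_inj: "finite \<pi> \<Longrightarrow> inj_on h \<pi> \<Longrightarrow>
      (\<And>p r. p \<in> \<pi> \<Longrightarrow> r \<in> \<pi> \<Longrightarrow> crosses (h p) (h r) = crosses p r) \<Longrightarrow> t (h ` \<pi>) = t \<pi>"
    and weight_Un: "finite X \<Longrightarrow> finite Y \<Longrightarrow> X \<inter> Y = {} \<Longrightarrow>
      (\<And>a b. a \<in> X \<Longrightarrow> b \<in> Y \<Longrightarrow> \<not> crosses a b) \<Longrightarrow> t (X \<union> Y) = t X * t Y"
    and weight_insert: "finite X \<Longrightarrow> finite Y \<Longrightarrow> X \<inter> Y = {} \<Longrightarrow> p \<notin> X \<union> Y \<Longrightarrow>
      (\<And>a b. a \<in> X \<Longrightarrow> b \<in> Y \<Longrightarrow> \<not> crosses a b) \<Longrightarrow>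
      t (insert p (X \<union> Y)) = t (insert p X) * t (insert p Y)"
    and weight_crossing: "crosses p r \<Longrightarrow> t {p, r} = complex_of_real q"
    and weight_singleton: "t {p} = 1"
proof -
  note w = weight[unfolded crossing_weight_def]
  show "t (h ` \<pi>) = t \<pi>"
    if "finite \<pi>" "inj_on h \<pi>" "\<And>p r. p \<in> \<pi> \<Longrightarrow> r \<in> \<pi> \<Longrightarrow> crosses (h p) (h r) = crosses p r"
    by (rule w[THEN conjunct1, rule_format]) (fact that)+
  show "t (X \<union> Y) = t X * t Y"
    if "finite X" "finite Y" "X \<inter> Y = {}" "\<And>a b. a \<in> X \<Longrightarrow> b \<in> Y \<Longrightarrow> \<not> crosses a b"
    by (rule w[THEN conjunct2, THEN conjunct1, rule_format]) (fact that)+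
  show "t (insert p (X \<union> Y)) = t (insert p X) * t (insert p Y)"
    if "finite X" "finite Y" "X \<inter> Y = {}" "p \<notin> X \<union> Y" "\<And>a b. a \<in> X \<Longrightarrow> b \<in> Y \<Longrightarrow> \<not> crosses a b"
    by (rule w[THEN conjunct2, THEN conjunct2, THEN conjunct1, rule_format]) (fact that)+
  show "t {p, r} = complex_of_real q" if "crosses p r"
    by (rule w[THEN conjunct2, THEN conjunct2, THEN conjunct2, THEN conjunct1, rule_format]) (fact that)
  show "t {p} = 1"
    by (rule w[THEN conjunct2, THEN conjunct2, THEN conjunct2, THEN conjunct2, rule_format])
qed

lemma D_dense: "closure D = UNIV"
  using gbm by (auto simp: generalized_brownian_motion_def)

lemma
  assumes "f \<in> L2_fun" "x \<in> D" "y \<in> D"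
  shows field_add: "\<omega> f (x + y) = \<omega> f x + \<omega> f y"
    and field_scaleC: "\<omega> f (c *\<^sub>C x) = c *\<^sub>C \<omega> f x"
    and field_sym: "cinner (\<omega> f x) y = cinner x (\<omega> f y)"
  using gbm assms unfolding generalized_brownian_motion_def by blast+

lemma
  assumes "f \<in> L2_fun" "g \<in> L2_fun" "x \<in> D"
  shows field_lincomb: "\<omega> (\<lambda>u. r * f u + s * g u) x = r *\<^sub>R \<omega> f x + s *\<^sub>R \<omega> g x"
    and field_cong: "(AE u in lborel. f u = g u) \<Longrightarrow> \<omega> f x = \<omega> g x"
  using gbm assms unfolding generalized_brownian_motion_def by blast+

lemma D_subspace: "cv.subspace D"
  by (simp add: field_domain_def cv.subspace_span)

lemma W_in_D: "set fs \<subseteq> L2_fun \<Longrightarrow> W fs \<in> D"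
  unfolding field_domain_def by (rule cv.span_base) blast

lemma Omega_in_D: "\<Omega> \<in> D"
  using W_in_D[of "[]"] by simp

lemma field_zero: "f \<in> L2_fun \<Longrightarrow> \<omega> f 0 = 0"
  using field_scaleC[of f \<Omega> \<Omega> 0] Omega_in_D by simp

lemma field_in_D:
  assumes f: "f \<in> L2_fun" and x: "x \<in> D"
  shows "\<omega> f x \<in> D"
proof -
  have "x \<in> D \<and> \<omega> f x \<in> D"
    using x unfolding field_domain_def
  proof (induction rule: cv.span_induct_alt)
    case base
    then show ?case using field_zero[OF f] by (simp add: cv.span_zero)
  next
    case (step c b y)
    then obtain fs where fs: "b = W fs" "set fs \<subseteq> L2_fun" by blast
    have y: "y \<in> D" "\<omega> f y \<in> D" using step by (auto simp: field_domain_def)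
    have b: "b \<in> D" "\<omega> f b \<in> D" using W_in_D[of fs] W_in_D[of "f # fs"] fs f by auto
    have cb: "c *\<^sub>C b \<in> D" by (rule cv.subspace_scale[OF D_subspace b(1)])
    have "\<omega> f (c *\<^sub>C b + y) = c *\<^sub>C \<omega> f b + \<omega> f y"
      by (simp add: field_add[OF f cb y(1)] field_scaleC[OF f b(1) b(1)])
    then have "c *\<^sub>C b + y \<in> D \<and> \<omega> f (c *\<^sub>C b + y) \<in> D"
      by (auto intro!: cv.subspace_add[OF D_subspace] cv.subspace_scale[OF D_subspace] b y)
    then show ?case by (simp add: field_domain_def)
  qed
  then show ?thesis ..
qed

lemma W_Cons: "W (f # fs) = \<omega> f (W fs)"
  by simp

lemma W_inner:
  "set fs \<subseteq> L2_fun \<Longrightarrow> set gs \<subseteq> L2_fun \<Longrightarrow> cinner (W fs) (W gs) = cinner \<Omega> (W (rev fs @ gs))"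
proof (induction fs arbitrary: gs)
  case (Cons f fs)
  have "cinner (\<omega> f (W fs)) (W gs) = cinner (W fs) (W (f # gs))"
    unfolding W_Cons by (rule field_sym) (use Cons.prems W_in_D in auto)
  also have "\<dots> = cinner \<Omega> (W (rev fs @ f # gs))"
    by (rule Cons.IH) (use Cons.prems in auto)
  finally show ?case by simp
qed simp

section \<open>Moments and norms of words\<close>

definition gram :: "(real \<Rightarrow> real) list \<Rightarrow> nat \<Rightarrow> nat \<Rightarrow> complex" where
  "gram hs i j = complex_of_real (L2_inner (hs ! (i - 1)) (hs ! (j - 1)))"

lemma W_moment: "set hs \<subseteq> L2_fun \<Longrightarrow> cinner \<Omega> (W hs) = pairing_sum t {1..length hs} (gram hs)"
  using gbm unfolding generalized_brownian_motion_def pairing_sum_def pair_partitions_eq_pairings gram_def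
  by blast

text \<open>The squared norm is a moment of the word doubled to length \<open>2 * n\<close>, where
  every pair partition contributes at most \<open>cmod (t \<pi>)\<close> times the squared product
  of the norms of the letters. This continuity in the letters takes the place of operator
  bounds.\<close>

lemma W_bound: "\<exists>K\<ge>0. \<forall>fs. set fs \<subseteq> L2_fun \<longrightarrow> length fs = n \<longrightarrow> norm (W fs) \<le> K * prod_list (map L2norm fs)"
proof -
  define C where "C = (\<Sum>\<pi>\<in>pairings {1..2 * n}. cmod (t \<pi>))"
  have C: "0 \<le> C" unfolding C_def by (intro sum_nonneg) auto
  have "norm (W fs) \<le> sqrt C * prod_list (map L2norm fs)" if fs: "set fs \<subseteq> L2_fun" "length fs = n" for fs
  proof -
    define hs where "hs = rev fs @ fs"
    have hs: "set hs \<subseteq> L2_fun" "length hs = 2 * n" using fs by (auto simp: hs_def)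
    define N where "N k = L2norm (hs ! (k - 1))" for k
    have g: "cmod (gram hs i j) \<le> N i * N j" if "i \<in> {1..2 * n}" "j \<in> {1..2 * n}" for i j
    proof -
      have "hs ! (i - 1) \<in> L2_fun" "hs ! (j - 1) \<in> L2_fun" using that hs by (auto intro!: subsetD[OF hs(1)] nth_mem)
      then show ?thesis unfolding gram_def N_def by (simp add: L2_Cauchy_Schwarz)
    qed
    have "(\<Prod>k\<in>{1..2 * n}. N k) = (\<Prod>i<2 * n. L2norm (hs ! i))"
      by (rule prod.reindex_bij_witness[of _ Suc "\<lambda>k. k - 1"]) (auto simp: N_def)
    also have "\<dots> = prod_list (map L2norm hs)"
      using hs(2) by (simp add: prod.list_conv_set_nth atLeast0LessThan)
    also have "\<dots> = (prod_list (map L2norm fs))\<^sup>2"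
      by (simp add: hs_def rev_map[symmetric] prod_list.rev power2_eq_square)
    finally have pN: "(\<Prod>k\<in>{1..2 * n}. N k) = (prod_list (map L2norm fs))\<^sup>2" .
    have "complex_of_real ((norm (W fs))\<^sup>2) = cinner \<Omega> (W hs)"
      using W_inner[OF fs(1) fs(1)] by (simp add: cinner_self hs_def)
    then have "(norm (W fs))\<^sup>2 = cmod (cinner \<Omega> (W hs))"
      by (metis norm_of_real abs_of_nonneg zero_le_power2)
    also have "\<dots> \<le> (\<Sum>\<pi>\<in>pairings {1..2 * n}. cmod (t \<pi> * (\<Prod>(i, j)\<in>\<pi>. gram hs i j)))"
      unfolding W_moment[OF hs(1)] hs(2) pairing_sum_def by (rule norm_sum)
    also have "\<dots> \<le> (\<Sum>\<pi>\<in>pairings {1..2 * n}. cmod (t \<pi>) * (prod_list (map L2norm fs))\<^sup>2)"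
    proof (rule sum_mono)
      fix \<pi> assume p: "\<pi> \<in> pairings {1..2 * n}"
      have "cmod (\<Prod>(i, j)\<in>\<pi>. gram hs i j) \<le> (\<Prod>(i, j)\<in>\<pi>. N i * N j)"
        unfolding prod_norm[symmetric]
        by (rule prod_mono) (use pairings_memD[OF p] g in \<open>auto simp: case_prod_unfold\<close>)
      also have "\<dots> = (prod_list (map L2norm fs))\<^sup>2"
        using prod_pairing[OF _ p, of N] pN by simp
      finally show "cmod (t \<pi> * (\<Prod>(i, j)\<in>\<pi>. gram hs i j)) \<le> cmod (t \<pi>) * (prod_list (map L2norm fs))\<^sup>2"
        by (simp add: norm_mult mult_left_mono)
    qed
    also have "\<dots> = C * (prod_list (map L2norm fs))\<^sup>2" by (simp add: C_def sum_distrib_right)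
    finally have "(norm (W fs))\<^sup>2 \<le> (sqrt C * prod_list (map L2norm fs))\<^sup>2"
      using C by (simp add: power_mult_distrib)
    moreover have "0 \<le> prod_list (map L2norm fs)" by (induction fs) auto
    ultimately show ?thesis using C by (intro power2_le_imp_le[of "norm (W fs)"]) auto
  qed
  then show ?thesis using C by (intro exI[of _ "sqrt C"]) auto
qed

lemma W_lincomb:
  assumes "f \<in> L2_fun" "g \<in> L2_fun" "set gs \<subseteq> L2_fun"
  shows "set fs \<subseteq> L2_fun \<Longrightarrow>
    W (fs @ (\<lambda>u. r * f u + s * g u) # gs) = r *\<^sub>R W (fs @ f # gs) + s *\<^sub>R W (fs @ g # gs)"
proof (induction fs)
  case Nil
  show ?case using field_lincomb[OF assms(1,2) W_in_D[OF assms(3)]] by simp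
next
  case (Cons h fs)
  have h: "h \<in> L2_fun" using Cons.prems by simp
  have *: "W (fs @ f # gs) \<in> D" "W (fs @ g # gs) \<in> D" using Cons.prems assms by (auto intro!: W_in_D simp del: foldr_append)
  note ** = cv.subspace_scale[OF D_subspace *(1)] cv.subspace_scale[OF D_subspace *(2)]
  have IH: "W (fs @ (\<lambda>u. r * f u + s * g u) # gs) = r *\<^sub>R W (fs @ f # gs) + s *\<^sub>R W (fs @ g # gs)"
    using Cons by simp
  show ?case
    unfolding append_Cons W_Cons IH scaleR_scaleC
    by (simp only: field_add[OF h **] field_scaleC[OF h *(1) *(1)] field_scaleC[OF h *(2) *(2)])
qed

lemma nice_dense: "closure (cspan {W fs |fs. set fs \<subseteq> nice_fun}) = UNIV"
proof -
  let ?K = "closure (cspan {W fs |fs. set fs \<subseteq> nice_fun})"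
  have nL: "nice_fun \<subseteq> L2_fun" using nice_L2 by blast
  \<comment> \<open>Letters are replaced from left to right: \<open>gs\<close> holds those that are
    already nice and varies in the induction.\<close>
  have key: "W (gs @ fs) \<in> ?K" if "set gs \<subseteq> nice_fun" "set fs \<subseteq> L2_fun" for gs fs
    using that
  proof (induction fs arbitrary: gs)
    case Nil
    then show ?case by (intro subsetD[OF closure_subset] cv.span_base) auto
  next
    case (Cons f fs)
    have f: "f \<in> L2_fun" and fs: "set fs \<subseteq> L2_fun" and gs: "set gs \<subseteq> L2_fun" using Cons.prems nL by auto
    obtain g where g: "\<And>n. g n \<in> nice_fun" "(\<lambda>n. L2norm (\<lambda>x. f x - g n x)) \<longlonglongrightarrow> 0"
      using nice_approx[OF f] by blast
    obtain K where K: "\<And>hs. set hs \<subseteq> L2_fun \<Longrightarrow> length hs = length gs + Suc (length fs) \<Longrightarrow>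
        norm (W hs) \<le> K * prod_list (map L2norm hs)" using W_bound by blast
    let ?P = "prod_list (map L2norm gs)" and ?Q = "prod_list (map L2norm fs)"
    have b: "norm (W (gs @ f # fs) - W (gs @ g n # fs)) \<le> K * (?P * (L2norm (\<lambda>x. f x - g n x) * ?Q))" for n
    proof -
      have gn: "g n \<in> L2_fun" using g(1) nL by auto
      have "W (gs @ f # fs) - W (gs @ g n # fs) = W (gs @ (\<lambda>x. f x - g n x) # fs)"
        using W_lincomb[OF f gn fs gs, of 1 "-1"] by simp
      moreover have "norm (W (gs @ (\<lambda>x. f x - g n x) # fs)) \<le> K * (?P * (L2norm (\<lambda>x. f x - g n x) * ?Q))"
        using K[of "gs @ (\<lambda>x. f x - g n x) # fs"] gs fs L2_diff[OF f gn] by simp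
      ultimately show ?thesis by metis
    qed
    have "(\<lambda>n. K * (?P * (L2norm (\<lambda>x. f x - g n x) * ?Q))) \<longlonglongrightarrow> K * (?P * (0 * ?Q))"
      by (intro tendsto_intros g)
    then have "(\<lambda>n. W (gs @ f # fs) - W (gs @ g n # fs)) \<longlonglongrightarrow> 0"
      by (intro Lim_null_comparison[OF always_eventually[OF allI[OF b]]]) simp
    from tendsto_diff[OF tendsto_const[of "W (gs @ f # fs)"] this]
    have "(\<lambda>n. W (gs @ g n # fs)) \<longlonglongrightarrow> W (gs @ f # fs)" by simp
    note lim = this
    have "W (gs @ g n # fs) \<in> ?K" for n
      using Cons.IH[of "gs @ [g n]"] Cons.prems g(1) by simp
    then show ?case by (rule closed_sequentially[OF closed_closure _ lim])
  qed
  have "D \<subseteq> ?K" unfolding field_domain_def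
  proof (rule cv.span_minimal)
    show "{W fs |fs. set fs \<subseteq> L2_fun} \<subseteq> ?K" using key[of "[]"] by auto
  qed (intro subspace_closure cv.subspace_span)
  then have "closure D \<subseteq> ?K" by (rule closure_minimal) simp
  then show ?thesis using D_dense by blast
qed

section \<open>Second quantization\<close>

lemma bounded_ops_eq_on_W:
  assumes a: "a \<in> bounded_ops" "b \<in> bounded_ops" and eq: "\<And>fs. set fs \<subseteq> L2_fun \<Longrightarrow> a (W fs) = b (W fs)"
  shows "a x = b x"
proof -
  have "x \<in> D \<Longrightarrow> a x = b x" for x
    unfolding field_domain_def
    by (induction rule: cv.span_induct_alt)
      (auto simp: bounded_ops_zero a bounded_ops_add bounded_ops_scaleC eq)
  moreover have "closed {x. a x = b x}"
    by (intro closed_Collect_eq linear_continuous_on bounded_ops_linear a)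
  ultimately have "closure D \<subseteq> {x. a x = b x}" by (intro closure_minimal) auto
  then show ?thesis using D_dense by blast
qed

text \<open>Inner products of words are functions of the Gram matrix of the letters, which
  \<open>O1\<close> preserves.\<close>

lemma second_quantization:
  assumes O1: "L2_involution O1"
  shows "\<exists>\<Gamma>. \<Gamma> \<in> bounded_ops \<and> (\<forall>fs. set fs \<subseteq> L2_fun \<longrightarrow> \<Gamma> (W fs) = W (map O1 fs)) \<and>
    (\<forall>x y. cinner (\<Gamma> x) (\<Gamma> y) = cinner x y) \<and> (\<forall>x. \<Gamma> (\<Gamma> x) = x)"
proof -
  have OL: "O1 f \<in> L2_fun" "O1 (O1 f) = f" if "f \<in> L2_fun" for f using O1 that by (auto simp: L2_involution_def)
  have Oi: "L2_inner (O1 f) (O1 g) = L2_inner f g" if "f \<in> L2_fun" "g \<in> L2_fun" for f g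
    using O1 that by (auto simp: L2_involution_def)
  let ?I = "{fs. set fs \<subseteq> L2_fun}"
  have iso: "cinner (W fs) (W gs) = cinner (W (map O1 fs)) (W (map O1 gs))" if "fs \<in> ?I" "gs \<in> ?I" for fs gs
  proof -
    let ?h = "rev fs @ gs"
    have h: "set ?h \<subseteq> L2_fun" "set (map O1 ?h) \<subseteq> L2_fun" using that OL by auto
    have nth: "?h ! (i - 1) \<in> L2_fun" if "i \<in> {1..length ?h}" for i
      by (rule subsetD[OF h(1)], rule nth_mem) (use that in auto)
    have "gram ?h i j = gram (map O1 ?h) i j" if "i \<in> {1..length ?h}" "j \<in> {1..length ?h}" for i j
    proof -
      have "i - 1 < length ?h" "j - 1 < length ?h" using that by auto
      then show ?thesis unfolding gram_def by (simp only: nth_map Oi nth that)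
    qed
    then have "pairing_sum t {1..length ?h} (gram ?h) = pairing_sum t {1..length (map O1 ?h)} (gram (map O1 ?h))"
      by (simp only: length_map) (rule pairing_sum_cong)
    then have "cinner \<Omega> (W ?h) = cinner \<Omega> (W (map O1 ?h))" by (simp only: W_moment h)
    moreover have "set (map O1 fs) \<subseteq> L2_fun" "set (map O1 gs) \<subseteq> L2_fun" using that OL by auto
    ultimately show ?thesis using that
      by (simp only: W_inner mem_Collect_eq map_append rev_map)
  qed
  have "closure (cspan (W ` ?I)) = UNIV"
    using D_dense by (simp add: field_domain_def setcompr_eq_image)
  from isometry_extension[of ?I W "\<lambda>fs. W (map O1 fs)", OF iso this]
  obtain \<Gamma> where G: "\<Gamma> \<in> bounded_ops" "\<And>fs. fs \<in> ?I \<Longrightarrow> \<Gamma> (W fs) = W (map O1 fs)"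
    "\<And>x y. cinner (\<Gamma> x) (\<Gamma> y) = cinner x y" by blast
  have "(\<Gamma> \<circ> \<Gamma>) x = id x" for x
  proof (rule bounded_ops_eq_on_W[OF bounded_ops_comp[OF G(1) G(1)] bounded_ops_id])
    fix fs assume fs: "set fs \<subseteq> L2_fun"
    then have "map O1 (map O1 fs) = fs" using OL(2) by (induction fs) auto
    moreover have "map O1 fs \<in> ?I" using fs OL by auto
    ultimately show "(\<Gamma> \<circ> \<Gamma>) (W fs) = id (W fs)"
      using G(2)[of fs] G(2)[of "map O1 fs"] fs by simp
  qed
  then show ?thesis using G by auto
qed

definition Gam :: "((real \<Rightarrow> real) \<Rightarrow> real \<Rightarrow> real) \<Rightarrow> 'h \<Rightarrow> 'h" where
  "Gam O1 = (SOME \<Gamma>. \<Gamma> \<in> bounded_ops \<and> (\<forall>fs. set fs \<subseteq> L2_fun \<longrightarrow> \<Gamma> (W fs) = W (map O1 fs)) \<and>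
    (\<forall>x y. cinner (\<Gamma> x) (\<Gamma> y) = cinner x y) \<and> (\<forall>x. \<Gamma> (\<Gamma> x) = x))"

context
  fixes O1 :: "(real \<Rightarrow> real) \<Rightarrow> real \<Rightarrow> real"
  assumes O1: "L2_involution O1"
begin

lemma Gam_bounded: "Gam O1 \<in> bounded_ops"
  and Gam_W: "set fs \<subseteq> L2_fun \<Longrightarrow> Gam O1 (W fs) = W (map O1 fs)"
  and Gam_inner: "cinner (Gam O1 x) (Gam O1 y) = cinner x y"
  and Gam_Gam: "Gam O1 (Gam O1 x) = x"
  using someI_ex[OF second_quantization[OF O1], folded Gam_def] by blast+

lemma Gam_adjoint: "adjoint_pair (Gam O1) (Gam O1)"
  unfolding adjoint_pair_def using Gam_bounded Gam_inner Gam_Gam by metis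

lemma Gam_Omega: "Gam O1 \<Omega> = \<Omega>"
  using Gam_W[of "[]"] by simp

lemma Gam_in_D_commute:
  assumes f: "f \<in> L2_fun" "AE u in lborel. O1 f u = f u" and x: "x \<in> D"
  shows "Gam O1 x \<in> D \<and> Gam O1 (\<omega> f x) = \<omega> f (Gam O1 x)"
proof -
  have OL: "O1 f \<in> L2_fun" if "f \<in> L2_fun" for f using O1 that by (auto simp: L2_involution_def)
  have "x \<in> D \<and> Gam O1 x \<in> D \<and> Gam O1 (\<omega> f x) = \<omega> f (Gam O1 x)"
    using x unfolding field_domain_def
  proof (induction rule: cv.span_induct_alt)
    case base
    then show ?case by (simp add: field_zero[OF f(1)] bounded_ops_zero[OF Gam_bounded] cv.span_zero)
  next
    case (step c b y)
    then obtain fs where fs: "b = W fs" "set fs \<subseteq> L2_fun" by blast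
    have y: "y \<in> D" "Gam O1 y \<in> D" "Gam O1 (\<omega> f y) = \<omega> f (Gam O1 y)" using step by (auto simp: field_domain_def)
    have "set (map O1 fs) \<subseteq> L2_fun" using fs OL by auto
    then have b: "b \<in> D" "Gam O1 b \<in> D" "Gam O1 b = W (map O1 fs)"
      using W_in_D fs Gam_W[OF fs(2)] by metis+
    have "Gam O1 (\<omega> f b) = \<omega> (O1 f) (Gam O1 b)"
      using Gam_W[of "f # fs"] fs f b(3) by simp
    also have "\<dots> = \<omega> f (Gam O1 b)" by (rule field_cong[OF OL[OF f(1)] f(1) b(2) f(2)])
    finally have fb: "Gam O1 (\<omega> f b) = \<omega> f (Gam O1 b)" .
    note sc = cv.subspace_scale[OF D_subspace b(1), of c] cv.subspace_scale[OF D_subspace b(2), of c]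
    have "Gam O1 (\<omega> f (c *\<^sub>C b + y)) = \<omega> f (Gam O1 (c *\<^sub>C b + y))"
      by (simp only: field_add[OF f(1) sc(1) y(1)] field_scaleC[OF f(1) b(1) b(1)]
          bounded_ops_add[OF Gam_bounded] bounded_ops_scaleC[OF Gam_bounded] fb y(3)
          field_add[OF f(1) sc(2) y(2)] field_scaleC[OF f(1) b(2) b(2)])
    moreover have "c *\<^sub>C b + y \<in> D" "Gam O1 (c *\<^sub>C b + y) \<in> D"
      by (simp_all only: bounded_ops_add[OF Gam_bounded] bounded_ops_scaleC[OF Gam_bounded])
        (intro cv.subspace_add[OF D_subspace] sc y)+
    ultimately show ?case by (simp add: field_domain_def)
  qed
  then show ?thesis by blast
qed

text \<open>Acting on both components, \<open>Gam O1\<close> preserves the closed graph, so the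
  entries of the projection onto it lie in \<open>commutant {Gam O1}\<close>. Elements of the double
  commutant commute with these entries, hence with the projection, and so preserve the graph in
  turn.\<close>

lemma affiliated_commutant_Gam:
  assumes f: "f \<in> L2_fun" "AE u in lborel. O1 f u = f u"
  shows "affiliated (closure_graph D (\<omega> f)) (commutant {Gam O1})"
proof -
  let ?G = "closure_graph D (\<omega> f)" and ?g = "\<lambda>p. (Gam O1 (fst p), Gam O1 (snd p))"
  have "cv.subspace ?G"
    by (rule closure_graph_subspace[OF D_subspace]) (use field_add[OF f(1)] field_scaleC[OF f(1)] in blast)+
  note G = closed_closure_graph[of D "\<omega> f"] this
  have "{p. ?g p \<in> ?G} = ?g -` ?G" by auto
  moreover have "closed (?g -` ?G)"
    by (rule closed_vimage[OF G(1)], intro continuous_on_Pair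
        bounded_linear.continuous_on[OF bounded_ops_linear[OF Gam_bounded]]
        continuous_on_fst continuous_on_snd continuous_on_id)
  ultimately have cl: "closed {p. ?g p \<in> ?G}" by simp
  have "{(x, \<omega> f x) |x. x \<in> D} \<subseteq> {p. ?g p \<in> ?G}"
    using Gam_in_D_commute[OF f] closure_graph_base[of _ D "\<omega> f"] by auto
  then have "?G \<subseteq> {p. ?g p \<in> ?G}"
    using cl unfolding closure_graph_def by (intro closure_minimal) (simp_all add: closure_graph_def)
  then have gG: "?g p \<in> ?G" if "p \<in> ?G" for p using that by blast
  have comm: "proj ?G (?g p) = ?g (proj ?G p)" for p
  proof (rule proj_commute[OF G, where v = ?g])
    show "cinner (?g p) r = cinner p (?g r)" for p r
      by (cases p, cases r) (simp add: adjoint_pairD[OF Gam_adjoint])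
    show "?g p \<in> ?G \<longleftrightarrow> p \<in> ?G" for p
      using gG[of p] gG[of "?g p"] by (auto simp: Gam_Gam)
  qed (auto simp: bounded_ops_diff[OF Gam_bounded] gG)
  \<comment> \<open>All four matrix entries at once: \<open>j\<close> embeds the argument as one
    component and \<open>P\<close> selects a component of the result.\<close>
  have in_comm: "(\<lambda>x. P (proj ?G (j x))) \<in> commutant {Gam O1}"
    if P: "P = fst \<or> P = snd" and j: "j = (\<lambda>x. (x, 0)) \<or> j = (\<lambda>x. (0, x))" for P and j :: "'h \<Rightarrow> 'h \<times> 'h"
  proof (rule commutantI)
    show "(\<lambda>x. P (proj ?G (j x))) \<in> bounded_ops"
    proof (rule bounded_opsI[of _ 1])
      have "j (x + y) = j x + j y" "j (c *\<^sub>C x) = c *\<^sub>C j x" for x y c using j by auto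
      then show "P (proj ?G (j (x + y))) = P (proj ?G (j x)) + P (proj ?G (j y))"
        "P (proj ?G (j (c *\<^sub>C x))) = c *\<^sub>C P (proj ?G (j x))" for x y c
        using P by (auto simp: proj_add[OF G] proj_scaleC[OF G] fst_scaleC snd_scaleC)
      fix x
      have "norm (P (proj ?G (j x))) \<le> norm (proj ?G (j x))"
        using P norm_fst_le norm_snd_le by (metis prod.collapse)
      also have "\<dots> \<le> norm (j x)" by (rule norm_proj_le[OF G])
      also have "\<dots> = norm x" using j by auto
      finally show "norm (P (proj ?G (j x))) \<le> norm x * 1" by simp
    qed
    have "j (Gam O1 x) = ?g (j x)" for x using j by (auto simp: bounded_ops_zero[OF Gam_bounded])
    then show "a (P (proj ?G (j x))) = P (proj ?G (j (a x)))" if "a \<in> {Gam O1}" for a x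
      using that comm[of "j x"] P by auto
  qed
  show ?thesis
    unfolding affiliated_def
  proof (intro ballI allI impI, clarify)
    fix u v x y
    assume u: "u \<in> commutant (commutant {Gam O1})" and xy: "(x, y) \<in> ?G"
    have ub: "u \<in> bounded_ops" using u commutant_bounded by blast
    have ju: "proj ?G (j (u x)) = (u (fst (proj ?G (j x))), u (snd (proj ?G (j x))))"
      if j: "j = (\<lambda>x. (x, 0)) \<or> j = (\<lambda>x. (0, x))" for j x
      using commutant_mem[OF u in_comm[OF _ j, of fst]] commutant_mem[OF u in_comm[OF _ j, of snd]]
      by (simp add: prod_eq_iff)
    have sum: "proj ?G (a, b) = proj ?G (a, 0) + proj ?G (0, b)" for a b
      using proj_add[OF G, of "(a, 0)" "(0, b)"] by simp
    have "proj ?G (u x, u y) = (u (fst (proj ?G (x, y))), u (snd (proj ?G (x, y))))"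
      unfolding sum[of "u x" "u y"] sum[of x y]
      using ju[of "\<lambda>x. (x, 0)" x] ju[of "\<lambda>x. (0, x)" y] by (simp add: bounded_ops_add[OF ub])
    also have "\<dots> = (u x, u y)" using proj_id[OF G xy] by simp
    finally show "(u x, u y) \<in> ?G" using proj_in[OF G, of "(u x, u y)"] by simp
  qed
qed

text \<open>\<open>commutant {Gam O1}\<close> is one of the algebras whose intersection is
  \<open>A I\<close>.\<close>

lemma Gam_commutes_algebra:
  assumes "fixes_supported O1 I" "a \<in> A I"
  shows "Gam O1 (a x) = a (Gam O1 x)"
proof -
  have "von_neumann_algebra (commutant {Gam O1})"
    by (rule von_neumann_commutant) (use Gam_bounded Gam_adjoint in auto)
  then have "a \<in> commutant {Gam O1}"
    using assms affiliated_commutant_Gam unfolding field_algebra_def fixes_supported_def by blast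
  then show ?thesis using commutant_mem by blast
qed

end

text \<open>A workable substitute for lying in the closure of the vectors \<open>a \<Omega>\<close>
  with \<open>a\<close> in \<open>A I\<close>: it holds for these vectors and passes to differences
  and limits.\<close>

definition fixed :: "real set \<Rightarrow> 'h \<Rightarrow> bool" where
  "fixed I x \<longleftrightarrow> (\<forall>O1. L2_involution O1 \<longrightarrow> fixes_supported O1 I \<longrightarrow> Gam O1 x = x)"

lemma fixed_algebra: "a \<in> A I \<Longrightarrow> fixed I (a \<Omega>)"
  by (simp add: fixed_def Gam_commutes_algebra Gam_Omega)

lemma fixed_diff: "fixed I x \<Longrightarrow> fixed I y \<Longrightarrow> fixed I (x - y)"
  by (simp add: fixed_def bounded_ops_diff[OF Gam_bounded])

lemma fixed_limit:
  assumes "\<And>n. fixed I (x n)" "x \<longlonglongrightarrow> y"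
  shows "fixed I y"
  unfolding fixed_def
proof (intro allI impI)
  fix O1 assume O1: "L2_involution O1" "fixes_supported O1 I"
  have "(\<lambda>n. Gam O1 (x n)) \<longlonglongrightarrow> Gam O1 y" by (rule tendsto_bounded_ops[OF Gam_bounded[OF O1(1)] assms(2)])
  then show "Gam O1 y = y"
    using assms O1 by (simp add: fixed_def LIMSEQ_unique)
qed

section \<open>Approximating the field operators\<close>

lemma field_scaled: "f \<in> L2_fun \<Longrightarrow> x \<in> D \<Longrightarrow> \<omega> (\<lambda>u. r * f u) x = r *\<^sub>R \<omega> f x"
  using field_lincomb[of f f x r 0] by simp

text \<open>Up to the factor \<open>1 / e n\<close>, the approximants are matrix entries of
  projections onto closed graphs. They are defined without reference to any algebra
  \<open>M\<close>, so that the same operators lie in every member of the intersection that defines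
  \<open>A I\<close>.\<close>

lemma field_approx:
  assumes f: "f \<in> L2_fun" "supported_in f I"
  obtains a where "\<And>n. a n \<in> A I" "\<And>x. x \<in> D \<Longrightarrow> (\<lambda>n. a n x) \<longlonglongrightarrow> \<omega> f x"
proof -
  define e where "e n = 1 / real (Suc n)" for n
  have e: "e n > 0" for n by (simp add: e_def)
  \<comment> \<open>The factor \<open>e n\<close> is put into the letter, which stays supported in
    \<open>I\<close>, so this graph is affiliated with each \<open>M\<close> by the very definition
    of \<open>A I\<close>.\<close>
  define G where "G n = closure_graph D (\<omega> (\<lambda>u. e n * f u))" for n
  define a where "a n x = complex_of_real (1 / e n) *\<^sub>C snd (proj (G n) (x, 0))" for n and x :: 'h
  have fe: "(\<lambda>u. e n * f u) \<in> L2_fun" for n by (rule L2_scale[OF f(1)])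
  have sub: "cv.subspace (G n)" for n unfolding G_def
    by (rule closure_graph_subspace[OF D_subspace]) (use field_add[OF fe] field_scaleC[OF fe] in blast)+
  have "a n \<in> A I" for n
    unfolding field_algebra_def
  proof (rule InterI, clarify)
    fix M :: "('h \<Rightarrow> 'h) set"
    assume M: "von_neumann_algebra M"
      "\<forall>f\<in>L2_fun. supported_in f I \<longrightarrow> affiliated (closure_graph D (\<omega> f)) M"
    have "supported_in (\<lambda>u. e n * f u) I"
      using f(2) unfolding supported_in_def by eventually_elim simp
    then have "affiliated (G n) M" using M(2) fe unfolding G_def by blast
    from proj_graph_mem_vN[OF M(1) _ sub this] have "(\<lambda>x. snd (proj (G n) (x, 0))) \<in> M"
      by (simp add: G_def closed_closure_graph)
    then show "a n \<in> M" unfolding a_def[abs_def] by (rule vN_scale[OF M(1)])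
  qed
  moreover have "(\<lambda>n. a n x) \<longlonglongrightarrow> \<omega> f x" if x: "x \<in> D" for x
  proof -
    have b: "norm (a n x - \<omega> f x) \<le> e n * norm (\<omega> f (\<omega> f x))" for n
      unfolding a_def G_def scaleC_of_real
      by (rule proj_graph_approx[OF D_subspace _ _ _ _ _ e x])
        (use field_add[OF f(1)] field_scaleC[OF f(1)] field_in_D[OF f(1)] field_sym[OF f(1)]
          field_scaled[OF f(1)] in blast)+
    have "e \<longlonglongrightarrow> 0" unfolding e_def[abs_def] by (rule LIMSEQ_Suc[OF lim_const_over_n])
    then have "(\<lambda>n. e n * norm (\<omega> f (\<omega> f x))) \<longlonglongrightarrow> 0 * norm (\<omega> f (\<omega> f x))" by (intro tendsto_intros)
    then have "(\<lambda>n. a n x - \<omega> f x) \<longlonglongrightarrow> 0"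
      by (intro Lim_null_comparison[OF always_eventually[OF allI[OF b]]]) simp
    then show ?thesis by (simp add: LIM_zero_iff)
  qed
  ultimately show ?thesis by (rule that)
qed

section \<open>Consequences of independence and traciality\<close>

abbreviation alg :: "('h \<Rightarrow> 'h) set" where "alg \<equiv> algebra (field_system \<Omega> \<omega>)"

lemma
  shows alg_vN: "von_neumann_algebra alg"
    and A_vN: "I \<in> intervals \<Longrightarrow> von_neumann_algebra (A I)"
    and A_alg: "I \<in> intervals \<Longrightarrow> A I \<subseteq> alg"
  using cbs by (auto simp: continuous_bernoulli_system_def field_system_def)

lemma trace: "a \<in> alg \<Longrightarrow> b \<in> alg \<Longrightarrow> cinner \<Omega> (a (b \<Omega>)) = cinner \<Omega> (b (a \<Omega>))"
  using cbs by (simp add: continuous_bernoulli_system_def faithful_normal_tracial_state_def field_system_def)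

lemma indep:
  "I \<in> intervals \<Longrightarrow> J \<in> intervals \<Longrightarrow> I \<inter> J = {} \<Longrightarrow> a \<in> A I \<Longrightarrow> b \<in> A J \<Longrightarrow>
    cinner \<Omega> (a (b \<Omega>)) = cinner \<Omega> (a \<Omega>) * cinner \<Omega> (b \<Omega>)"
  using cbs by (simp add: continuous_bernoulli_system_def field_system_def)

text \<open>By traciality the adjoint of \<open>b\<close> moves to the right end;
  \<open>a' \<circ> a\<close> then stands next to \<open>b \<circ> b'\<close>, and independence
  separates them.\<close>

lemma norm_indep:
  assumes I: "I \<in> intervals" "J \<in> intervals" "I \<inter> J = {}" and a: "a \<in> A I" and b: "b \<in> A J"
  shows "norm (a (b \<Omega>)) = norm (a \<Omega>) * norm (b \<Omega>)"
proof -
  obtain a' where a': "a' \<in> A I" "adjoint_pair a a'" using vN_adjoint[OF A_vN[OF I(1)] a] by blast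
  obtain b' where b': "b' \<in> A J" "adjoint_pair b b'" using vN_adjoint[OF A_vN[OF I(2)] b] by blast
  have aa: "a' \<circ> a \<in> A I" and bb: "b \<circ> b' \<in> A J"
    by (intro vN_comp[OF A_vN[OF I(1)]] vN_comp[OF A_vN[OF I(2)]] a b a' b')+
  note al = A_alg[OF I(1), THEN subsetD] A_alg[OF I(2), THEN subsetD]
  have "cinner (a (b \<Omega>)) (a (b \<Omega>)) = cinner \<Omega> (b' ((a' \<circ> a \<circ> b) \<Omega>))"
    by (simp add: adjoint_pairD[OF a'(2)] adjoint_pairD[OF b'(2)])
  also have "\<dots> = cinner \<Omega> ((a' \<circ> a \<circ> b) (b' \<Omega>))"
    by (rule trace) (intro vN_comp[OF alg_vN] al aa[THEN al(1)] b b')+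
  also have "\<dots> = cinner \<Omega> ((a' \<circ> a) \<Omega>) * cinner \<Omega> ((b \<circ> b') \<Omega>)"
    using indep[OF I aa bb] by simp
  also have "cinner \<Omega> ((b \<circ> b') \<Omega>) = cinner \<Omega> (b' (b \<Omega>))"
    using trace[OF al(2)[OF b] al(2)[OF b'(1)]] by simp
  also have "\<dots> = cinner (b \<Omega>) (b \<Omega>)" by (simp add: adjoint_pairD[OF b'(2)])
  also have "cinner \<Omega> ((a' \<circ> a) \<Omega>) = cinner (a \<Omega>) (a \<Omega>)" by (simp add: adjoint_pairD[OF a'(2)])
  finally have "complex_of_real ((norm (a (b \<Omega>)))\<^sup>2) = complex_of_real ((norm (a \<Omega>) * norm (b \<Omega>))\<^sup>2)"
    by (simp only: cinner_self power_mult_distrib of_real_mult)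
  then have "(norm (a (b \<Omega>)))\<^sup>2 = (norm (a \<Omega>) * norm (b \<Omega>))\<^sup>2" using of_real_eq_iff by blast
  then show ?thesis by (rule power2_eq_imp_eq) auto
qed

text \<open>After inserting \<open>c (b \<Omega>)\<close>, both differences are again products of
  elements of the two algebras, so \<open>norm_indep\<close> applies and no operator norm
  enters.\<close>

lemma norm_indep_diff:
  assumes I: "I \<in> intervals" "J \<in> intervals" "I \<inter> J = {}"
    and a: "a \<in> A I" "c \<in> A I" and b: "b \<in> A J" "d \<in> A J"
  shows "norm (a (b \<Omega>) - c (d \<Omega>)) \<le> norm (a \<Omega> - c \<Omega>) * norm (b \<Omega>) + norm (c \<Omega>) * norm (b \<Omega> - d \<Omega>)"
proof -
  have c: "c \<in> bounded_ops" using vN_bounded[OF A_vN[OF I(1)]] a by blast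
  have "a (b \<Omega>) - c (d \<Omega>) = (a (b \<Omega>) - c (b \<Omega>)) + c (b \<Omega> - d \<Omega>)"
    by (simp add: bounded_ops_diff[OF c])
  also have "norm \<dots> \<le> norm (a (b \<Omega>) - c (b \<Omega>)) + norm (c (b \<Omega> - d \<Omega>))" by (rule norm_triangle_ineq)
  also have "norm (a (b \<Omega>) - c (b \<Omega>)) = norm (a \<Omega> - c \<Omega>) * norm (b \<Omega>)"
    by (rule norm_indep[OF I vN_diff[OF A_vN[OF I(1)] a] b(1)])
  also have "norm (c (b \<Omega> - d \<Omega>)) = norm (c \<Omega>) * norm (b \<Omega> - d \<Omega>)"
    by (rule norm_indep[OF I a(2) vN_diff[OF A_vN[OF I(2)] b]])
  finally show ?thesis .
qed

text \<open>Independence makes the product of two approximating sequences converge, although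
  the approximating operators need not be uniformly bounded.\<close>

lemma product_limit:
  assumes I: "I \<in> intervals" "J \<in> intervals" "I \<inter> J = {}"
    and a: "\<And>n. a n \<in> A I" and b: "\<And>n. b n \<in> A J"
    and bl: "(\<lambda>n. b n \<Omega>) \<longlonglongrightarrow> y" and al: "(\<lambda>n. a n \<Omega>) \<longlonglongrightarrow> x" and ay: "(\<lambda>n. a n y) \<longlonglongrightarrow> z"
  shows "(\<lambda>n. a n (b n \<Omega>)) \<longlonglongrightarrow> z"
proof -
  have "norm (a n (b n \<Omega>) - a n y) \<le> norm (a n \<Omega>) * norm (b n \<Omega> - y)" for n
  proof (rule LIMSEQ_le)
    have ab: "a n \<in> bounded_ops" using vN_bounded[OF A_vN[OF I(1)]] a by blast
    show "(\<lambda>m. norm (a n (b n \<Omega>) - a n (b m \<Omega>))) \<longlonglongrightarrow> norm (a n (b n \<Omega>) - a n y)"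
      by (intro tendsto_intros tendsto_bounded_ops[OF ab] bl)
    show "(\<lambda>m. norm (a n \<Omega>) * norm (b n \<Omega> - b m \<Omega>)) \<longlonglongrightarrow> norm (a n \<Omega>) * norm (b n \<Omega> - y)"
      by (intro tendsto_intros bl)
    show "\<exists>N. \<forall>m\<ge>N. norm (a n (b n \<Omega>) - a n (b m \<Omega>)) \<le> norm (a n \<Omega>) * norm (b n \<Omega> - b m \<Omega>)"
      using norm_indep_diff[OF I a a b b, of n n n] by simp
  qed
  note bound = this
  have "(\<lambda>n. norm (a n \<Omega>) * norm (b n \<Omega> - y)) \<longlonglongrightarrow> norm x * norm (y - y)"
    by (intro tendsto_intros al bl)
  then have "(\<lambda>n. a n (b n \<Omega>) - a n y) \<longlonglongrightarrow> 0"
    by (intro Lim_null_comparison[OF always_eventually[OF allI[OF bound]]]) simp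
  from tendsto_add[OF this ay] show ?thesis by simp
qed

section \<open>Moments of orthogonal families\<close>

lemma gram_rev_cong:
  assumes "length ws = length ws'" "\<And>g h. g \<in> set (zip ws ws') \<Longrightarrow> h \<in> set (zip ws ws') \<Longrightarrow>
      L2_inner (fst g) (fst h) = L2_inner (snd g) (snd h)"
    and "i \<in> {1..length ws}" "j \<in> {1..length ws}"
  shows "gram (rev ws) i j = gram (rev ws') i j"
proof -
  let ?z = "rev (zip ws ws')"
  have z: "rev ws ! k = fst (?z ! k)" "rev ws' ! k = snd (?z ! k)" "?z ! k \<in> set (zip ws ws')"
    if "k < length ws" for k
  proof -
    have "?z = zip (rev ws) (rev ws')" by (rule zip_rev[OF assms(1), symmetric])
    with that assms(1) show "rev ws ! k = fst (?z ! k)" "rev ws' ! k = snd (?z ! k)" by simp_all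
    show "?z ! k \<in> set (zip ws ws')" using that assms(1) nth_mem[of k ?z] by simp
  qed
  have "i - 1 < length ws" "j - 1 < length ws" using assms(3,4) by auto
  then show ?thesis unfolding gram_def by (simp add: z assms(2))
qed

text \<open>For a word of square integrable letters this is \<open>cinner (W ws) \<Omega>\<close>.
  The explicit form shows that it depends only on the inner products of the letters.\<close>

definition coef0 :: "(real \<Rightarrow> real) list \<Rightarrow> complex" where
  "coef0 ws = pairing_sum t {1..length ws} (gram (rev ws))"

text \<open>The letter at position \<open>k + 1\<close> of the reversed word is paired with a letter to the right of
  the whole word.\<close>

definition coef1 :: "nat \<Rightarrow> (real \<Rightarrow> real) list \<Rightarrow> complex" where
  "coef1 k ws = pairing_sum (\<lambda>\<tau>. t (insert (k + 1, length ws + 1) \<tau>)) ({1..length ws} - {k + 1}) (gram (rev ws))"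

lemma coef_cong:
  assumes "length ws = length ws'" "\<And>g h. g \<in> set (zip ws ws') \<Longrightarrow> h \<in> set (zip ws ws') \<Longrightarrow>
      L2_inner (fst g) (fst h) = L2_inner (snd g) (snd h)"
  shows "coef0 ws = coef0 ws'" "coef1 k ws = coef1 k ws'"
  unfolding coef0_def coef1_def assms(1)[symmetric]
  by (rule pairing_sum_cong, rule gram_rev_cong[OF assms]; simp)+

lemma weight_relabel:
  assumes "strict_mono_on X e" "finite X" "\<pi> \<in> pairings X"
  shows "t (map_prod e e ` \<pi>) = t \<pi>"
proof (rule weight_inj)
  show "finite \<pi>" by (rule pairings_finite[OF assms(2,3)])
  show "inj_on (map_prod e e) \<pi>"
    by (rule inj_on_subset[OF map_prod_inj_on[OF _ _] pairings_subset[OF assms(3)]])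
      (rule strict_mono_on_imp_inj_on[OF assms(1)])+
  show "crosses (map_prod e e p) (map_prod e e r) = crosses p r" if "p \<in> \<pi>" "r \<in> \<pi>" for p r
    using pairings_subset[OF assms(3)] that by (intro crosses_map_strict_mono[OF assms(1)]) auto
qed

lemma not_crosses_separated:
  "\<sigma> \<subseteq> {n + 1..} \<times> {n + 1..} \<Longrightarrow> \<tau> \<subseteq> {..n} \<times> {..n} \<Longrightarrow> p \<in> \<sigma> \<Longrightarrow> r \<in> \<tau> \<Longrightarrow> \<not> crosses p r" for n :: nat
  by (cases p; cases r) (fastforce simp: crosses_def)

text \<open>In \<open>rev ws @ vs\<close> the two words occupy consecutive blocks of positions and
  orthogonality forbids pairs between them. Pairs from different blocks do not cross, so the weight
  factors.\<close>

lemma inner_split0: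
  assumes ws: "set ws \<subseteq> L2_fun" and vs: "set vs \<subseteq> L2_fun"
    and orth: "\<And>g h. g \<in> set ws \<Longrightarrow> h \<in> set vs \<Longrightarrow> L2_inner g h = 0"
  shows "cinner (W ws) (W vs) = coef0 ws * cinner \<Omega> (W vs)"
proof -
  define n m hs where "n = length ws" and "m = length vs" and "hs = rev ws @ vs"
  define X Y where "X = {n + 1..n + m}" and "Y = {1..n}"
  have len: "length hs = n + m" by (simp add: hs_def n_def m_def)
  have nth1: "hs ! (i - 1) = rev ws ! (i - 1)" "hs ! (i - 1) \<in> set ws" if "i \<in> Y" for i
  proof -
    have i: "i - 1 < length (rev ws)" using that by (auto simp: Y_def n_def)
    then show e: "hs ! (i - 1) = rev ws ! (i - 1)" by (simp add: hs_def nth_append)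
    show "hs ! (i - 1) \<in> set ws" unfolding e using nth_mem[OF i] by simp
  qed
  have nth2: "hs ! (n + i - 1) = vs ! (i - 1)" "hs ! (n + i - 1) \<in> set vs" if "i \<in> {1..m}" for i
  proof -
    have "\<not> n + i - 1 < length (rev ws)" "n + i - 1 - length (rev ws) = i - 1" and i: "i - 1 < length vs"
      using that by (auto simp: n_def m_def)
    then show e: "hs ! (n + i - 1) = vs ! (i - 1)" by (simp only: hs_def nth_append if_False)
    show "hs ! (n + i - 1) \<in> set vs" unfolding e using nth_mem[OF i] .
  qed
  have X: "X = (+) n ` {1..m}" by (auto simp: X_def)
  have sm: "strict_mono_on {1..m} ((+) n)" by (auto simp: strict_mono_on_def)
  have "cinner (W ws) (W vs) = pairing_sum t (X \<union> Y) (gram hs)"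
  proof -
    have "set hs \<subseteq> L2_fun" using ws vs by (simp add: hs_def)
    moreover have "{1..n + m} = X \<union> Y" by (auto simp: X_def Y_def)
    ultimately show ?thesis using W_inner[OF ws vs] W_moment[of hs] len by (simp add: hs_def)
  qed
  also have "\<dots> = pairing_sum t X (gram hs) * pairing_sum t Y (gram hs)"
  proof (rule pairing_sum_Un)
    fix a b assume "a \<in> X" "b \<in> Y"
    then obtain i where "i \<in> {1..m}" "a = n + i" unfolding X by blast
    then have "L2_inner (hs ! (b - 1)) (hs ! (a - 1)) = 0"
      using nth1(2)[OF \<open>b \<in> Y\<close>] nth2(2) orth by blast
    then show "gram hs a b = 0 \<and> gram hs b a = 0" by (simp add: gram_def L2_inner_commute)
  next
    fix \<sigma> \<tau> assume p: "\<sigma> \<in> pairings X" "\<tau> \<in> pairings Y"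
    note s = pairings_subset[OF p(1)] pairings_subset[OF p(2)]
    show "t (\<sigma> \<union> \<tau>) = t \<sigma> * t \<tau>"
    proof (rule weight_Un)
      show "finite \<sigma>" by (rule pairings_finite[OF _ p(1)]) (simp add: X_def)
      show "finite \<tau>" by (rule pairings_finite[OF _ p(2)]) (simp add: Y_def)
      have "X \<inter> Y = {}" by (auto simp: X_def Y_def)
      then show "\<sigma> \<inter> \<tau> = {}" using s by blast
      show "\<not> crosses a b" if "a \<in> \<sigma>" "b \<in> \<tau>" for a b
        by (rule not_crosses_separated[OF _ _ that, of n]) (use s in \<open>auto simp: X_def Y_def\<close>)
    qed
  qed (auto simp: X_def Y_def)
  also have "pairing_sum t Y (gram hs) = coef0 ws"
    unfolding coef0_def n_def[symmetric] Y_def[symmetric]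
    by (rule pairing_sum_cong) (simp only: gram_def nth1(1))
  also have "pairing_sum t X (gram hs) = pairing_sum t {1..m} (\<lambda>i j. gram hs (n + i) (n + j))"
    unfolding X by (rule pairing_sum_image[OF sm]) (rule weight_relabel[OF sm], auto)
  also have "\<dots> = pairing_sum t {1..m} (gram vs)"
    by (rule pairing_sum_cong) (simp only: gram_def nth2)
  also have "\<dots> = cinner \<Omega> (W vs)" by (simp add: W_moment[OF vs] m_def)
  finally show ?thesis by simp
qed

text \<open>Only \<open>f\<close> can be paired across. Its pair is the single vertex common to the
  crossing graphs of the two sides, so the weight factors over them; the sum over the right side is
  the moment of \<open>f # vs\<close>.\<close>

lemma inner_split1:
  assumes ws: "ws = gl @ f # gr" "set ws \<subseteq> L2_fun" and vs: "set vs \<subseteq> L2_fun"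
    and orth: "\<And>g h. g \<in> set gl \<union> set gr \<Longrightarrow> h \<in> insert f (set vs) \<Longrightarrow> L2_inner g h = 0"
  shows "cinner (W ws) (W vs) = coef1 (length gr) ws * cinner (\<omega> f \<Omega>) (W vs)"
proof -
  \<comment> \<open>\<open>l\<close> is the position of \<open>f\<close>, counted from 1, in the
    reversed word, where the letters of \<open>gr\<close> precede it.\<close>
  define n m hs l where "n = length ws" and "m = length vs" and "hs = rev ws @ vs" and "l = length gr + 1"
  define X Y where "X = insert l {n + 1..n + m}" and "Y = {1..n} - {l}"
  \<comment> \<open>Increasing enumeration of \<open>X\<close> by the positions of
    \<open>f # vs\<close>: \<open>f\<close> sits at \<open>l\<close>, and letter
    \<open>i - 1\<close> of \<open>vs\<close> at \<open>n + i - 1\<close>.\<close>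
  define e where "e i = (if i \<le> 1 then l else n + i - 1)" for i
  have l: "1 \<le> l" "l \<le> n" by (auto simp: l_def n_def ws)
  have f: "f \<in> L2_fun" using ws by auto
  have len: "length hs = n + m" by (simp add: hs_def n_def m_def)
  have rws: "rev ws = rev gr @ f # rev gl" by (simp add: ws(1))
  have nth1: "hs ! (i - 1) = rev ws ! (i - 1)" "hs ! (i - 1) \<in> set gl \<union> set gr" if "i \<in> Y" for i
  proof -
    have i: "i - 1 < length (rev ws)" "i - 1 \<noteq> length gr" "i \<ge> 1" using that by (auto simp: Y_def n_def l_def)
    then show e: "hs ! (i - 1) = rev ws ! (i - 1)" by (simp add: hs_def nth_append)
    show "hs ! (i - 1) \<in> set gl \<union> set gr"
    proof (cases "i - 1 < length gr")
      case True
      then have "rev ws ! (i - 1) = rev gr ! (i - 1)" by (simp add: rws nth_append)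
      moreover have "rev gr ! (i - 1) \<in> set (rev gr)" using True by (intro nth_mem) simp
      ultimately show ?thesis unfolding e by simp
    next
      case False
      define k where "k = i - 1 - length gr - 1"
      have k: "i - 1 = length gr + Suc k" "k < length gl" using False i ws(1) by (auto simp: k_def)
      then have "rev ws ! (i - 1) = rev gl ! k" by (simp add: rws nth_append)
      moreover have "rev gl ! k \<in> set (rev gl)" using k by (intro nth_mem) simp
      ultimately show ?thesis unfolding e by simp
    qed
  qed
  have nth2: "hs ! (e i - 1) = (f # vs) ! (i - 1)" if "i \<in> {1..m + 1}" for i
  proof (cases "i = 1")
    case True
    have "hs ! (length gr) = f" by (simp add: hs_def rws nth_append)
    then show ?thesis using True by (simp add: e_def l_def)
  next
    case False
    define k where "k = i - 2"
    have k: "i = k + 2" using that False by (auto simp: k_def)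
    have "hs ! (length (rev ws) + k) = vs ! k" unfolding hs_def by (rule nth_append_length_plus)
    then show ?thesis by (simp add: e_def k n_def)
  qed
  have nth2': "hs ! (e i - 1) \<in> insert f (set vs)" if "i \<in> {1..m + 1}" for i
    using nth2[OF that] nth_mem[of "i - 1" "f # vs"] that by (auto simp: m_def)
  have sm: "strict_mono_on {1..m + 1} e" using l by (auto simp: strict_mono_on_def e_def)
  have X: "X = e ` {1..m + 1}"
  proof (intro set_eqI iffI)
    fix x assume "x \<in> X"
    then consider "x = l" | "x \<in> {n + 1..n + m}" by (auto simp: X_def)
    then show "x \<in> e ` {1..m + 1}"
    proof cases
      case 1
      then show ?thesis by (intro image_eqI[of _ _ 1]) (auto simp: e_def)
    next
      case 2
      then show ?thesis by (intro image_eqI[of _ _ "x - n + 1"]) (auto simp: e_def)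
    qed
  qed (auto simp: X_def e_def)
  have "cinner (W ws) (W vs) = pairing_sum t (X \<union> Y) (gram hs)"
  proof -
    have "set hs \<subseteq> L2_fun" using ws vs by (simp add: hs_def)
    moreover have "{1..n + m} = X \<union> Y" using l by (auto simp: X_def Y_def)
    ultimately show ?thesis using W_inner[OF ws(2) vs] W_moment[of hs] len by (simp add: hs_def)
  qed
  also have "\<dots> = pairing_sum t X (gram hs) * pairing_sum (\<lambda>\<tau>. t (insert (l, n + 1) \<tau>)) Y (gram hs)"
  proof (rule pairing_sum_Un)
    fix a b assume "a \<in> X" "b \<in> Y"
    then obtain i where "i \<in> {1..m + 1}" "a = e i" unfolding X by blast
    then have "L2_inner (hs ! (b - 1)) (hs ! (a - 1)) = 0"
      using nth1(2)[OF \<open>b \<in> Y\<close>] nth2' orth by blast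
    then show "gram hs a b = 0 \<and> gram hs b a = 0" by (simp add: gram_def L2_inner_commute)
  next
    fix \<sigma> \<tau> assume p: "\<sigma> \<in> pairings X" "\<tau> \<in> pairings Y"
    note s = pairings_subset[OF p(1)] pairings_subset[OF p(2)]
    have fin: "finite \<sigma>" "finite \<tau>"
      by (rule pairings_finite[OF _ p(1)], simp add: X_def) (rule pairings_finite[OF _ p(2)], simp add: Y_def)
    have lX: "l \<in> X" by (simp add: X_def)
    \<comment> \<open>\<open>r\<close> joins \<open>f\<close> to a letter of the right word. All
      other pairs of \<open>\<sigma>\<close> lie beyond \<open>n\<close> and cannot cross pairs of
      \<open>\<tau>\<close>.\<close>
    obtain r where r: "r \<in> \<sigma>" "fst r = l \<or> snd r = l" and ru: "\<And>r'. r' \<in> \<sigma> \<Longrightarrow> fst r' = l \<or> snd r' = l \<Longrightarrow> r' = r"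
      using pairings_ex1[OF p(1) lX] by (elim ex1E) blast
    have "fst r \<in> X" "snd r \<in> X" "fst r < snd r"
      using pairings_memD[OF p(1) r(1)] pairings_less[OF p(1), of "fst r" "snd r"] r(1) by auto
    then obtain b where rb: "r = (l, b)" "n < b" using r(2) l by (cases r) (auto simp: X_def)
    define \<sigma>' where "\<sigma>' = \<sigma> - {r}"
    have "\<sigma>' \<subseteq> {n + 1..} \<times> {n + 1..}"
    proof
      fix z assume z: "z \<in> \<sigma>'"
      then have "fst z \<in> X" "snd z \<in> X" "fst z \<noteq> l" "snd z \<noteq> l"
        using pairings_memD[OF p(1), of z] ru[of z] by (auto simp: \<sigma>'_def)
      then show "z \<in> {n + 1..} \<times> {n + 1..}" by (cases z) (auto simp: X_def)
    qed
    moreover have ty: "\<tau> \<subseteq> {..n} \<times> {..n}" using s by (auto simp: Y_def)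
    ultimately have nc: "\<not> crosses a b" if "a \<in> \<sigma>'" "b \<in> \<tau>" for a b
      using not_crosses_separated that by blast
    have disj: "\<sigma>' \<inter> \<tau> = {}" "r \<notin> \<sigma>' \<union> \<tau>"
      using \<open>\<sigma>' \<subseteq> _\<close> ty rb by (fastforce simp: \<sigma>'_def)+
    have "t (insert r (\<sigma>' \<union> \<tau>)) = t (insert r \<sigma>') * t (insert r \<tau>)"
      by (rule weight_insert) (use fin disj nc in \<open>auto simp: \<sigma>'_def\<close>)
    moreover have "insert r \<sigma>' = \<sigma>" using r by (auto simp: \<sigma>'_def)
    \<comment> \<open>Whether \<open>r\<close> crosses a pair inside the left word depends on
      \<open>l\<close> alone once its other end lies beyond \<open>n\<close>; so that end may be
      normalized to \<open>n + 1\<close>, which makes the coefficient independent of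
      \<open>\<sigma>\<close>.\<close>
    moreover have "t (insert (l, n + 1) \<tau>) = t (insert r \<tau>)"
    proof -
      define h where "h z = (if z = r then (l, n + 1) else z)" for z :: "nat \<times> nat"
      have rt: "r \<notin> \<tau>" "(l, n + 1) \<notin> \<tau>" using disj ty by auto
      have h: "h r = (l, n + 1)" "\<And>z. z \<in> \<tau> \<Longrightarrow> h z = z" using rt by (auto simp: h_def)
      have c: "crosses (l, n + 1) z = crosses r z" "crosses z (l, n + 1) = crosses z r" if "z \<in> \<tau>" for z
        using subsetD[OF ty that] rb by (cases z, auto simp: crosses_def)+
      have "h ` insert r \<tau> = insert (l, n + 1) \<tau>" using h by (auto simp: image_iff)
      moreover have "t (h ` insert r \<tau>) = t (insert r \<tau>)"
      proof (rule weight_inj)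
        show "inj_on h (insert r \<tau>)" using h rt by (auto simp: inj_on_def)
        show "crosses (h a) (h b) = crosses a b" if "a \<in> insert r \<tau>" "b \<in> insert r \<tau>" for a b
          using that h c crosses_irrefl by (metis insertE)
      qed (use fin in auto)
      ultimately show ?thesis by simp
    qed
    ultimately show "t (\<sigma> \<union> \<tau>) = t \<sigma> * t (insert (l, n + 1) \<tau>)"
      by (metis Un_insert_left)
  qed (auto simp: X_def Y_def)
  also have "pairing_sum (\<lambda>\<tau>. t (insert (l, n + 1) \<tau>)) Y (gram hs) = coef1 (length gr) ws"
    unfolding coef1_def n_def[symmetric] l_def[symmetric] Y_def[symmetric]
    by (rule pairing_sum_cong) (simp only: gram_def nth1(1))
  also have "pairing_sum t X (gram hs) = pairing_sum t {1..m + 1} (\<lambda>i j. gram hs (e i) (e j))"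
    unfolding X by (rule pairing_sum_image[OF sm]) (rule weight_relabel[OF sm], auto)
  also have "\<dots> = pairing_sum t {1..m + 1} (gram (f # vs))"
    by (rule pairing_sum_cong) (simp only: gram_def nth2)
  also have "\<dots> = cinner \<Omega> (W (f # vs))"
    using vs f W_moment[of "f # vs"] by (simp add: m_def)
  also have "\<dots> = cinner (\<omega> f \<Omega>) (W vs)"
    using field_sym[OF f Omega_in_D W_in_D[OF vs]] by simp
  finally show ?thesis by simp
qed

lemma one_point: "f \<in> L2_fun \<Longrightarrow> cinner \<Omega> (\<omega> f \<Omega>) = 0"
  using W_moment[of "[f]"] by (simp add: pairing_sum_singleton)

lemma two_point:
  assumes "f \<in> L2_fun" "g \<in> L2_fun"
  shows "cinner (\<omega> f \<Omega>) (\<omega> g \<Omega>) = complex_of_real (L2_inner f g)"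
proof -
  have "cinner (\<omega> f \<Omega>) (\<omega> g \<Omega>) = cinner \<Omega> (W [f, g])"
    using W_inner[of "[f]" "[g]"] assms by simp
  also have "\<dots> = pairing_sum t {1, 2} (gram [f, g])"
    using W_moment[of "[f, g]"] assms by (simp add: numeral_2_eq_2 atLeastAtMostSuc_conv insert_commute)
  also have "\<dots> = complex_of_real (L2_inner f g)"
    by (simp add: pairing_sum_doubleton weight_singleton gram_def)
  finally show ?thesis .
qed

text \<open>The letters read \<open>f\<close>, \<open>g\<close>, \<open>f'\<close>,
  \<open>g'\<close>; among the three pair partitions of four positions only the crossing one joins
  no letter on \<open>I\<close> to a letter on \<open>J\<close>.\<close>

lemma four_point:
  assumes L: "f \<in> L2_fun" "f' \<in> L2_fun" "g \<in> L2_fun" "g' \<in> L2_fun"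
    and supp: "supported_in f I" "supported_in f' I" "supported_in g J" "supported_in g' J" "I \<inter> J = {}"
  shows "cinner (\<omega> g (\<omega> f \<Omega>)) (\<omega> f' (\<omega> g' \<Omega>)) = complex_of_real (q * L2_inner f f' * L2_inner g g')"
proof -
  have orth: "L2_inner h k = 0" "L2_inner k h = 0" if "h \<in> {f, f'}" "k \<in> {g, g'}" for h k
    using that supp L2_inner_disjoint[of h I k J] by (auto simp: L2_inner_commute[of k h])
  let ?h = "[f, g, f', g']"
  have "cinner (\<omega> g (\<omega> f \<Omega>)) (\<omega> f' (\<omega> g' \<Omega>)) = cinner \<Omega> (W ?h)"
    using W_inner[of "[g, f]" "[f', g']"] L by simp
  also have "\<dots> = pairing_sum t ({1, 3} \<union> {2, 4}) (gram ?h)"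
  proof -
    have "cinner \<Omega> (W ?h) = pairing_sum t {1..length ?h} (gram ?h)"
      by (rule W_moment) (use L in auto)
    also have "length ?h = 4" by simp
    also have "{1..4} = {1, 3} \<union> {2, 4 :: nat}" by auto
    finally show ?thesis .
  qed
  also have "\<dots> = pairing_sum (\<lambda>_. complex_of_real q) {1, 3} (gram ?h) * pairing_sum (\<lambda>_. 1) {2, 4} (gram ?h)"
  proof (rule pairing_sum_Un)
    fix a b :: nat assume "a \<in> {1, 3}" "b \<in> {2, 4}"
    then show "gram ?h a b = 0 \<and> gram ?h b a = 0" by (auto simp: gram_def orth)
  next
    fix \<sigma> \<tau> assume "\<sigma> \<in> pairings {1, 3}" "\<tau> \<in> pairings {2, 4}"
    then have "\<sigma> \<union> \<tau> = {(1, 3), (2, 4)}" by (auto simp: pairings_doubleton)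
    moreover have "crosses (1, 3) (2, 4)" by (simp add: crosses_def)
    ultimately show "t (\<sigma> \<union> \<tau>) = complex_of_real q * 1" using weight_crossing by simp
  qed auto
  also have "\<dots> = complex_of_real (q * L2_inner f f' * L2_inner g g')"
    by (simp add: pairing_sum_doubleton gram_def)
  finally show ?thesis .
qed

section \<open>Vectors fixed by the isometries that are trivial on an interval\<close>

text \<open>\<open>O1 c\<close> moves the letters of the word to infinity as \<open>c\<close> grows, without affecting \<open>\<rho>\<close>.\<close>

lemma fixed_inner_at_top:
  fixes O1 :: "real \<Rightarrow> (real \<Rightarrow> real) \<Rightarrow> real \<Rightarrow> real"
  assumes rho: "fixed I \<rho>" and ws: "set ws \<subseteq> L2_fun"
    and O1: "\<forall>\<^sub>F c in at_top. L2_involution (O1 c) \<and> fixes_supported (O1 c) I"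
    and ev: "\<And>vs. set vs \<subseteq> nice_fun \<Longrightarrow>
      \<forall>\<^sub>F c in at_top. cinner (W (map (O1 c) ws)) (W vs) = z * cinner y (W vs)"
  shows "cinner (W ws) \<rho> = z * cinner y \<rho>"
proof -
  define S where "S = cspan {W fs |fs. set fs \<subseteq> nice_fun}"
  let ?B = "norm (W ws) + cmod z * norm y"
  \<comment> \<open>How large \<open>c\<close> has to be depends on \<open>r\<close>, but the bound
    does not involve \<open>c\<close>, because \<open>Gam (O1 c)\<close> preserves the norm of the
    word.\<close>
  have bound: "cmod (cinner (W ws) \<rho> - z * cinner y \<rho>) \<le> ?B * norm (\<rho> - r)" if r: "r \<in> S" for r
  proof -
    have "\<forall>\<^sub>F c in at_top. cinner (W (map (O1 c) ws)) r = z * cinner y r"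
      using r unfolding S_def
    proof (induction rule: cv.span_induct_alt)
      case (step a b r)
      then obtain fs where "b = W fs" "set fs \<subseteq> nice_fun" by blast
      from ev[OF this(2)] step(2) show ?case
        by eventually_elim (simp add: \<open>b = W fs\<close> cinner_simps algebra_simps)
    qed simp
    with O1 have "\<forall>\<^sub>F c in at_top. (L2_involution (O1 c) \<and> fixes_supported (O1 c) I) \<and>
        cinner (W (map (O1 c) ws)) r = z * cinner y r" by (rule eventually_conj)
    then obtain c where c: "L2_involution (O1 c)" "fixes_supported (O1 c) I"
      "cinner (W (map (O1 c) ws)) r = z * cinner y r"
      using eventually_happens[of _ "at_top :: real filter"] by (auto simp: trivial_limit_at_top_linorder)
    have g: "Gam (O1 c) \<rho> = \<rho>" "Gam (O1 c) (W ws) = W (map (O1 c) ws)"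
      using rho c(1,2) Gam_W[OF c(1) ws] by (auto simp: fixed_def)
    have n: "norm (W (map (O1 c) ws)) = norm (W ws)"
      using norm_eq_if_cinner_eq[OF Gam_inner[OF c(1), of "W ws" "W ws"]] by (simp add: g)
    have "cinner (W ws) \<rho> = cinner (W (map (O1 c) ws)) \<rho>"
      using Gam_inner[OF c(1), of "W ws" \<rho>] by (simp add: g)
    then have "cinner (W ws) \<rho> - z * cinner y \<rho> = cinner (W (map (O1 c) ws)) (\<rho> - r) - z * cinner y (\<rho> - r)"
      using c(3) by (simp add: cinner_diff_right algebra_simps)
    also have "cmod \<dots> \<le> cmod (cinner (W (map (O1 c) ws)) (\<rho> - r)) + cmod (z * cinner y (\<rho> - r))"
      by (rule norm_triangle_ineq4)
    also have "\<dots> \<le> norm (W ws) * norm (\<rho> - r) + cmod z * (norm y * norm (\<rho> - r))"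
      unfolding norm_mult n[symmetric] by (intro add_mono mult_left_mono cinner_Cauchy_Schwarz) auto
    finally show ?thesis by (simp add: algebra_simps)
  qed
  have "\<rho> \<in> closure S" using nice_dense by (simp add: S_def)
  then obtain r where r: "\<And>n. r n \<in> S" "r \<longlonglongrightarrow> \<rho>" unfolding closure_sequential by auto
  have "(\<lambda>n. ?B * norm (\<rho> - r n)) \<longlonglongrightarrow> ?B * norm (\<rho> - \<rho>)" by (intro tendsto_intros r)
  then have "cmod (cinner (W ws) \<rho> - z * cinner y \<rho>) \<le> ?B * norm (\<rho> - \<rho>)"
    by (rule LIMSEQ_le_const) (use bound[OF r(1)] in auto)
  then show ?thesis by simp
qed

text \<open>For \<open>c > 2 * R\<close> the set is disjoint from its translate, and for
  \<open>c > R + u\<close> the translate also misses the interval, which was removed from the set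
  itself.\<close>

lemma swap_far_involution:
  "\<forall>\<^sub>F c in at_top. L2_involution (swap_with ({- R..R} - {s..<u}) c) \<and>
    fixes_supported (swap_with ({- R..R} - {s..<u}) c) {s..<u}"
  using eventually_gt_at_top[of "2 * R"] eventually_gt_at_top[of "R + u"]
proof eventually_elim
  case (elim c)
  let ?B = "{- R..R} - {s..<u}"
  have meas: "?B \<in> sets borel" by simp
  have d: "x - c \<notin> ?B" if "x \<in> ?B" for x using that elim(1) by auto
  show ?case
    using swap_involution[OF meas d] swap_fixes[OF meas d, of "{s..<u}"] elim(2) by auto
qed

text \<open>The letters in \<open>G\<close> live on the set being swapped, so they are carried
  entirely to its translate, which leaves the common support of the finitely many
  \<open>vs\<close>.\<close>

lemma swap_far_orthogonal:
  assumes R: "\<And>g x. g \<in> G \<Longrightarrow> \<bar>x\<bar> > R \<Longrightarrow> g x = 0" and off: "\<And>g x. g \<in> G \<Longrightarrow> x \<in> {s..<u} \<Longrightarrow> g x = 0"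
    and vs: "finite vs" "vs \<subseteq> nice_fun"
  shows "\<forall>\<^sub>F c in at_top. \<forall>g\<in>G. \<forall>v\<in>vs. L2_inner (swap_with ({- R..R} - {s..<u}) c g) v = 0"
proof -
  let ?B = "{- R..R} - {s..<u}"
  obtain R' where R': "\<And>f x. f \<in> vs \<Longrightarrow> \<bar>x\<bar> > R' \<Longrightarrow> f x = 0" using nice_common_bound[OF vs] by metis
  show ?thesis
    using eventually_gt_at_top[of "2 * R"] eventually_gt_at_top[of "R + R'"]
  proof eventually_elim
    case (elim c)
    have pw: "swap_with ?B c g x * v x = 0" if "g \<in> G" "v \<in> vs" for g v x
    proof (cases "swap_point ?B c x \<in> ?B")
      case True
      then have "x - c \<in> ?B" using elim(1) by (auto simp: swap_point_def split: if_splits)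
      then have "\<bar>x\<bar> > R'" using elim(2) by auto
      then show ?thesis using R' that by simp
    next
      case False
      then have "swap_point ?B c x \<in> {s..<u} \<or> \<bar>swap_point ?B c x\<bar> > R" by (auto simp: abs_if)
      then have "g (swap_point ?B c x) = 0" using off R that(1) by blast
      then show ?thesis by (simp add: swap_with_def)
    qed
    have "L2_inner (swap_with ?B c g) v = 0" if "g \<in> G" "v \<in> vs" for g v
      unfolding L2_inner_def pw[OF that] by simp
    then show ?case by blast
  qed
qed

lemma coef_involution:
  assumes "L2_involution O1" "set ws \<subseteq> L2_fun"
  shows "coef0 (map O1 ws) = coef0 ws" "coef1 k (map O1 ws) = coef1 k ws"
proof -
  have "L2_inner (fst g) (fst h) = L2_inner (snd g) (snd h)"
    if gh: "g \<in> set (zip (map O1 ws) ws)" "h \<in> set (zip (map O1 ws) ws)" for g h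
  proof -
    have "zip (map O1 ws) ws = map (\<lambda>f. (O1 f, f)) ws" by (induction ws) auto
    then obtain g' h' where "g = (O1 g', g')" "h = (O1 h', h')" "g' \<in> set ws" "h' \<in> set ws"
      using gh by auto
    then show ?thesis using assms by (auto simp: L2_involution_def subset_iff)
  qed
  then show "coef0 (map O1 ws) = coef0 ws" "coef1 k (map O1 ws) = coef1 k ws"
    by (intro coef_cong; simp)+
qed

lemma fixed_inner0:
  assumes rho: "fixed {s..<u} \<rho>" and ws: "set ws \<subseteq> nice_fun"
    and off: "\<And>g x. g \<in> set ws \<Longrightarrow> x \<in> {s..<u} \<Longrightarrow> g x = 0"
  shows "cinner (W ws) \<rho> = coef0 ws * cinner \<Omega> \<rho>"
proof -
  have nL: "set fs \<subseteq> L2_fun" if "set fs \<subseteq> nice_fun" for fs using that nice_L2 by blast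
  obtain R where R: "\<And>f x. f \<in> set ws \<Longrightarrow> \<bar>x\<bar> > R \<Longrightarrow> f x = 0"
    using nice_common_bound[OF finite_set ws] by metis
  let ?O = "swap_with ({- R..R} - {s..<u})"
  show ?thesis
  proof (rule fixed_inner_at_top[OF rho nL[OF ws] swap_far_involution[of R s u]])
    fix vs assume vs: "set vs \<subseteq> nice_fun"
    have "\<forall>\<^sub>F c in at_top. \<forall>g\<in>set ws. \<forall>v\<in>set vs. L2_inner (?O c g) v = 0"
      by (rule swap_far_orthogonal) (use R off vs in auto)
    then show "\<forall>\<^sub>F c in at_top. cinner (W (map (?O c) ws)) (W vs) = coef0 ws * cinner \<Omega> (W vs)"
      using swap_far_involution[of R s u]
    proof eventually_elim
      case (elim c)
      then have inv: "L2_involution (?O c)" by simp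
      then have "set (map (?O c) ws) \<subseteq> L2_fun" using nL[OF ws] by (auto simp: L2_involution_def)
      then have "cinner (W (map (?O c) ws)) (W vs) = coef0 (map (?O c) ws) * cinner \<Omega> (W vs)"
        by (rule inner_split0[OF _ nL[OF vs]]) (use elim(1) in auto)
      then show ?case by (simp only: coef_involution[OF inv nL[OF ws]])
    qed
  qed
qed

text \<open>The letter on the interval stays while the others escape from any given
  \<open>vs\<close>, so \<open>inner_split1\<close> applies; its coefficient does not change with
  \<open>c\<close>, since moving the letters preserves their Gram matrix.\<close>

lemma fixed_inner1:
  assumes rho: "fixed {s..<u} \<rho>" and ws: "ws = gl @ f # gr" "set ws \<subseteq> nice_fun"
    and off: "\<And>g x. g \<in> set gl \<union> set gr \<Longrightarrow> x \<in> {s..<u} \<Longrightarrow> g x = 0"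
    and f0: "\<And>x. x \<notin> {s..<u} \<Longrightarrow> f x = 0"
  shows "cinner (W ws) \<rho> = coef1 (length gr) ws * cinner (\<omega> f \<Omega>) \<rho>"
proof -
  have nL: "set fs \<subseteq> L2_fun" if "set fs \<subseteq> nice_fun" for fs using that nice_L2 by blast
  have f: "f \<in> L2_fun" using nL[OF ws(2)] ws(1) by simp
  have fs: "supported_in f {s..<u}" using f0 by (simp add: supported_in_def)
  obtain R where R: "\<And>f x. f \<in> set ws \<Longrightarrow> \<bar>x\<bar> > R \<Longrightarrow> f x = 0"
    using nice_common_bound[OF finite_set ws(2)] by metis
  let ?O = "swap_with ({- R..R} - {s..<u})"
  show ?thesis
  proof (rule fixed_inner_at_top[OF rho nL[OF ws(2)] swap_far_involution[of R s u]])
    fix vs assume vs: "set vs \<subseteq> nice_fun"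
    have "set gl \<union> set gr \<subseteq> set ws" using ws(1) by auto
    then have R': "\<And>f x. f \<in> set gl \<union> set gr \<Longrightarrow> \<bar>x\<bar> > R \<Longrightarrow> f x = 0" using R by blast
    have "\<forall>\<^sub>F c in at_top. \<forall>g\<in>set gl \<union> set gr. \<forall>v\<in>set vs. L2_inner (?O c g) v = 0"
      by (rule swap_far_orthogonal) (use R' off vs in blast)+
    then show "\<forall>\<^sub>F c in at_top. cinner (W (map (?O c) ws)) (W vs) =
        coef1 (length gr) ws * cinner (\<omega> f \<Omega>) (W vs)"
      using swap_far_involution[of R s u]
    proof eventually_elim
      case (elim c)
      let ?P = "?O c"
      have inv: "L2_involution ?P" using elim by simp
      have OL: "?P h \<in> L2_fun" if "h \<in> L2_fun" for h using inv that by (auto simp: L2_involution_def)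
      have s: "set (map ?P ws) \<subseteq> L2_fun" using nL[OF ws(2)] OL by auto
      have e: "map ?P ws = map ?P gl @ ?P f # map ?P gr" by (simp add: ws(1))
      have "cinner (W (map ?P ws)) (W vs) = coef1 (length (map ?P gr)) (map ?P ws) * cinner (\<omega> (?P f) \<Omega>) (W vs)"
      proof (rule inner_split1[OF e s nL[OF vs]])
        fix g h assume "g \<in> set (map ?P gl) \<union> set (map ?P gr)" and h: "h \<in> insert (?P f) (set vs)"
        then obtain g' where g': "g = ?P g'" "g' \<in> set gl \<union> set gr" by auto
        show "L2_inner g h = 0"
        proof (cases "h = ?P f")
          case True
          have "g' \<in> L2_fun" using g'(2) nL[OF ws(2)] ws(1) by auto
          then have "L2_inner g h = L2_inner g' f" using inv f by (simp add: g' True L2_involution_def)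
          also have "\<dots> = 0"
          proof -
            have "g' x * f x = 0" for x using off[OF g'(2), of x] f0[of x] by (cases "x \<in> {s..<u}") auto
            note pw = this
            show ?thesis unfolding L2_inner_def pw by simp
          qed
          finally show ?thesis .
        next
          case False
          then show ?thesis using elim(1) h g' by auto
        qed
      qed
      \<comment> \<open>The swap fixes \<open>f\<close> only almost everywhere, which the field
        operators do not notice.\<close>
      also have "\<omega> (?P f) \<Omega> = \<omega> f \<Omega>"
        using elim f fs by (intro field_cong[OF OL[OF f] f Omega_in_D]) (auto simp: fixes_supported_def)
      finally show ?case by (simp only: coef_involution[OF inv nL[OF ws(2)]] length_map)
    qed
  qed
qed

section \<open>The first chaos\<close>

text \<open>Letters are real-valued, so the complex span of the one-letter vectors consists of these
  combinations.\<close>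

definition chaos_vectors :: "'h set" where
  "chaos_vectors = {\<omega> f \<Omega> + \<i> *\<^sub>C \<omega> g \<Omega> |f g. f \<in> L2_fun \<and> g \<in> L2_fun}"

definition first_chaos :: "'h set" where
  "first_chaos = closure chaos_vectors"

lemma field_chaos: "f \<in> L2_fun \<Longrightarrow> \<omega> f \<Omega> \<in> first_chaos"
proof -
  assume f: "f \<in> L2_fun"
  have "\<omega> f \<Omega> = \<omega> f \<Omega> + \<i> *\<^sub>C \<omega> (\<lambda>x. 0 * f x) \<Omega>"
    unfolding field_scaled[OF f Omega_in_D] by simp
  then have "\<omega> f \<Omega> \<in> chaos_vectors" unfolding chaos_vectors_def using f L2_scale[OF f, of 0] by blast
  then show ?thesis unfolding first_chaos_def using closure_subset by blast
qed

lemma chaos_subspace: "cv.subspace first_chaos"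
  unfolding first_chaos_def
proof (rule subspace_closure, rule cv.subspaceI)
  have L0: "(\<lambda>x. 0) \<in> L2_fun" using L2_scale[OF indicator_L2, of 0] by simp
  have "\<omega> (\<lambda>x. 0) \<Omega> = 0" using field_scaled[OF L0 Omega_in_D, of 0] by simp
  then show "0 \<in> chaos_vectors" using L0 by (force simp: chaos_vectors_def)
next
  fix x y assume "x \<in> chaos_vectors" "y \<in> chaos_vectors"
  then obtain f g f' g' where L: "f \<in> L2_fun" "g \<in> L2_fun" "f' \<in> L2_fun" "g' \<in> L2_fun"
    and xy: "x = \<omega> f \<Omega> + \<i> *\<^sub>C \<omega> g \<Omega>" "y = \<omega> f' \<Omega> + \<i> *\<^sub>C \<omega> g' \<Omega>" unfolding chaos_vectors_def by blast
  have "x + y = \<omega> (\<lambda>u. 1 * f u + 1 * f' u) \<Omega> + \<i> *\<^sub>C \<omega> (\<lambda>u. 1 * g u + 1 * g' u) \<Omega>"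
    unfolding xy field_lincomb[OF L(1,3) Omega_in_D] field_lincomb[OF L(2,4) Omega_in_D]
    by (simp add: scaleC_add_right)
  then show "x + y \<in> chaos_vectors"
    unfolding chaos_vectors_def using L2_lincomb[OF L(1,3), of 1 1] L2_lincomb[OF L(2,4), of 1 1] by blast
next
  fix c x assume "x \<in> chaos_vectors"
  then obtain f g where L: "f \<in> L2_fun" "g \<in> L2_fun"
    and x: "x = \<omega> f \<Omega> + \<i> *\<^sub>C \<omega> g \<Omega>" unfolding chaos_vectors_def by blast
  have c: "c = complex_of_real (Re c) + \<i> * complex_of_real (Im c)"
    "\<i> * c = \<i> * complex_of_real (Re c) - complex_of_real (Im c)" by (simp_all add: complex_eq_iff)
  have cv: "c *\<^sub>C v = Re c *\<^sub>R v + \<i> *\<^sub>C Im c *\<^sub>R v" for v :: 'h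
    unfolding scaleR_scaleC scaleC_scaleC scaleC_add_left[symmetric] c(1)[symmetric] ..
  have ic: "(\<i> * c) *\<^sub>C w = \<i> *\<^sub>C Re c *\<^sub>R w - Im c *\<^sub>R w" for w :: 'h
    unfolding scaleR_scaleC scaleC_scaleC cv.scale_left_diff_distrib[symmetric] c(2)[symmetric] ..
  have 1: "c *\<^sub>C v + (\<i> * c) *\<^sub>C w = (Re c *\<^sub>R v - Im c *\<^sub>R w) + \<i> *\<^sub>C (Im c *\<^sub>R v + Re c *\<^sub>R w)" for v w :: 'h
    unfolding cv ic scaleC_add_right by simp
  have "c *\<^sub>C x = \<omega> (\<lambda>u. Re c * f u + (- Im c) * g u) \<Omega> + \<i> *\<^sub>C \<omega> (\<lambda>u. Im c * f u + Re c * g u) \<Omega>"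
    unfolding x field_lincomb[OF L Omega_in_D]
    using 1[of "\<omega> f \<Omega>" "\<omega> g \<Omega>"] by (simp add: scaleC_add_right scaleC_scaleC mult.commute)
  then show "c *\<^sub>C x \<in> chaos_vectors"
    unfolding chaos_vectors_def using L2_lincomb[OF L, of "Re c" "- Im c"] L2_lincomb[OF L, of "Im c" "Re c"] by blast
qed

lemma chaos_closed: "closed first_chaos"
  by (simp add: first_chaos_def)

lemma chaos_orthogonal_Omega: "x \<in> first_chaos \<Longrightarrow> cinner \<Omega> x = 0"
proof -
  have "closed {x. cinner \<Omega> x = 0}" by (intro closed_Collect_eq continuous_intros)
  then have "first_chaos \<subseteq> {x. cinner \<Omega> x = 0}"
    unfolding first_chaos_def
    by (intro closure_minimal) (auto simp: chaos_vectors_def cinner_simps one_point)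
  then show "x \<in> first_chaos \<Longrightarrow> cinner \<Omega> x = 0" by blast
qed

lemma Gam_chaos_vector:
  assumes O1: "L2_involution O1" and L: "f \<in> L2_fun" "g \<in> L2_fun"
  shows "Gam O1 (\<omega> f \<Omega> + \<i> *\<^sub>C \<omega> g \<Omega>) = \<omega> (O1 f) \<Omega> + \<i> *\<^sub>C \<omega> (O1 g) \<Omega>"
  using Gam_W[OF O1, of "[f]"] Gam_W[OF O1, of "[g]"] L
  by (simp add: bounded_ops_add[OF Gam_bounded[OF O1]] bounded_ops_scaleC[OF Gam_bounded[OF O1]])

lemma Gam_chaos:
  assumes O1: "L2_involution O1" and x: "x \<in> first_chaos"
  shows "Gam O1 x \<in> first_chaos"
proof -
  obtain y where y: "\<And>n. y n \<in> chaos_vectors" "y \<longlonglongrightarrow> x"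
    using x unfolding first_chaos_def closure_sequential by auto
  have "Gam O1 (y n) \<in> chaos_vectors" for n
  proof -
    obtain f g where "f \<in> L2_fun" "g \<in> L2_fun" "y n = \<omega> f \<Omega> + \<i> *\<^sub>C \<omega> g \<Omega>"
      using y(1)[of n] unfolding chaos_vectors_def by blast
    moreover from this have "O1 f \<in> L2_fun" "O1 g \<in> L2_fun" using O1 by (auto simp: L2_involution_def)
    ultimately show ?thesis using Gam_chaos_vector[OF O1] unfolding chaos_vectors_def by auto
  qed
  moreover have "(\<lambda>n. Gam O1 (y n)) \<longlonglongrightarrow> Gam O1 x"
    by (rule tendsto_bounded_ops[OF Gam_bounded[OF O1] y(2)])
  ultimately show ?thesis unfolding first_chaos_def closure_sequential by (intro exI conjI allI)
qed

text \<open>Second quantizations map the first chaos onto itself, so the projection commutes with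
  them.\<close>

lemma fixed_proj_chaos:
  assumes "fixed I x"
  shows "fixed I (proj first_chaos x)"
  unfolding fixed_def
proof (intro allI impI)
  fix O1 assume O1: "L2_involution O1" "fixes_supported O1 I"
  have "proj first_chaos (Gam O1 x) = Gam O1 (proj first_chaos x)"
  proof (rule proj_commute[OF chaos_closed chaos_subspace, where v = "Gam O1"])
    show "cinner (Gam O1 x) y = cinner x (Gam O1 y)" for x y
      by (rule adjoint_pairD[OF Gam_adjoint[OF O1(1)]])
    show "Gam O1 x \<in> first_chaos \<longleftrightarrow> x \<in> first_chaos" for x
      using Gam_chaos[OF O1(1), of x] Gam_chaos[OF O1(1), of "Gam O1 x"] by (auto simp: Gam_Gam[OF O1(1)])
  qed (auto simp: bounded_ops_diff[OF Gam_bounded[OF O1(1)]] Gam_chaos[OF O1(1)])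
  then show "Gam O1 (proj first_chaos x) = proj first_chaos x" using assms O1 by (simp add: fixed_def)
qed

text \<open>Averaging an approximating sequence with its image under the second quantized
  \<open>flip_off I\<close> keeps the limit \<open>x\<close> and truncates all letters to
  \<open>I\<close>.\<close>

lemma fixed_chaos_local:
  assumes x: "x \<in> first_chaos" "fixed I x" and I: "I \<in> sets borel"
  shows "\<exists>f g. (\<forall>n::nat. f n \<in> L2_fun \<and> g n \<in> L2_fun \<and> supported_in (f n) I \<and> supported_in (g n) I) \<and>
    (\<lambda>n. \<omega> (f n) \<Omega> + \<i> *\<^sub>C \<omega> (g n) \<Omega>) \<longlonglongrightarrow> x"
proof -
  let ?F = "flip_off I"
  note F = flip_off_involution[OF I]
  have FL: "?F f \<in> L2_fun" if "f \<in> L2_fun" for f using F that by (auto simp: L2_involution_def)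
  have Fx: "Gam ?F x = x" using x(2) F flip_off_fixes by (auto simp: fixed_def)
  obtain y where y: "\<And>n. y n \<in> chaos_vectors" "y \<longlonglongrightarrow> x"
    using x(1) unfolding first_chaos_def closure_sequential by auto
  have "\<exists>f g. f \<in> L2_fun \<and> g \<in> L2_fun \<and> y n = \<omega> f \<Omega> + \<i> *\<^sub>C \<omega> g \<Omega>" for n
    using y(1)[of n] unfolding chaos_vectors_def by blast
  then obtain f g where fg: "\<And>n. f n \<in> L2_fun" "\<And>n. g n \<in> L2_fun"
    "\<And>n. y n = \<omega> (f n) \<Omega> + \<i> *\<^sub>C \<omega> (g n) \<Omega>" by metis
  have half: "\<omega> (trunc I h) \<Omega> = (1/2) *\<^sub>R (\<omega> h \<Omega> + \<omega> (?F h) \<Omega>)" if "h \<in> L2_fun" for h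
  proof -
    have "trunc I h = (\<lambda>u. (1/2) * h u + (1/2) * ?F h u)" by (auto simp: trunc_def flip_off_def)
    then show ?thesis using field_lincomb[OF that FL[OF that] Omega_in_D, of "1/2" "1/2"]
      by (simp add: scaleR_add_right)
  qed
  have "\<omega> (trunc I (f n)) \<Omega> + \<i> *\<^sub>C \<omega> (trunc I (g n)) \<Omega> = (1/2) *\<^sub>R (y n + Gam ?F (y n))" for n
    unfolding half[OF fg(1)] half[OF fg(2)] fg(3) Gam_chaos_vector[OF F fg(1,2)]
    by (simp add: scaleR_scaleC scaleC_add_right scaleC_scaleC mult.commute algebra_simps)
  moreover have "(\<lambda>n. (1/2) *\<^sub>R (y n + Gam ?F (y n))) \<longlonglongrightarrow> (1/2) *\<^sub>R (x + Gam ?F x)"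
    by (intro tendsto_intros y tendsto_bounded_ops[OF Gam_bounded[OF F]])
  moreover have "(1/2) *\<^sub>R (x + Gam ?F x) = x" by (simp add: Fx flip: scaleR_2)
  ultimately have "(\<lambda>n. \<omega> (trunc I (f n)) \<Omega> + \<i> *\<^sub>C \<omega> (trunc I (g n)) \<Omega>) \<longlonglongrightarrow> x" by simp
  then show ?thesis
    using L2_trunc[OF fg(1) I] L2_trunc[OF fg(2) I] trunc_supported
    by (intro exI[of _ "\<lambda>n. trunc I (f n)"] exI[of _ "\<lambda>n. trunc I (g n)"]) blast
qed

end

section \<open>Small inner products with words, and additive families\<close>

lemma prod_list_le_power:
  fixes L :: real
  assumes "1 \<le> L" "\<And>x. x \<in> set xs \<Longrightarrow> 0 \<le> x \<and> x \<le> L"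
  shows "0 \<le> prod_list xs \<and> prod_list xs \<le> L ^ length xs"
  using assms(2)
proof (induction xs)
  case (Cons x xs)
  then have "0 \<le> x" "x \<le> L" "0 \<le> prod_list xs" "prod_list xs \<le> L ^ length xs" by auto
  then show ?case using assms(1) by (auto intro: mult_mono)
qed simp

lemma cmod_cinner_diff_le:
  "cmod (cinner v u - cinner v' u') \<le> norm (v - v') * norm u + norm v' * norm (u - u')"
proof -
  have "cinner v u - cinner v' u' = cinner (v - v') u + cinner v' (u - u')"
    by (simp add: cinner_simps)
  then show ?thesis
    using norm_triangle_ineq[of "cinner (v - v') u" "cinner v' (u - u')"]
      cinner_Cauchy_Schwarz[of "v - v'" u] cinner_Cauchy_Schwarz[of v' "u - u'"] by simp
qed

lemma tendsto_if_close:
  fixes z z' :: "nat \<Rightarrow> 'b::real_normed_vector"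
  assumes "\<And>n. norm (z n - z' n) < e n" "e \<longlonglongrightarrow> 0" "z' \<longlonglongrightarrow> w"
  shows "z \<longlonglongrightarrow> w"
proof -
  have "(\<lambda>n. z n - z' n) \<longlonglongrightarrow> 0"
    by (rule Lim_null_comparison[OF always_eventually assms(2)]) (use assms(1) less_imp_le in blast)
  from tendsto_add[OF this assms(3)] show ?thesis by simp
qed

context gbm
begin

text \<open>Splitting each letter into its parts on and off the interval, the words with at most one
  letter on the interval do not contribute, and each remaining word contains the square of the
  square root of the length.\<close>

lemma word_bound:
  assumes fs: "set fs \<subseteq> nice_fun"
  shows "\<exists>B\<ge>0. \<forall>s u \<rho>. s < u \<longrightarrow> fixed {s..<u} \<rho> \<longrightarrow> cinner \<Omega> \<rho> = 0 \<longrightarrow>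
    (\<forall>f\<in>L2_fun. cinner (\<omega> f \<Omega>) \<rho> = 0) \<longrightarrow> cmod (cinner (W fs) \<rho>) \<le> B * (u - s) * norm \<rho>"
proof -
  define n where "n = length fs"
  obtain K where K: "\<And>f x. f \<in> set fs \<Longrightarrow> \<bar>f x\<bar> \<le> K" using nice_common_bound[OF finite_set fs] by metis
  \<comment> \<open>The summand 1 ensures \<open>1 \<le> L\<close>, so that a product of fewer than
    \<open>n\<close> norms is still at most \<open>L ^ n\<close>.\<close>
  define L where "L = 1 + (\<Sum>f\<in>set fs. L2norm f)"
  have L: "1 \<le> L" by (simp add: L_def sum_nonneg)
  have fL: "L2norm f \<le> L" if "f \<in> set fs" for f
    using member_le_sum[OF that, of L2norm] by (simp add: L_def)
  obtain Kn where Kn: "0 \<le> Kn" "\<And>ws. set ws \<subseteq> L2_fun \<Longrightarrow> length ws = n \<Longrightarrow>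
      norm (W ws) \<le> Kn * prod_list (map L2norm ws)" using W_bound by blast
  define F where "F = {f \<in> nice_fun. L2norm f \<le> L \<and> (\<forall>x. \<bar>f x\<bar> \<le> K)}"
  have fsF: "set fs \<subseteq> F" using fs fL K by (auto simp: F_def)
  \<comment> \<open>Letters are split one after another, and the expansion stops at the second
    letter on the interval. The two factors \<open>n\<close> bound the choices of the first and of
    the second such letter, \<open>K\<^sup>2\<close> comes from these two and \<open>L ^ n\<close>
    from the rest.\<close>
  define B where "B = real n * (real n * (Kn * (L ^ n * K\<^sup>2)))"
  have "0 \<le> B" using Kn(1) L by (simp add: B_def)
  moreover have "cmod (cinner (W fs) \<rho>) \<le> B * (u - s) * norm \<rho>"
    if su: "s < u" and rho: "fixed {s..<u} \<rho>" "cinner \<Omega> \<rho> = 0" and orth: "\<And>f. f \<in> L2_fun \<Longrightarrow> cinner (\<omega> f \<Omega>) \<rho> = 0"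
    for s u \<rho>
  proof -
    let ?I = "{s..<u}"
    \<comment> \<open>\<open>C\<close> contains the letters already restricted to the complement of
      the interval.\<close>
    define C where "C = {g \<in> nice_fun. L2norm g \<le> L \<and> (\<forall>x\<in>?I. g x = 0)}"
    define M where "M = Kn * (L ^ n * (K\<^sup>2 * (u - s))) * norm \<rho>"
    have M0: "0 \<le> M" using Kn(1) L su by (simp add: M_def)
    have nL: "f \<in> L2_fun" if "f \<in> nice_fun" for f using that nice_L2 by blast
    have F: "f \<in> nice_fun" "f \<in> L2_fun" "L2norm f \<le> L" if "f \<in> F" for f using that nL by (auto simp: F_def)
    have C: "f \<in> nice_fun" "f \<in> L2_fun" "L2norm f \<le> L" "x \<in> ?I \<Longrightarrow> f x = 0" if "f \<in> C" for f x
      using that nL by (auto simp: C_def)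
    have co: "trunc (- ?I) f \<in> C" if "f \<in> F" for f
      using trunc_nice[OF F(1)[OF that], of "- ?I"] L2norm_trunc_le[OF F(2)[OF that], of "- ?I"] F(3)[OF that]
      by (auto simp: C_def trunc_def)
    have tr: "trunc ?I f \<in> nice_fun" "L2norm (trunc ?I f) \<le> K * sqrt (u - s)" if "f \<in> F" for f
      using trunc_nice[OF F(1)[OF that], of ?I] L2norm_trunc_bounded[OF F(2)[OF that], of K s u] su that
      by (auto simp: F_def)
    have split: "W (ps @ f # rs) = W (ps @ trunc ?I f # rs) + W (ps @ trunc (- ?I) f # rs)"
      if "set ps \<subseteq> L2_fun" "set rs \<subseteq> L2_fun" "f \<in> F" for ps f rs
    proof -
      have "trunc ?I f \<in> L2_fun" "trunc (- ?I) f \<in> L2_fun" by (intro L2_trunc F that; simp)+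
      moreover have "f = (\<lambda>x. 1 * trunc ?I f x + 1 * trunc (- ?I) f x)" by (auto simp: trunc_def)
      ultimately show ?thesis using W_lincomb[of "trunc ?I f" "trunc (- ?I) f" rs ps 1 1] that by simp
    qed
    have two: "cmod (cinner (W (gl @ trunc ?I f # gr @ trunc ?I f' # rs)) \<rho>) \<le> M"
      if s: "set gl \<subseteq> C" "set gr \<subseteq> C" "set rs \<subseteq> F" "f \<in> F" "f' \<in> F"
        and len: "length (gl @ trunc ?I f # gr @ trunc ?I f' # rs) = n" for gl f gr f' rs
    proof -
      let ?ws = "gl @ trunc ?I f # gr @ trunc ?I f' # rs"
      let ?p = "prod_list (map L2norm (gl @ gr @ rs))"
      have "0 \<le> ?p \<and> ?p \<le> L ^ length (map L2norm (gl @ gr @ rs))"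
        by (rule prod_list_le_power[OF L]) (use s C(3) F(3) in auto)
      moreover have "L ^ length (map L2norm (gl @ gr @ rs)) \<le> L ^ n"
        using len L by (intro power_increasing) auto
      ultimately have p: "0 \<le> ?p" "?p \<le> L ^ n" by auto
      have ab: "L2norm (trunc ?I f) * L2norm (trunc ?I f') \<le> (K * sqrt (u - s)) * (K * sqrt (u - s))"
        using tr(2)[OF s(4)] tr(2)[OF s(5)] by (intro mult_mono) (auto intro: order_trans[OF L2norm_nonneg])
      have "prod_list (map L2norm ?ws) = ?p * (L2norm (trunc ?I f) * L2norm (trunc ?I f'))" by simp
      also have "\<dots> \<le> L ^ n * ((K * sqrt (u - s)) * (K * sqrt (u - s)))"
        by (rule mult_mono[OF p(2) ab]) (use L in auto)
      also have "(K * sqrt (u - s)) * (K * sqrt (u - s)) = K\<^sup>2 * (u - s)"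
        using su by (simp add: power2_eq_square algebra_simps)
      finally have "Kn * prod_list (map L2norm ?ws) \<le> Kn * (L ^ n * (K\<^sup>2 * (u - s)))"
        using Kn(1) by (rule mult_left_mono)
      moreover have "set ?ws \<subseteq> L2_fun" using s C(2) F(2) nL[OF tr(1)] by auto
      ultimately have "norm (W ?ws) \<le> Kn * (L ^ n * (K\<^sup>2 * (u - s)))" using Kn(2)[OF _ len] by (meson order_trans)
      then have "norm (W ?ws) * norm \<rho> \<le> M" unfolding M_def by (intro mult_right_mono) auto
      then show ?thesis using cinner_Cauchy_Schwarz[of "W ?ws" \<rho>] by linarith
    qed
    \<comment> \<open>The first letter on the interval is chosen; \<open>gr\<close> collects the
      restricted letters after it and \<open>rs\<close> those still to be split. If no second one is
      chosen, \<open>fixed_inner1\<close> makes the term vanish.\<close>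
    have one: "cmod (cinner (W (gl @ trunc ?I f # gr @ rs)) \<rho>) \<le> real (length rs) * M"
      if "set gl \<subseteq> C" "set gr \<subseteq> C" "set rs \<subseteq> F" "f \<in> F" "length (gl @ trunc ?I f # gr @ rs) = n" for gl f gr rs
      using that
    proof (induction rs arbitrary: gr)
      case Nil
      have "cinner (W (gl @ trunc ?I f # gr)) \<rho>
          = coef1 (length gr) (gl @ trunc ?I f # gr) * cinner (\<omega> (trunc ?I f) \<Omega>) \<rho>"
        by (rule fixed_inner1[OF rho(1) refl])
          (use Nil C(1,4) tr(1) in \<open>auto simp: trunc_def[abs_def] subset_iff\<close>)
      then show ?case using orth[OF nL[OF tr(1)[OF Nil(4)]]] by simp
    next
      case (Cons h rs)
      have h: "h \<in> F" and rs: "set rs \<subseteq> F" using Cons.prems by auto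
      have "W ((gl @ trunc ?I f # gr) @ h # rs) =
          W ((gl @ trunc ?I f # gr) @ trunc ?I h # rs) + W ((gl @ trunc ?I f # gr) @ trunc (- ?I) h # rs)"
        by (rule split[OF _ _ h]) (use Cons.prems C(2) F(2) nL[OF tr(1)] in auto)
      then have "cinner (W (gl @ trunc ?I f # gr @ h # rs)) \<rho> =
          cinner (W (gl @ trunc ?I f # gr @ trunc ?I h # rs)) \<rho> +
          cinner (W (gl @ trunc ?I f # (gr @ [trunc (- ?I) h]) @ rs)) \<rho>"
        by (simp add: cinner_add_left)
      also have "cmod \<dots> \<le> M + real (length rs) * M"
      proof (rule norm_triangle_le, rule add_mono)
        show "cmod (cinner (W (gl @ trunc ?I f # gr @ trunc ?I h # rs)) \<rho>) \<le> M"
          by (rule two) (use Cons.prems in auto)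
        show "cmod (cinner (W (gl @ trunc ?I f # (gr @ [trunc (- ?I) h]) @ rs)) \<rho>) \<le> real (length rs) * M"
          by (rule Cons.IH) (use Cons.prems co[OF h] in auto)
      qed
      finally show ?case by (simp add: algebra_simps)
    qed
    have "cmod (cinner (W (gl @ rs)) \<rho>) \<le> real (length rs) * (real n * M)"
      if "set gl \<subseteq> C" "set rs \<subseteq> F" "length (gl @ rs) = n" for gl rs
      using that
    proof (induction rs arbitrary: gl)
      case Nil
      have "cinner (W gl) \<rho> = coef0 gl * cinner \<Omega> \<rho>"
        by (rule fixed_inner0[OF rho(1)]) (use Nil C(1,4) in auto)
      then show ?case by (simp add: rho(2))
    next
      case (Cons h rs)
      have h: "h \<in> F" and rs: "set rs \<subseteq> F" using Cons.prems by auto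
      have "W (gl @ h # rs) = W (gl @ trunc ?I h # rs) + W (gl @ trunc (- ?I) h # rs)"
        by (rule split[OF _ _ h]) (use Cons.prems C(2) F(2) in auto)
      then have "cinner (W (gl @ h # rs)) \<rho> =
          cinner (W (gl @ trunc ?I h # [] @ rs)) \<rho> + cinner (W ((gl @ [trunc (- ?I) h]) @ rs)) \<rho>"
        by (simp add: cinner_add_left)
      also have "cmod \<dots> \<le> real n * M + real (length rs) * (real n * M)"
      proof (rule norm_triangle_le, rule add_mono)
        have "cmod (cinner (W (gl @ trunc ?I h # [] @ rs)) \<rho>) \<le> real (length rs) * M"
          by (rule one) (use Cons.prems in auto)
        also have "\<dots> \<le> real n * M" using Cons.prems M0 by (intro mult_right_mono) auto
        finally show "cmod (cinner (W (gl @ trunc ?I h # [] @ rs)) \<rho>) \<le> real n * M" .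
        show "cmod (cinner (W ((gl @ [trunc (- ?I) h]) @ rs)) \<rho>) \<le> real (length rs) * (real n * M)"
          by (rule Cons.IH) (use Cons.prems co[OF h] in auto)
      qed
      finally show ?case by (simp add: algebra_simps)
    qed
    from this[of "[]" fs] fsF show ?thesis by (simp add: n_def B_def M_def algebra_simps)
  qed
  ultimately show ?thesis by blast
qed

lemma additive_in_chaos:
  fixes \<xi> :: "real \<Rightarrow> real \<Rightarrow> 'h"
  assumes fx: "\<And>s u. s < u \<Longrightarrow> fixed {s..<u} (\<xi> s u)"
    and mean: "\<And>s u. s < u \<Longrightarrow> cinner \<Omega> (\<xi> s u) = 0"
    and nrm: "\<And>s u. s < u \<Longrightarrow> (norm (\<xi> s u))\<^sup>2 = u - s"
    and add: "\<And>s u v. s < u \<Longrightarrow> u < v \<Longrightarrow> \<xi> s v = \<xi> s u + \<xi> u v"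
  shows "\<xi> a (a + 1) \<in> first_chaos"
proof -
  note X = chaos_closed chaos_subspace
  let ?P = "proj first_chaos"
  \<comment> \<open>This remainder inherits additivity, as projecting is linear, and invariance, as
    projecting commutes with second quantizations.\<close>
  define r where "r s u = \<xi> s u - ?P (\<xi> s u)" for s u
  have rfix: "fixed {s..<u} (r s u)" if "s < u" for s u
    unfolding r_def by (intro fixed_diff fixed_proj_chaos fx that)
  have rmean: "cinner \<Omega> (r s u) = 0" if "s < u" for s u
    unfolding r_def using mean[OF that] chaos_orthogonal_Omega[OF proj_in[OF X]] by (simp add: cinner_diff_right)
  have rorth: "cinner (\<omega> f \<Omega>) (r s u) = 0" if "f \<in> L2_fun" for f s u
    unfolding r_def by (rule proj_orth[OF X field_chaos[OF that]])
  have rnorm: "norm (r s u) \<le> sqrt (u - s)" if "s < u" for s u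
  proof -
    have "norm (r s u) \<le> norm (\<xi> s u)" unfolding r_def by (rule norm_proj_compl_le[OF X])
    also have "\<dots> = sqrt (u - s)" by (simp flip: nrm[OF that])
    finally show ?thesis .
  qed
  have radd: "r s v = r s u + r u v" if "s < u" "u < v" for s u v
    unfolding r_def add[OF that] proj_add[OF X] by simp
  have rsum: "r a (a + real m / real N) = (\<Sum>k<m. r (a + real k / real N) (a + real (Suc k) / real N))"
    if N: "N > 0" and m: "m \<ge> 1" for N m
    using m
  proof (induction m rule: nat_induct_at_least)
    case (Suc m)
    have "r a (a + real (Suc m) / real N) =
        r a (a + real m / real N) + r (a + real m / real N) (a + real (Suc m) / real N)"
      using N Suc(1) by (intro radd) (auto simp: divide_strict_right_mono)
    then show ?case using Suc by simp
  qed simp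
  have "cinner (W fs) (r a (a + 1)) = 0" if fs: "set fs \<subseteq> nice_fun" for fs
  proof -
    obtain B where B: "0 \<le> B" "\<And>s u \<rho>. s < u \<Longrightarrow> fixed {s..<u} \<rho> \<Longrightarrow> cinner \<Omega> \<rho> = 0 \<Longrightarrow>
      (\<forall>f\<in>L2_fun. cinner (\<omega> f \<Omega>) \<rho> = 0) \<Longrightarrow> cmod (cinner (W fs) \<rho>) \<le> B * (u - s) * norm \<rho>"
      using word_bound[OF fs] by blast
    have b: "cmod (cinner (W fs) (r a (a + 1))) \<le> B * sqrt (1 / real (Suc n))" for n
    proof -
      let ?N = "Suc n"
      let ?r = "\<lambda>k. r (a + real k / real ?N) (a + real (Suc k) / real ?N)"
      have "cinner (W fs) (r a (a + 1)) = (\<Sum>k<?N. cinner (W fs) (?r k))"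
        using rsum[of ?N ?N] by (simp del: of_nat_Suc sum.lessThan_Suc add: cinner_sum_right)
      also have "cmod \<dots> \<le> (\<Sum>k<?N. B * (1 / real ?N) * sqrt (1 / real ?N))"
      proof (rule order_trans[OF norm_sum sum_mono])
        fix k
        have lt: "a + real k / real ?N < a + real (Suc k) / real ?N" by (simp add: divide_strict_right_mono)
        have e: "(a + real (Suc k) / real ?N) - (a + real k / real ?N) = 1 / real ?N"
          by (simp add: diff_divide_distrib[symmetric])
        have "cmod (cinner (W fs) (?r k)) \<le> B * (1 / real ?N) * norm (?r k)"
          using B(2)[OF lt rfix[OF lt] rmean[OF lt]] rorth unfolding e by blast
        also have "\<dots> \<le> B * (1 / real ?N) * sqrt (1 / real ?N)"
          using rnorm[OF lt] B(1) unfolding e by (intro mult_left_mono) auto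
        finally show "cmod (cinner (W fs) (?r k)) \<le> B * (1 / real ?N) * sqrt (1 / real ?N)" .
      qed
      also have "\<dots> = B * sqrt (1 / real ?N)" by (simp del: of_nat_Suc)
      finally show ?thesis .
    qed
    have "(\<lambda>n. B * sqrt (1 / real (Suc n))) \<longlonglongrightarrow> B * sqrt 0"
      by (intro tendsto_intros LIMSEQ_Suc[OF lim_const_over_n])
    then have "cmod (cinner (W fs) (r a (a + 1))) \<le> B * sqrt 0"
      by (rule LIMSEQ_le_const) (use b in blast)
    then show ?thesis by simp
  qed
  then have "cinner d (r a (a + 1)) = 0" if "d \<in> cspan {W fs |fs. set fs \<subseteq> nice_fun}" for d
    by (intro cspan_orthogonal[OF _ that]) auto
  then have "r a (a + 1) = 0" by (rule closure_span_eq_0[OF nice_dense])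
  then have "\<xi> a (a + 1) = ?P (\<xi> a (a + 1))" by (simp add: r_def)
  then show ?thesis using proj_in[OF X] by metis
qed

section \<open>The crossing moment\<close>

text \<open>The limit is conjugate-linear in the coefficients of one product and linear in those of
  the other, so complex combinations assemble to the squared norms of \<open>x\<close> and
  \<open>y\<close>.\<close>

lemma chaos_product:
  assumes I: "I \<in> intervals" "J \<in> intervals" "I \<inter> J = {}"
    and f: "f \<in> L2_fun" "f' \<in> L2_fun" "supported_in f I" "supported_in f' I"
    and g: "g \<in> L2_fun" "g' \<in> L2_fun" "supported_in g J" "supported_in g' J"
    and x: "x = \<omega> f \<Omega> + \<i> *\<^sub>C \<omega> f' \<Omega>" and y: "y = \<omega> g \<Omega> + \<i> *\<^sub>C \<omega> g' \<Omega>"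
  obtains c d where "\<And>n. c n \<in> A I" "\<And>n. d n \<in> A J" "(\<lambda>n. c n \<Omega>) \<longlonglongrightarrow> x" "(\<lambda>n. d n \<Omega>) \<longlonglongrightarrow> y"
    "(\<lambda>n. cinner (d n (c n \<Omega>)) (c n (d n \<Omega>))) \<longlonglongrightarrow> complex_of_real (q * (norm x)\<^sup>2 * (norm y)\<^sup>2)"
proof -
  obtain a where a: "\<And>n. a n \<in> A I" "\<And>z. z \<in> D \<Longrightarrow> (\<lambda>n. a n z) \<longlonglongrightarrow> \<omega> f z" using field_approx[OF f(1,3)] by metis
  obtain a' where a': "\<And>n. a' n \<in> A I" "\<And>z. z \<in> D \<Longrightarrow> (\<lambda>n. a' n z) \<longlonglongrightarrow> \<omega> f' z" using field_approx[OF f(2,4)] by metis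
  obtain b where b: "\<And>n. b n \<in> A J" "\<And>z. z \<in> D \<Longrightarrow> (\<lambda>n. b n z) \<longlonglongrightarrow> \<omega> g z" using field_approx[OF g(1,3)] by metis
  obtain b' where b': "\<And>n. b' n \<in> A J" "\<And>z. z \<in> D \<Longrightarrow> (\<lambda>n. b' n z) \<longlonglongrightarrow> \<omega> g' z" using field_approx[OF g(2,4)] by metis
  define c where "c n z = a n z + \<i> *\<^sub>C a' n z" for n z
  define d where "d n z = b n z + \<i> *\<^sub>C b' n z" for n z
  have c: "c n \<in> A I" for n
    unfolding c_def[abs_def] by (intro vN_plus[OF A_vN[OF I(1)]] vN_scale[OF A_vN[OF I(1)]] a a')
  have d: "d n \<in> A J" for n
    unfolding d_def[abs_def] by (intro vN_plus[OF A_vN[OF I(2)]] vN_scale[OF A_vN[OF I(2)]] b b')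
  have cl: "(\<lambda>n. c n z) \<longlonglongrightarrow> \<omega> f z + \<i> *\<^sub>C \<omega> f' z" if "z \<in> D" for z
    unfolding c_def by (intro tendsto_intros a(2) a'(2) that)
  have dl: "(\<lambda>n. d n z) \<longlonglongrightarrow> \<omega> g z + \<i> *\<^sub>C \<omega> g' z" if "z \<in> D" for z
    unfolding d_def by (intro tendsto_intros b(2) b'(2) that)
  note inD = field_in_D[OF f(1) Omega_in_D] field_in_D[OF f(2) Omega_in_D]
    field_in_D[OF g(1) Omega_in_D] field_in_D[OF g(2) Omega_in_D]
  note sD = cv.subspace_scale[OF D_subspace inD(2), of \<i>] cv.subspace_scale[OF D_subspace inD(4), of \<i>]
  have xD: "x \<in> D" and yD: "y \<in> D" unfolding x y by (intro cv.subspace_add[OF D_subspace] inD sD)+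
  note cx = cl[OF Omega_in_D, folded x] and dy = dl[OF Omega_in_D, folded y]
  have cd: "(\<lambda>n. c n (d n \<Omega>)) \<longlonglongrightarrow> \<omega> f y + \<i> *\<^sub>C \<omega> f' y"
    by (rule product_limit[OF I c d dy cx cl[OF yD]])
  have JI: "J \<inter> I = {}" using I(3) by blast
  have dc: "(\<lambda>n. d n (c n \<Omega>)) \<longlonglongrightarrow> \<omega> g x + \<i> *\<^sub>C \<omega> g' x"
    by (rule product_limit[OF I(2,1) JI d c cx dy dl[OF xD]])
  have fp: "cinner (\<omega> k (\<omega> h \<Omega>)) (\<omega> h' (\<omega> k' \<Omega>)) = complex_of_real (q * L2_inner h h' * L2_inner k k')"
    if "h \<in> {f, f'}" "h' \<in> {f, f'}" "k \<in> {g, g'}" "k' \<in> {g, g'}" for h h' k k'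
    by (rule four_point[where I = I and J = J]) (use that f g I in auto)
  have nx: "(norm x)\<^sup>2 = L2_inner f f + L2_inner f' f'" and ny: "(norm y)\<^sup>2 = L2_inner g g + L2_inner g' g'"
    unfolding norm_sq_cinner x y using f g
    by (simp_all add: cinner_simps two_point L2_inner_commute[of f' f] L2_inner_commute[of g' g])
  have fy: "\<omega> h y = \<omega> h (\<omega> g \<Omega>) + \<i> *\<^sub>C \<omega> h (\<omega> g' \<Omega>)" if "h \<in> L2_fun" for h
    unfolding y by (simp add: field_add[OF that inD(3) sD(2)] field_scaleC[OF that inD(4) inD(4)])
  have gx: "\<omega> h x = \<omega> h (\<omega> f \<Omega>) + \<i> *\<^sub>C \<omega> h (\<omega> f' \<Omega>)" if "h \<in> L2_fun" for h
    unfolding x by (simp add: field_add[OF that inD(1) sD(1)] field_scaleC[OF that inD(2) inD(2)])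
  have "cinner (\<omega> g x + \<i> *\<^sub>C \<omega> g' x) (\<omega> f y + \<i> *\<^sub>C \<omega> f' y) = complex_of_real (q * (norm x)\<^sup>2 * (norm y)\<^sup>2)"
    unfolding fy[OF f(1)] fy[OF f(2)] gx[OF g(1)] gx[OF g(2)] nx ny
    by (simp add: cinner_simps fp L2_inner_commute[of f' f] L2_inner_commute[of g' g] algebra_simps)
  with tendsto_cinner[OF dc cd]
  have "(\<lambda>n. cinner (d n (c n \<Omega>)) (c n (d n \<Omega>))) \<longlonglongrightarrow> complex_of_real (q * (norm x)\<^sup>2 * (norm y)\<^sup>2)" by simp
  then show ?thesis using that[of c d] c d cx dy by blast
qed

text \<open>\<open>norm_indep_diff\<close> is applied once with \<open>I\<close> before
  \<open>J\<close> and once with \<open>J\<close> before \<open>I\<close>, to control both orders of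
  the product.\<close>

lemma crossing_moment_continuous:
  assumes I: "I \<in> intervals" "J \<in> intervals" "I \<inter> J = {}"
    and mem: "\<And>n. a n \<in> A I" "\<And>n. c n \<in> A I" "\<And>n. b n \<in> A J" "\<And>n. d n \<in> A J"
    and lim: "(\<lambda>n. a n \<Omega>) \<longlonglongrightarrow> x" "(\<lambda>n. c n \<Omega>) \<longlonglongrightarrow> x" "(\<lambda>n. b n \<Omega>) \<longlonglongrightarrow> y" "(\<lambda>n. d n \<Omega>) \<longlonglongrightarrow> y"
  shows "(\<lambda>n. cinner (b n (a n \<Omega>)) (a n (b n \<Omega>)) - cinner (d n (c n \<Omega>)) (c n (d n \<Omega>))) \<longlonglongrightarrow> 0"
proof -
  have JI: "J \<inter> I = {}" using I(3) by blast
  let ?u = "\<lambda>n. norm (a n \<Omega> - c n \<Omega>) * norm (b n \<Omega>) + norm (c n \<Omega>) * norm (b n \<Omega> - d n \<Omega>)"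
  let ?v = "\<lambda>n. norm (b n \<Omega> - d n \<Omega>) * norm (a n \<Omega>) + norm (d n \<Omega>) * norm (a n \<Omega> - c n \<Omega>)"
  let ?bd = "\<lambda>n. ?v n * (norm (a n \<Omega>) * norm (b n \<Omega>)) + (norm (d n \<Omega>) * norm (c n \<Omega>)) * ?u n"
  have b: "norm (cinner (b n (a n \<Omega>)) (a n (b n \<Omega>)) - cinner (d n (c n \<Omega>)) (c n (d n \<Omega>))) \<le> ?bd n" for n
  proof -
    let ?U = "a n (b n \<Omega>)" and ?U' = "c n (d n \<Omega>)" and ?V = "b n (a n \<Omega>)" and ?V' = "d n (c n \<Omega>)"
    have dV: "norm (?V - ?V') \<le> ?v n"
      by (rule norm_indep_diff[OF I(2,1) JI, of "b n" "d n" "a n" "c n", OF mem(3) mem(4) mem(1) mem(2)])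
    have dU: "norm (?U - ?U') \<le> ?u n"
      by (rule norm_indep_diff[OF I, of "a n" "c n" "b n" "d n", OF mem])
    have "cmod (cinner ?V ?U - cinner ?V' ?U') \<le> norm (?V - ?V') * norm ?U + norm ?V' * norm (?U - ?U')"
      by (rule cmod_cinner_diff_le)
    also have "\<dots> \<le> ?v n * norm ?U + norm ?V' * ?u n"
      by (rule add_mono, rule mult_right_mono[OF dV norm_ge_zero], rule mult_left_mono[OF dU norm_ge_zero])
    also have "\<dots> = ?bd n"
      by (simp only: norm_indep[OF I mem(1) mem(3)] norm_indep[OF I(2,1) JI mem(4) mem(2)])
    finally show ?thesis .
  qed
  have "?bd \<longlonglongrightarrow> (norm (y - y) * norm x + norm y * norm (x - x)) * (norm x * norm y)
      + (norm y * norm x) * (norm (x - x) * norm y + norm x * norm (y - y))"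
    by (intro tendsto_intros lim)
  then have "?bd \<longlonglongrightarrow> 0" by simp
  then show ?thesis by (rule Lim_null_comparison[OF always_eventually[OF allI[OF b]]])
qed

text \<open>The moment is known only for approximants of one-letter vectors. A diagonal choice
  handles their limits, and \<open>crossing_moment_continuous\<close> transfers the value to the
  given sequences.\<close>

lemma chaos_crossing:
  assumes I: "I \<in> intervals" "J \<in> intervals" "I \<inter> J = {}"
    and mem: "\<And>n. a n \<in> A I" "\<And>n. b n \<in> A J"
    and lim: "(\<lambda>n. a n \<Omega>) \<longlonglongrightarrow> x" "(\<lambda>n. b n \<Omega>) \<longlonglongrightarrow> y" and xy: "x \<in> first_chaos" "y \<in> first_chaos"
  shows "(\<lambda>n. cinner (b n (a n \<Omega>)) (a n (b n \<Omega>))) \<longlonglongrightarrow> complex_of_real (q * (norm x)\<^sup>2 * (norm y)\<^sup>2)"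
proof -
  have borel: "I \<in> sets borel" "J \<in> sets borel" using I by (auto simp: intervals_def)
  have fx: "fixed I x" "fixed J y"
    using fixed_limit[OF fixed_algebra[OF mem(1)] lim(1)] fixed_limit[OF fixed_algebra[OF mem(2)] lim(2)] by auto
  obtain f f' where f: "\<And>n::nat. f n \<in> L2_fun \<and> f' n \<in> L2_fun \<and> supported_in (f n) I \<and> supported_in (f' n) I"
    "(\<lambda>n. \<omega> (f n) \<Omega> + \<i> *\<^sub>C \<omega> (f' n) \<Omega>) \<longlonglongrightarrow> x"
    using fixed_chaos_local[OF xy(1) fx(1) borel(1)] by blast
  obtain g g' where g: "\<And>n::nat. g n \<in> L2_fun \<and> g' n \<in> L2_fun \<and> supported_in (g n) J \<and> supported_in (g' n) J"
    "(\<lambda>n. \<omega> (g n) \<Omega> + \<i> *\<^sub>C \<omega> (g' n) \<Omega>) \<longlonglongrightarrow> y"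
    using fixed_chaos_local[OF xy(2) fx(2) borel(2)] by blast
  define xs where "xs n = \<omega> (f n) \<Omega> + \<i> *\<^sub>C \<omega> (f' n) \<Omega>" for n
  define ys where "ys n = \<omega> (g n) \<Omega> + \<i> *\<^sub>C \<omega> (g' n) \<Omega>" for n
  define e where "e n = 1 / real (Suc n)" for n
  have e: "e n > 0" "e \<longlonglongrightarrow> 0" for n
    unfolding e_def[abs_def] by (simp, rule LIMSEQ_Suc[OF lim_const_over_n])
  define m where "m n = complex_of_real (q * (norm (xs n))\<^sup>2 * (norm (ys n))\<^sup>2)" for n
  have "\<exists>c d. c \<in> A I \<and> d \<in> A J \<and> norm (c \<Omega> - xs n) < e n \<and> norm (d \<Omega> - ys n) < e n \<and>
      norm (cinner (d (c \<Omega>)) (c (d \<Omega>)) - m n) < e n" for n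
  proof -
    obtain c d where cd: "\<And>k. c k \<in> A I" "\<And>k. d k \<in> A J" "(\<lambda>k. c k \<Omega>) \<longlonglongrightarrow> xs n" "(\<lambda>k. d k \<Omega>) \<longlonglongrightarrow> ys n"
      "(\<lambda>k. cinner (d k (c k \<Omega>)) (c k (d k \<Omega>))) \<longlonglongrightarrow> m n"
      using chaos_product[OF I _ _ _ _ _ _ _ _ xs_def[of n] ys_def[of n]] f(1)[of n] g(1)[of n] unfolding m_def by blast
    have "\<forall>\<^sub>F k in sequentially. dist (c k \<Omega>) (xs n) < e n \<and> dist (d k \<Omega>) (ys n) < e n \<and>
        dist (cinner (d k (c k \<Omega>)) (c k (d k \<Omega>))) (m n) < e n"
      by (intro eventually_conj tendstoD cd e(1))
    then obtain k where "dist (c k \<Omega>) (xs n) < e n \<and> dist (d k \<Omega>) (ys n) < e n \<and>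
        dist (cinner (d k (c k \<Omega>)) (c k (d k \<Omega>))) (m n) < e n"
      using eventually_happens'[OF sequentially_bot] by blast
    then have w: "c k \<in> A I \<and> d k \<in> A J \<and> norm (c k \<Omega> - xs n) < e n \<and> norm (d k \<Omega> - ys n) < e n \<and>
        norm (cinner (d k (c k \<Omega>)) (c k (d k \<Omega>)) - m n) < e n"
      using cd(1,2) by (simp add: dist_norm)
    show ?thesis by (rule exI[of _ "c k"], rule exI[of _ "d k"], rule w)
  qed
  then obtain c d where cd: "\<And>n. c n \<in> A I" "\<And>n. d n \<in> A J" "\<And>n. norm (c n \<Omega> - xs n) < e n"
    "\<And>n. norm (d n \<Omega> - ys n) < e n" "\<And>n. norm (cinner (d n (c n \<Omega>)) (c n (d n \<Omega>)) - m n) < e n" by metis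

  have xl: "xs \<longlonglongrightarrow> x" and yl: "ys \<longlonglongrightarrow> y" using f(2) g(2) by (simp_all add: xs_def[abs_def] ys_def[abs_def])
  have ml: "m \<longlonglongrightarrow> complex_of_real (q * (norm x)\<^sup>2 * (norm y)\<^sup>2)"
    unfolding m_def by (intro tendsto_intros xl yl)
  have Q: "(\<lambda>n. cinner (d n (c n \<Omega>)) (c n (d n \<Omega>))) \<longlonglongrightarrow> complex_of_real (q * (norm x)\<^sup>2 * (norm y)\<^sup>2)"
    by (rule tendsto_if_close[OF cd(5) e(2) ml])
  from tendsto_add[OF crossing_moment_continuous[OF I mem(1) cd(1) mem(2) cd(2) lim(1) tendsto_if_close[OF cd(3) e(2) xl] lim(2) tendsto_if_close[OF cd(4) e(2) yl]] Q]
  show ?thesis by simp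
qed

end

section \<open>Isomorphic systems\<close>

lemma isomorphic_imp_eq:
  fixes \<Omega> :: "'h::chilbert_space" and \<Omega>' :: "'k::chilbert_space"
  assumes g1: "gbm q t \<Omega> \<omega>" and g2: "gbm q' t' \<Omega>' \<omega>'"
    and iso: "isomorphic_bernoulli_systems (field_system \<Omega> \<omega>) (field_system \<Omega>' \<omega>')"
  shows "q = q'"
proof -
  interpret G: gbm q t \<Omega> \<omega> by (rule g1)
  interpret H: gbm q' t' \<Omega>' \<omega>' by (rule g2)
  obtain \<pi> where \<pi>: "star_isomorphism G.alg H.alg \<pi>"
    and loc: "\<And>I. I \<in> intervals \<Longrightarrow> \<pi> ` G.A I = H.A I"
    and st: "\<And>a. a \<in> G.alg \<Longrightarrow> cinner \<Omega> (a \<Omega>) = cinner \<Omega>' (\<pi> a \<Omega>')"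
    using iso unfolding isomorphic_bernoulli_systems_def by (auto simp: field_system_def)
  have padd: "\<pi> (\<lambda>x. a x + b x) = (\<lambda>x. \<pi> a x + \<pi> b x)"
    and pscale: "\<pi> (\<lambda>x. c *\<^sub>C a x) = (\<lambda>x. c *\<^sub>C \<pi> a x)"
    and pcomp: "\<pi> (a \<circ> b) = \<pi> a \<circ> \<pi> b"
    and padj: "adjoint_pair a b \<Longrightarrow> adjoint_pair (\<pi> a) (\<pi> b)"
    if "a \<in> G.alg" "b \<in> G.alg" for a b c
    using \<pi> that unfolding star_isomorphism_def by blast+
  note V = G.alg_vN
  \<comment> \<open>This makes \<open>\<pi>\<close> isometric on the vectors
    \<open>a \<Omega>\<close>. The unitary it induces is never constructed; it is used through
    sequences of such vectors.\<close>
  have inner: "cinner (\<pi> a \<Omega>') (\<pi> b \<Omega>') = cinner (a \<Omega>) (b \<Omega>)" if a: "a \<in> G.alg" and b: "b \<in> G.alg" for a b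
  proof -
    obtain a' where a': "a' \<in> G.alg" "adjoint_pair a a'" using vN_adjoint[OF V a] by blast
    have "cinner (a \<Omega>) (b \<Omega>) = cinner \<Omega> ((a' \<circ> b) \<Omega>)" by (simp add: adjoint_pairD'[OF a'(2), symmetric] adjoint_pairD[OF a'(2)])
    also have "\<dots> = cinner \<Omega>' (\<pi> a' (\<pi> b \<Omega>'))" using st[OF vN_comp[OF V a'(1) b]] by (simp add: pcomp[OF a'(1) b])
    also have "\<dots> = cinner (\<pi> a \<Omega>') (\<pi> b \<Omega>')" by (simp add: adjoint_pairD[OF padj[OF a a'(1) a'(2)]])
    finally show ?thesis by simp
  qed
  have pdiff: "\<pi> (\<lambda>x. a x - b x) = (\<lambda>x. \<pi> a x - \<pi> b x)" if "a \<in> G.alg" "b \<in> G.alg" for a b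
    using padd[OF that(1) vN_scale[OF V that(2), of "-1"]] pscale[OF that(2,2), of "-1"] by simp
  have pnorm: "norm (\<pi> a \<Omega>') = norm (a \<Omega>)" if "a \<in> G.alg" for a
    by (rule norm_eq_if_cinner_eq) (rule inner[OF that that])
  have pdist: "dist (\<pi> a \<Omega>') (\<pi> b \<Omega>') = dist (a \<Omega>) (b \<Omega>)" if "a \<in> G.alg" "b \<in> G.alg" for a b
    using pnorm[OF vN_diff[OF V that]] by (simp add: pdiff[OF that] dist_norm)

  define X where "X s u = \<omega> (indicator {s..<u}) \<Omega>" for s u :: real
  have int: "{s..<u} \<in> intervals" if "s < u" for s u :: real using that by (auto simp: intervals_def)
  \<comment> \<open>The limit \<open>y\<close> plays the role of the image of \<open>X s u\<close>
    under the induced unitary.\<close>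
  have "\<exists>a y. (\<forall>n::nat. a n \<in> G.A {s..<u}) \<and> (\<lambda>n. a n \<Omega>) \<longlonglongrightarrow> X s u \<and> (\<lambda>n. \<pi> (a n) \<Omega>') \<longlonglongrightarrow> y"
    if su: "s < u" for s u
  proof -
    have "supported_in (indicator {s..<u}) {s..<u}" by (simp add: supported_in_def)
    then obtain a where a: "\<And>n. a n \<in> G.A {s..<u}" "\<And>x. x \<in> G.D \<Longrightarrow> (\<lambda>n. a n x) \<longlonglongrightarrow> \<omega> (indicator {s..<u}) x"
      using G.field_approx[OF indicator_L2] by metis
    have l: "(\<lambda>n. a n \<Omega>) \<longlonglongrightarrow> X s u" unfolding X_def by (rule a(2)[OF G.Omega_in_D])
    have aG: "a n \<in> G.alg" for n using a(1) G.A_alg[OF int[OF su]] by blast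
    have "Cauchy (\<lambda>n. \<pi> (a n) \<Omega>')"
      using LIMSEQ_imp_Cauchy[OF l] unfolding Cauchy_def by (simp add: pdist[OF aG aG])
    then obtain y where "(\<lambda>n. \<pi> (a n) \<Omega>') \<longlonglongrightarrow> y" using Cauchy_convergent convergent_def by blast
    with a(1) l show ?thesis by (intro exI[of _ a] exI[of _ y]) simp
  qed
  then obtain a \<xi> where a: "\<And>s u n. s < u \<Longrightarrow> a s u (n::nat) \<in> G.A {s..<u}"
    "\<And>s u. s < u \<Longrightarrow> (\<lambda>n. a s u n \<Omega>) \<longlonglongrightarrow> X s u" "\<And>s u. s < u \<Longrightarrow> (\<lambda>n. \<pi> (a s u n) \<Omega>') \<longlonglongrightarrow> \<xi> s u"
    by metis
  have aG: "a s u n \<in> G.alg" if "s < u" for s u n using a(1)[OF that] G.A_alg[OF int[OF that]] by blast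
  have pa: "\<pi> (a s u n) \<in> H.A {s..<u}" if "s < u" for s u n
    using a(1)[OF that] loc[OF int[OF that]] by blast
  have nX: "(norm (X s u))\<^sup>2 = u - s" if "s < u" for s u
    unfolding norm_sq_cinner X_def using that by (simp add: G.two_point[OF indicator_L2 indicator_L2] L2norm_indicator)
  have n\<xi>: "(norm (\<xi> s u))\<^sup>2 = u - s" if su: "s < u" for s u
  proof -
    have "(\<lambda>n. norm (a s u n \<Omega>)) \<longlonglongrightarrow> norm (\<xi> s u)" using tendsto_norm[OF a(3)[OF su]] by (simp add: pnorm[OF aG[OF su]])
    then have "norm (\<xi> s u) = norm (X s u)" using tendsto_norm[OF a(2)[OF su]] LIMSEQ_unique by blast
    then show ?thesis by (simp add: nX[OF su])
  qed
  have chaos: "\<xi> s (s + 1) \<in> H.first_chaos" for s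
  proof (rule H.additive_in_chaos)
    fix s u :: real assume su: "s < u"
    show "H.fixed {s..<u} (\<xi> s u)" by (rule H.fixed_limit[OF H.fixed_algebra[OF pa[OF su]] a(3)[OF su]])
    have "(\<lambda>n. cinner \<Omega> (a s u n \<Omega>)) \<longlonglongrightarrow> cinner \<Omega>' (\<xi> s u)"
      using tendsto_cinner[OF tendsto_const a(3)[OF su], of \<Omega>'] by (simp add: st[OF aG[OF su]])
    moreover have "(\<lambda>n. cinner \<Omega> (a s u n \<Omega>)) \<longlonglongrightarrow> cinner \<Omega> (X s u)" by (intro tendsto_intros a su)
    ultimately show "cinner \<Omega>' (\<xi> s u) = 0"
      using LIMSEQ_unique G.one_point[OF indicator_L2] by (fastforce simp: X_def)
    show "(norm (\<xi> s u))\<^sup>2 = u - s" by (rule n\<xi>[OF su])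
    fix v :: real assume uv: "u < v"
    have sv: "s < v" using su uv by simp
    have "(indicator {s..<v} :: real \<Rightarrow> real) = (\<lambda>x. 1 * indicator {s..<u} x + 1 * indicator {u..<v} x)"
      using su uv by (auto simp: indicator_def fun_eq_iff)
    then have Xadd: "X s v = X s u + X u v"
      unfolding X_def using G.field_lincomb[OF indicator_L2 indicator_L2 G.Omega_in_D, of 1 s u 1 u v] by simp
    \<comment> \<open>The additivity defect of the approximants: its vectors tend to 0 in the first
      system, hence by isometry also in the second.\<close>
    let ?z = "\<lambda>n x. a s v n x - (a s u n x + a u v n x)"
    have zG: "?z n \<in> G.alg" for n by (intro vN_diff[OF V] vN_plus[OF V] aG su uv sv)
    have pz: "\<pi> (?z n) \<Omega>' = \<pi> (a s v n) \<Omega>' - (\<pi> (a s u n) \<Omega>' + \<pi> (a u v n) \<Omega>')" for n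
      by (simp add: pdiff[OF aG[OF sv] vN_plus[OF V aG[OF su] aG[OF uv]]] padd[OF aG[OF su] aG[OF uv]])
    have "(\<lambda>n. norm (?z n \<Omega>)) \<longlonglongrightarrow> norm (X s v - (X s u + X u v))" by (intro tendsto_intros a su uv sv)
    moreover have "(\<lambda>n. norm (\<pi> (?z n) \<Omega>')) \<longlonglongrightarrow> norm (\<xi> s v - (\<xi> s u + \<xi> u v))"
      unfolding pz by (intro tendsto_intros a su uv sv)
    ultimately have "norm (\<xi> s v - (\<xi> s u + \<xi> u v)) = norm (X s v - (X s u + X u v))"
      unfolding pnorm[OF zG] using LIMSEQ_unique by blast
    then show "\<xi> s v = \<xi> s u + \<xi> u v" by (simp add: Xadd)
  qed

  \<comment> \<open>The end point \<open>1 + 1\<close> matches the form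
    \<open>\<xi> s (s + 1)\<close> in which membership in the first chaos is available.\<close>
  have I: "{0..<1} \<in> intervals" "{1..<1 + 1 :: real} \<in> intervals" "{0..<1} \<inter> {1..<1 + 1 :: real} = {}"
    by (auto intro: int)
  let ?a = "a 0 1" and ?b = "a 1 (1 + 1)"
  have 01: "(0::real) < 1" and 12: "(1::real) < 1 + 1" by simp_all
  have "(\<lambda>n. cinner (?b n (?a n \<Omega>)) (?a n (?b n \<Omega>))) \<longlonglongrightarrow> complex_of_real (q * (norm (X 0 1))\<^sup>2 * (norm (X 1 (1 + 1)))\<^sup>2)"
    by (rule G.chaos_crossing[OF I a(1)[OF 01] a(1)[OF 12] a(2)[OF 01] a(2)[OF 12]])
      (simp_all only: X_def G.field_chaos indicator_L2)
  moreover have "(\<lambda>n. cinner (\<pi> (?b n) (\<pi> (?a n) \<Omega>')) (\<pi> (?a n) (\<pi> (?b n) \<Omega>')))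
      \<longlonglongrightarrow> complex_of_real (q' * (norm (\<xi> 0 1))\<^sup>2 * (norm (\<xi> 1 (1 + 1)))\<^sup>2)"
    by (rule H.chaos_crossing[OF I pa[OF 01] pa[OF 12] a(3)[OF 01] a(3)[OF 12]])
      (use chaos[of 0] chaos[of 1] in simp_all)
  moreover have "cinner (\<pi> (?b n) (\<pi> (?a n) \<Omega>')) (\<pi> (?a n) (\<pi> (?b n) \<Omega>')) = cinner (?b n (?a n \<Omega>)) (?a n (?b n \<Omega>))" for n
    using inner[OF vN_comp[OF V aG[OF 12] aG[OF 01]] vN_comp[OF V aG[OF 01] aG[OF 12]], of n n n n]
    by (simp add: pcomp aG)
  ultimately have "complex_of_real (q * (norm (X 0 1))\<^sup>2 * (norm (X 1 (1 + 1)))\<^sup>2)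
      = complex_of_real (q' * (norm (\<xi> 0 1))\<^sup>2 * (norm (\<xi> 1 (1 + 1)))\<^sup>2)"
    using LIMSEQ_unique by simp
  then have "complex_of_real q = complex_of_real q'"
    by (simp only: nX[OF 01] nX[OF 12] n\<xi>[OF 01] n\<xi>[OF 12]) simp
  then show ?thesis by simp
qed

lemma not_isomorphic_if_crossing_weights:
  fixes S :: "'h::chilbert_space bernoulli_data" and S' :: "'k::chilbert_space bernoulli_data"
  assumes "crossing_weight q t" "crossing_weight q' t'" "q \<noteq> q'"
    and "bernoulli_system_of_gbm t S" "bernoulli_system_of_gbm t' S'"
  shows "\<not> isomorphic_bernoulli_systems S S'"
  using assms isomorphic_imp_eq unfolding bernoulli_system_of_gbm_def gbm_def by metis

theorem corollary3p4:
  fixes q q' :: real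
    and S :: "'h::chilbert_space bernoulli_data"
    and S' :: "'k::chilbert_space bernoulli_data"
  assumes "-1 \<le> q" "q \<le> 1" "-1 \<le> q'" "q' \<le> 1" "q \<noteq> q'"
  shows "(bernoulli_system_of_gbm (q_weight q) S \<and>
            bernoulli_system_of_gbm (q_weight q') S' \<longrightarrow>
            \<not> isomorphic_bernoulli_systems S S') \<and>
         (bernoulli_system_of_gbm (bozejko_speicher_weight q) S \<and>
            bernoulli_system_of_gbm (bozejko_speicher_weight q') S' \<longrightarrow>
            \<not> isomorphic_bernoulli_systems S S')"
  using not_isomorphic_if_crossing_weights[OF crossing_weight_q_weight crossing_weight_q_weight assms(5)]
    not_isomorphic_if_crossing_weights[OF crossing_weight_bozejko_speicher_weight
      crossing_weight_bozejko_speicher_weight assms(5)]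
  by blast

end
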